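(* Let $(z,z')\in\mathbb C^2$ be admissible, let $P_{z,z'}$ be the associated probability measure on the Thoma simplex $\Omega$, and let $\widetilde P_{z,z'}$ be its lifting to the Thoma cone $\widetilde\Omega$ with parameter $c=zz'$. (i) The measure $\widetilde P_{z,z'}$ is an orthogonality measure for the Laguerre symmetric functions with the same parameters $(z,z')$; that is, $$\varphi^{\mathsf L}_{z,z'}(F)=\int_{\widetilde\Omega}F(\widetilde\omega)\,\widetilde P_{z,z'}(d\widetilde\omega)\qquad\text{for all }F\in\mathrm{Sym}.$$ (ii) If $(z,z')$ is in the principal or complementary series, then the Laguerre symmetric functions $\mathfrak L_\nu$, $\nu\in\mathbb Y$, with parameters $(z,z')$ form an orthogonal basis in the Hilbert space $L^2(\widetilde\Omega,\widetilde P_{z,z'})$.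
   Context: $\mathbb Y$ is the set of all partitions (Young diagrams); $|\nu|$ is the number of boxes of $\nu$. For a box $\square=(i,j)$ (row $i$, column $j$), $c(\square)=j-i$; for $\mu\subseteq\nu$, $(z)_{\nu/\mu}=\prod_{\square\in\nu/\mu}(z+c(\square))$, $(z)_\nu=(z)_{\nu/\varnothing}$; $(x)_n=x(x+1)\cdots(x+n-1)$; $\dim\nu/\mu$ is the number of standard tableaux of skew shape $\nu/\mu$, $\dim\nu=\dim\nu/\varnothing$. $\mathrm{Sym}$ is the algebra of symmetric functions over $\mathbb R$, freely generated by the power sums $p_k$; $\mathrm{Sym}_{\mathbb C}$ is its complexification; $S_\nu$ are the Schur functions. Laguerre symmetric functions: $\mathfrak L_\nu=\sum_{\mu\subseteq\nu}(-1)^{|\nu|-|\mu|}\frac{\dim\nu/\mu}{(|\nu|-|\mu|)!}(z)_{\nu/\mu}(z')_{\nu/\mu}S_\mu$. They form a basis of $\mathrm{Sym}_{\mathbb C}$, and the formal moment functional $\varphi^{\mathsf L}_{z,z'}:\mathrm{Sym}_{\mathbb C}\to\mathbb C$ is the linear functional with $\varphi^{\mathsf L}_{z,z'}(\mathfrak L_\nu)=\delta_{\nu\varnothing}$. Admissibility: $(z,z')\in\mathbb C^2$ is admissible if $z\ne0$, $z'\ne0$ and $(z)_\nu(z')_\nu\ge0$ for all $\nu\in\mathbb Y$ (then $zz'>0$). Principal series: $z'=\bar z\in\mathbb C\setminus\mathbb Z$. Complementary series: $z,z'$ real with $k<z,z'<k+1$ for some $k\in\mathbb Z$. Both series consist of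 admissible pairs. The Thoma cone $\widetilde\Omega$ is the set of triples $\widetilde\omega=(\alpha,\beta,r)\in\mathbb R_+^\infty\times\mathbb R_+^\infty\times\mathbb R_+$ with $\alpha_1\ge\alpha_2\ge\dots\ge0$, $\beta_1\ge\beta_2\ge\dots\ge0$, $\sum\alpha_i+\sum\beta_i\le r$, with the topology induced by the product topology. The Thoma simplex $\Omega$ is the (compact) subset of triples with $r=1$, whose points are written $\omega=(\alpha,\beta)$. Elements of $\mathrm{Sym}$ are realized as continuous functions on $\widetilde\Omega$ (and, by restriction, on $\Omega$) via the algebra morphism defined by $p_1(\alpha,\beta,r)=r$ and $p_k(\alpha,\beta,r)=\sum_i\alpha_i^k+(-1)^{k-1}\sum_i\beta_i^k$ for $k\ge2$. All measures are Borel. Measure $P_{z,z'}$: for admissible $(z,z')$ there exists a unique probability measure $P=P_{z,z'}$ on $\Omega$ such that $$\int_\Omega S_\nu(\omega)P(d\omega)=\frac{(z)_\nu(z')_\nu}{(zz')_{|\nu|}}\frac{\dim\nu}{|\nu|!}\qquad\text{for all }\nu\in\mathbb Y.$$ Lifting: for a probability measure $P$ on $\Omega$ and $c>0$, its lifting with parameter $c$ is the push-forward of $P\otimes\gamma_c$ under the map $\Omega\times\mathbb R_{>0}\to\widetilde\Omega$, $((\alpha,\beta),r)\mapsto(r\alpha,r\beta,r)$, where $\gamma_c(dr)=\frac1{\Gamma(c)}r^{c-1}e^{-r}dr$ on $\mathbb R_{>0}$. *)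

theory Defs
  imports
    "HOL-Probability.Probability"
    "HOL-Library.Poly_Mapping"
    "Jordan_Normal_Form.Determinant"
begin

section \<open>Young diagrams\<close>

text \<open>A partition is the list of its nonzero parts; rows and columns of its diagram are numbered
  from 0, which does not affect the contents.\<close>

definition young :: "nat list set" where
  "young = {\<nu>. sorted_wrt (\<ge>) \<nu> \<and> 0 \<notin> set \<nu>}"

definition boxes :: "nat list \<Rightarrow> (nat \<times> nat) set" where
  "boxes \<nu> = {(i, j). i < length \<nu> \<and> j < \<nu> ! i}"

definition skew :: "nat list \<Rightarrow> nat list \<Rightarrow> (nat \<times> nat) set" where
  "skew \<nu> \<mu> = boxes \<nu> - boxes \<mu>"

definition content :: "nat \<times> nat \<Rightarrow> int" where
  "content b = int (snd b) - int (fst b)"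

definition skew_pochhammer :: "complex \<Rightarrow> nat list \<Rightarrow> nat list \<Rightarrow> complex" where
  "skew_pochhammer z \<nu> \<mu> = (\<Prod>b\<in>skew \<nu> \<mu>. z + of_int (content b))"

definition standard_tableaux :: "nat list \<Rightarrow> nat list \<Rightarrow> (nat \<times> nat \<Rightarrow> nat) set" where
  "standard_tableaux \<nu> \<mu> =
    {T \<in> extensional (skew \<nu> \<mu>).
       bij_betw T (skew \<nu> \<mu>) {1..card (skew \<nu> \<mu>)} \<and>
       (\<forall>i j j'. (i, j) \<in> skew \<nu> \<mu> \<and> (i, j') \<in> skew \<nu> \<mu> \<and> j < j' \<longrightarrow> T (i, j) < T (i, j')) \<and>
       (\<forall>i i' j. (i, j) \<in> skew \<nu> \<mu> \<and> (i', j) \<in> skew \<nu> \<mu> \<and> i < i' \<longrightarrow> T (i, j) < T (i', j))}"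

definition skew_dim :: "nat list \<Rightarrow> nat list \<Rightarrow> nat" where
  "skew_dim \<nu> \<mu> = card (standard_tableaux \<nu> \<mu>)"

section \<open>Symmetric functions\<close>

text \<open>The algebra of symmetric functions is the polynomial algebra in the power sums
  \<open>p\<^sub>1, p\<^sub>2, \<dots>\<close>; the variable with index \<open>k\<close> stands for \<open>p\<^bsub>k+1\<^esub>\<close>. The coefficients are the real
  numbers for Sym itself and the complex numbers for its complexification.\<close>

type_synonym 'a sym = "(nat \<Rightarrow>\<^sub>0 nat) \<Rightarrow>\<^sub>0 'a"

definition sym_const :: "'a::comm_ring_1 \<Rightarrow> 'a sym" where
  "sym_const a = Poly_Mapping.single 0 a"

definition power_sum :: "nat \<Rightarrow> 'a::comm_ring_1 sym" where
  "power_sum k = Poly_Mapping.single (Poly_Mapping.single (k - 1) 1) 1"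

definition complexify :: "real sym \<Rightarrow> complex sym" where
  "complexify F = Poly_Mapping.map complex_of_real F"

text \<open>Newton's identities \<open>n h\<^sub>n = p\<^sub>1 h\<^bsub>n-1\<^esub> + \<dots> + p\<^sub>n h\<^sub>0\<close> for the complete homogeneous
  symmetric functions.\<close>

fun complete_hom :: "nat \<Rightarrow> 'a::field_char_0 sym" where
  "complete_hom 0 = 1"
| "complete_hom (Suc n) =
     sym_const (1 / of_nat (Suc n)) * (\<Sum>k\<le>n. power_sum (Suc k) * complete_hom (n - k))"

text \<open>Jacobi--Trudi: \<open>S\<^sub>\<nu> = det (h\<^bsub>\<nu>\<^sub>i - i + j\<^esub>)\<close>, with \<open>h\<^sub>n = 0\<close> for \<open>n < 0\<close>.\<close>

definition schur :: "nat list \<Rightarrow> 'a::field_char_0 sym" where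
  "schur \<nu> = Determinant.det (Matrix.mat (length \<nu>) (length \<nu>)
     (\<lambda>(i, j). if i \<le> \<nu> ! i + j then complete_hom (\<nu> ! i + j - i) else 0))"

definition laguerre_sym :: "complex \<Rightarrow> complex \<Rightarrow> nat list \<Rightarrow> complex sym" where
  "laguerre_sym z z' \<nu> =
    (\<Sum>\<mu> | \<mu> \<in> young \<and> boxes \<mu> \<subseteq> boxes \<nu>.
       sym_const ((-1) ^ (sum_list \<nu> - sum_list \<mu>) *
         (of_nat (skew_dim \<nu> \<mu>) / fact (sum_list \<nu> - sum_list \<mu>)) *
         skew_pochhammer z \<nu> \<mu> * skew_pochhammer z' \<nu> \<mu>) * schur \<mu>)"

definition laguerre_functional :: "complex \<Rightarrow> complex \<Rightarrow> complex sym \<Rightarrow> complex" where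
  "laguerre_functional z z' =
    (THE \<phi>. Vector_Spaces.linear (\<lambda>a F. sym_const a * F) (*) \<phi> \<and>
            (\<forall>\<nu>\<in>young. \<phi> (laguerre_sym z z' \<nu>) = (if \<nu> = [] then 1 else 0)))"

section \<open>Parameters\<close>

definition admissible :: "complex \<Rightarrow> complex \<Rightarrow> bool" where
  "admissible z z' \<longleftrightarrow> z \<noteq> 0 \<and> z' \<noteq> 0 \<and>
     (\<forall>\<nu>\<in>young. skew_pochhammer z \<nu> [] * skew_pochhammer z' \<nu> [] \<in> \<real>\<^sub>\<ge>\<^sub>0)"

definition principal_series :: "complex \<Rightarrow> complex \<Rightarrow> bool" where
  "principal_series z z' \<longleftrightarrow> z' = cnj z \<and> z \<notin> \<int>"

definition complementary_series :: "complex \<Rightarrow> complex \<Rightarrow> bool" where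
  "complementary_series z z' \<longleftrightarrow> z \<in> \<real> \<and> z' \<in> \<real> \<and>
     (\<exists>k::int. of_int k < Re z \<and> Re z < of_int k + 1 \<and> of_int k < Re z' \<and> Re z' < of_int k + 1)"

section \<open>Thoma cone and Thoma simplex\<close>

text \<open>The topology on \<open>nat \<Rightarrow> real\<close> is the product topology, so the Borel sets of a subset of
  the following type are those of \<open>restrict_space borel\<close>.\<close>

type_synonym thoma_point = "(nat \<Rightarrow> real) \<times> (nat \<Rightarrow> real) \<times> real"

definition thoma_cone :: "thoma_point set" where
  "thoma_cone = {(\<alpha>, \<beta>, r). decseq \<alpha> \<and> decseq \<beta> \<and> (\<forall>i. 0 \<le> \<alpha> i) \<and> (\<forall>i. 0 \<le> \<beta> i) \<and> 0 \<le> r \<and>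
     summable \<alpha> \<and> summable \<beta> \<and> suminf \<alpha> + suminf \<beta> \<le> r}"

definition thoma_simplex :: "thoma_point set" where
  "thoma_simplex = {(\<alpha>, \<beta>, r) \<in> thoma_cone. r = 1}"

fun power_sum_at :: "nat \<Rightarrow> thoma_point \<Rightarrow> real" where
  "power_sum_at k (\<alpha>, \<beta>, r) =
    (if k = 1 then r else suminf (\<lambda>i. \<alpha> i ^ k) + (-1) ^ (k - 1) * suminf (\<lambda>i. \<beta> i ^ k))"

text \<open>The algebra morphism sending \<open>power_sum k\<close> to \<open>power_sum_at k\<close>.\<close>

definition sym_eval :: "'a::{real_algebra_1, comm_ring_1} sym \<Rightarrow> thoma_point \<Rightarrow> 'a" where
  "sym_eval F \<omega> = (\<Sum>m\<in>Poly_Mapping.keys F. Poly_Mapping.lookup F m *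
     (\<Prod>i\<in>Poly_Mapping.keys m. of_real (power_sum_at (Suc i) \<omega>) ^ Poly_Mapping.lookup m i))"

section \<open>Measures\<close>

text \<open>\<open>is_z_measure z z' P\<close> says that \<open>P\<close> is the measure \<open>P\<^bsub>z,z'\<^esub>\<close>.\<close>

definition is_z_measure :: "complex \<Rightarrow> complex \<Rightarrow> thoma_point measure \<Rightarrow> bool" where
  "is_z_measure z z' P \<longleftrightarrow> prob_space P \<and> sets P = sets (restrict_space borel thoma_simplex) \<and>
     (\<forall>\<nu>\<in>young. complex_of_real (\<integral>\<omega>. sym_eval (schur \<nu>) \<omega> \<partial>P) =
        skew_pochhammer z \<nu> [] * skew_pochhammer z' \<nu> [] / pochhammer (z * z') (sum_list \<nu>) *
        (of_nat (skew_dim \<nu> []) / fact (sum_list \<nu>)))"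

definition gamma_distr :: "real \<Rightarrow> real measure" where
  "gamma_distr c = density (restrict_space lborel {0<..})
     (\<lambda>r. ennreal (r powr (c - 1) * exp (- r) / Gamma c))"

definition lifting :: "thoma_point measure \<Rightarrow> real \<Rightarrow> thoma_point measure" where
  "lifting P c = distr (P \<Otimes>\<^sub>M gamma_distr c) (restrict_space borel thoma_cone)
     (\<lambda>((\<alpha>, \<beta>, _), r). (\<lambda>i. r * \<alpha> i, \<lambda>i. r * \<beta> i, r))"

definition square_integrable :: "'x measure \<Rightarrow> ('x \<Rightarrow> complex) \<Rightarrow> bool" where
  "square_integrable M f \<longleftrightarrow> f \<in> borel_measurable M \<and> integrable M (\<lambda>x. (cmod (f x))\<^sup>2)"

text \<open>Orthogonal bases of the complex Hilbert space \<open>L\<^sup>2(M)\<close>: nonzero, pairwise orthogonal vectors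
  with dense linear span.\<close>

definition orthogonal_basis_L2 :: "'x measure \<Rightarrow> 'i set \<Rightarrow> ('i \<Rightarrow> 'x \<Rightarrow> complex) \<Rightarrow> bool" where
  "orthogonal_basis_L2 M I f \<longleftrightarrow>
     (\<forall>i\<in>I. square_integrable M (f i) \<and> (\<integral>x. (cmod (f i x))\<^sup>2 \<partial>M) \<noteq> 0) \<and>
     (\<forall>i\<in>I. \<forall>j\<in>I. i \<noteq> j \<longrightarrow> (\<integral>x. f i x * cnj (f j x) \<partial>M) = 0) \<and>
     (\<forall>g. square_integrable M g \<longrightarrow> (\<forall>\<epsilon>>0. \<exists>J a. finite J \<and> J \<subseteq> I \<and>
        (\<integral>x. (cmod (g x - (\<Sum>i\<in>J. a i * f i x)))\<^sup>2 \<partial>M) < \<epsilon>))"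

end

theory Submission
  imports Defs
begin

text \<open>Let \<open>D\<close> be the operator \<open>S\<^sub>\<nu> \<mapsto> \<Sum> (z + c(b)) (z' + c(b)) S\<^bsub>\<nu> - b\<^esub>\<close>, summed over the removable boxes \<open>b\<close>.
  Counting standard tableaux box by box gives \<open>L\<^sub>\<nu> = e\<^bsup>-D\<^esup> S\<^sub>\<nu>\<close>, so the moment functional is \<open>F \<mapsto> \<langle>1\<rangle> e\<^sup>D F\<close>,
  where \<open>\<langle>1\<rangle>\<close> takes the coefficient of \<open>S\<^sub>\<emptyset> = 1\<close>. The Schur functions are homogeneous, hence integrating \<open>S\<^sub>\<nu>\<close> against the
  lifting multiplies its integral over the simplex by \<open>(zz')\<^bsub>|\<nu>|\<^esub>\<close>, which yields the same value
  \<open>(z)\<^sub>\<nu> (z')\<^sub>\<nu> dim \<nu> / |\<nu>|!\<close>.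

  Orthogonality amounts to \<open>\<langle>1\<rangle> e\<^sup>D (F G) = (e\<^sup>D F, e\<^sup>D G)\<close> for the form with \<open>(S\<^sub>\<nu>, S\<^sub>\<mu>) = \<delta>\<^bsub>\<nu>\<mu>\<^esub> (z)\<^sub>\<nu> (z')\<^sub>\<nu>\<close>,
  that is, to the symmetry of all multiplication operators after conjugation by \<open>e\<^sup>D\<close>. For \<open>p\<^sub>1\<close> this is a
  computation with operators adding and removing boxes; the other \<open>p\<^sub>k\<close> are obtained by repeated commutators
  with an operator whose conjugate is skew-symmetric.

  For the density, the bounded multipliers of the \<open>L\<^sup>2\<close>-closure of the symmetric functions determine a
  \<open>\<sigma>\<close>-algebra. It makes \<open>exp (- r / 4)\<close> measurable because the lifting has exponential moments in \<open>r\<close>, hence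
  all power sums, and then all Thoma coordinates, which the power sums determine by a moment argument.
  So every indicator function, and hence every square integrable function, lies in the closure.\<close>

section \<open>The polynomial algebra of symmetric functions\<close>

text \<open>Conjugating multiplication by p_k directly would need chains of commutators with D whose
  length grows with k. The chains for p_1, p_2 and the derivation p_k -> k p_{k+1} stay short: all
  operators in them add boxes, remove boxes, or measure size and sum of contents, and the basic
  commutators are second differences of polynomials in the content. The conjugate of p_1 is p_1 + (2
  size + z z') + D, symmetric because D is the adjoint of p_1. The conjugate of the derivation alone
  is neither symmetric nor skew; adding multiples of p_1 and p_2 makes it skew, and as these commute
  with every p_k, the commutators producing p_{k+1} are unaffected. The chain for p_2 ends because
  the adjoints of p_1 and p_2 commute, which is read off from a nondegenerate form; here the
  principal and complementary series enter.

  Moreover p_1 evaluates to r and not to the sum of the coordinates, so the coordinates have to be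
  recovered from p_k with k \<ge> 2 and r.\<close>

abbreviation mon :: "(nat \<Rightarrow>\<^sub>0 nat) \<Rightarrow> 'a::comm_ring_1 sym" where
  "mon m \<equiv> Poly_Mapping.single m 1"

lemma sym_const_add: "sym_const (a + b) = sym_const a + sym_const b"
  by (simp add: sym_const_def single_add)

lemma sym_const_diff: "sym_const (a - b) = sym_const a - sym_const b"
  by (simp add: sym_const_def single_diff)

lemma sym_const_uminus: "sym_const (- a) = - sym_const a"
  by (simp add: sym_const_def single_uminus)

lemma sym_const_mult: "sym_const (a * b) = sym_const a * sym_const b"
  by (simp add: sym_const_def mult_single)

lemma sym_const_0 [simp]: "sym_const 0 = 0"
  by (simp add: sym_const_def)

lemma sym_const_1 [simp]: "sym_const 1 = 1"
  by (simp add: sym_const_def)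

lemma sym_const_of_nat: "sym_const (of_nat n) = of_nat n"
  by (induction n) (simp_all add: sym_const_add)

lemma sym_const_of_int: "sym_const (of_int n) = of_int n"
  by (cases n) (simp_all add: sym_const_of_nat sym_const_uminus sym_const_diff)

lemma sym_const_numeral: "sym_const (numeral n) = numeral n"
  using sym_const_of_nat[of "numeral n"] by simp

lemma sym_const_sum: "sym_const (sum f A) = (\<Sum>x\<in>A. sym_const (f x))"
  by (induction A rule: infinite_finite_induct) (simp_all add: sym_const_add)

lemma sym_const_inverse_of_nat:
  fixes F :: "'a::field_char_0 sym"
  assumes "n \<noteq> 0"
  shows "sym_const (1 / of_nat n) * (of_nat n * F) = F"
proof -
  have "sym_const (1 / of_nat n :: 'a) * of_nat n = (1 :: 'a sym)"
    unfolding sym_const_of_nat[symmetric] sym_const_mult[symmetric] using assms by simp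
  then show ?thesis by (simp add: mult.assoc[symmetric])
qed

lemma sym_const_times_mon: "sym_const a * mon m = Poly_Mapping.single m a"
  by (simp add: sym_const_def mult_single)

lemma mon_add: "mon (m + n) = mon m * mon n"
  by (simp add: mult_single)

interpretation sym: vector_space "\<lambda>(a::'a::field_char_0) (F::'a sym). sym_const a * F"
  by unfold_locales (simp_all add: sym_const_add sym_const_mult algebra_simps)

definition mon_ext :: "((nat \<Rightarrow>\<^sub>0 nat) \<Rightarrow> 'b::comm_ring_1 sym) \<Rightarrow> 'b sym \<Rightarrow> 'b sym" where
  "mon_ext g F = (\<Sum>m\<in>Poly_Mapping.keys F. sym_const (Poly_Mapping.lookup F m) * g m)"

lemma mon_ext_superset:
  assumes "finite K" "Poly_Mapping.keys F \<subseteq> K"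
  shows "mon_ext g F = (\<Sum>m\<in>K. sym_const (Poly_Mapping.lookup F m) * g m)"
  unfolding mon_ext_def
  by (rule sum.mono_neutral_left) (use assms in \<open>auto simp: in_keys_iff\<close>)

lemma mon_ext_add: "mon_ext g (F + G) = mon_ext g F + mon_ext g G"
proof -
  let ?K = "Poly_Mapping.keys F \<union> Poly_Mapping.keys G"
  have K: "finite ?K" by simp
  show ?thesis
    using mon_ext_superset[OF K, of "F + G" g] mon_ext_superset[OF K, of F g]
      mon_ext_superset[OF K, of G g] keys_add[of F G]
    by (simp add: lookup_add sym_const_add algebra_simps sum.distrib)
qed

lemma lookup_sym_const_times:
  "Poly_Mapping.lookup (sym_const a * F) m = a * Poly_Mapping.lookup F m"
proof -
  have "sym_const a * F = Poly_Mapping.map ((*) a) F"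
    by (simp add: mult_map_scale_conv_mult sym_const_def)
  then show ?thesis by (simp add: map.rep_eq when_def)
qed

lemma mon_ext_const: "mon_ext g (sym_const a * F) = sym_const a * mon_ext g F"
proof -
  have "mon_ext g (sym_const a * F) =
      (\<Sum>m\<in>Poly_Mapping.keys F. sym_const (Poly_Mapping.lookup (sym_const a * F) m) * g m)"
    by (rule mon_ext_superset) (auto simp: in_keys_iff lookup_sym_const_times)
  then show ?thesis
    by (simp add: lookup_sym_const_times sym_const_mult mon_ext_def sum_distrib_left mult.assoc)
qed

lemma mon_ext_mon [simp]: "mon_ext g (mon m) = g m"
  by (simp add: mon_ext_def)

lemma mon_ext_0 [simp]: "mon_ext g 0 = 0"
  by (simp add: mon_ext_def)

lemma sym_expand: "F = mon_ext mon F"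
proof (rule poly_mapping_eqI)
  fix k
  have "Poly_Mapping.lookup (mon_ext mon F) k =
      (\<Sum>m\<in>Poly_Mapping.keys F. if m = k then Poly_Mapping.lookup F m else 0)"
    by (simp add: mon_ext_def lookup_sum sym_const_times_mon lookup_single when_def)
  then show "Poly_Mapping.lookup F k = Poly_Mapping.lookup (mon_ext mon F) k"
    by (simp add: in_keys_iff)
qed

lemma sym_induct [case_names mon add const]:
  fixes F :: "'b::comm_ring_1 sym"
  assumes "\<And>m. P (mon m)" "\<And>F G. P F \<Longrightarrow> P G \<Longrightarrow> P (F + G)" "\<And>a F. P F \<Longrightarrow> P (sym_const a * F)"
  shows "P F"
proof -
  have P0: "P 0" using assms(3)[OF assms(1), of 0] by simp
  have "P (\<Sum>m\<in>K. sym_const (a m) * mon m)" if "finite K" for K a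
    using that by (induction K rule: finite_induct) (auto intro: assms P0)
  then show ?thesis by (subst sym_expand) (simp add: mon_ext_def)
qed

text \<open>The derivation \<open>p\<^sub>k \<mapsto> k p\<^bsub>k+1\<^esub>\<close>. Together with multiplication by \<open>p\<^sub>1\<close> it generates
  the multiplications by all \<open>p\<^sub>k\<close>, and on Schur functions both just add boxes.\<close>

definition raise_der :: "'b::comm_ring_1 sym \<Rightarrow> 'b sym" where
  "raise_der = mon_ext (\<lambda>m. \<Sum>k\<in>Poly_Mapping.keys m.
     of_nat (Poly_Mapping.lookup m k * Suc k) *
     mon (m - Poly_Mapping.single k 1 + Poly_Mapping.single (Suc k) 1))"

lemma raise_der_add: "raise_der (F + G) = raise_der F + raise_der G"
  by (simp add: raise_der_def mon_ext_add)

lemma raise_der_const_times: "raise_der (sym_const a * F) = sym_const a * raise_der F"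
  by (simp add: raise_der_def mon_ext_const)

lemma raise_der_0 [simp]: "raise_der 0 = 0"
  by (simp add: raise_der_def)

lemma raise_der_mon_superset:
  assumes "finite K" "Poly_Mapping.keys m \<subseteq> K"
  shows "raise_der (mon m :: 'b::comm_ring_1 sym) = (\<Sum>k\<in>K.
     of_nat (Poly_Mapping.lookup m k * Suc k) *
     mon (m - Poly_Mapping.single k 1 + Poly_Mapping.single (Suc k) 1))"
  unfolding raise_der_def mon_ext_mon
  by (rule sum.mono_neutral_left) (use assms in \<open>auto simp: in_keys_iff\<close>)

lemma raise_der_mult_mon:
  "raise_der (mon m * mon n :: 'b::comm_ring_1 sym) = raise_der (mon m) * mon n + mon m * raise_der (mon n)"
proof -
  let ?K = "Poly_Mapping.keys m \<union> Poly_Mapping.keys n"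
  have K: "finite ?K" by simp
  \<comment> \<open>Subtraction of exponents is truncated, so it commutes with adding
    \<open>n\<close> only if \<open>k\<close> occurs in \<open>m\<close>; otherwise the coefficient
    is 0.\<close>
  have shift: "of_nat (Poly_Mapping.lookup m k * Suc k) *
       mon ((m + n) - Poly_Mapping.single k 1 + Poly_Mapping.single (Suc k) 1) =
     (of_nat (Poly_Mapping.lookup m k * Suc k) *
       mon (m - Poly_Mapping.single k 1 + Poly_Mapping.single (Suc k) 1)) * (mon n :: 'b sym)" for m n k
  proof (cases "Poly_Mapping.lookup m k = 0")
    case False
    have "(m + n) - Poly_Mapping.single k 1 + Poly_Mapping.single (Suc k) 1 =
        (m - Poly_Mapping.single k 1 + Poly_Mapping.single (Suc k) 1) + n"
      by (rule poly_mapping_eqI) (use False in \<open>auto simp: lookup_add lookup_minus lookup_single when_def\<close>)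
    then show ?thesis by (simp only: mon_add mult.assoc)
  qed simp
  have "raise_der (mon (m + n) :: 'b sym) = (\<Sum>k\<in>?K.
      of_nat (Poly_Mapping.lookup (m + n) k * Suc k) *
      mon ((m + n) - Poly_Mapping.single k 1 + Poly_Mapping.single (Suc k) 1))"
    by (rule raise_der_mon_superset[OF K keys_add])
  also have "\<dots> = (\<Sum>k\<in>?K. of_nat (Poly_Mapping.lookup m k * Suc k) *
       mon ((m + n) - Poly_Mapping.single k 1 + Poly_Mapping.single (Suc k) 1)
      + of_nat (Poly_Mapping.lookup n k * Suc k) *
       mon ((n + m) - Poly_Mapping.single k 1 + Poly_Mapping.single (Suc k) 1))"
    by (rule sum.cong[OF refl]) (simp only: lookup_add of_nat_add distrib_right add.commute)
  also have "\<dots> = raise_der (mon m) * mon n + mon m * raise_der (mon n)"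
    unfolding shift sum.distrib
    by (subst (1 2) raise_der_mon_superset[OF K])
      (simp_all only: sum_distrib_right mult.commute[of "mon m"] Un_upper1 Un_upper2)
  finally show ?thesis by (simp only: mon_add)
qed

lemma raise_der_mult:
  fixes F G :: "'b::comm_ring_1 sym"
  shows "raise_der (F * G) = raise_der F * G + F * raise_der G"
proof (induction F rule: sym_induct)
  case (mon m)
  show ?case
  proof (induction G rule: sym_induct)
    case (mon n)
    show ?case by (rule raise_der_mult_mon)
  next
    case (add F G)
    then show ?case by (simp add: raise_der_add algebra_simps)
  next
    case (const a F)
    then show ?case
      by (simp add: raise_der_const_times mult.left_commute[of "mon m"] distrib_left
          mult.left_commute[of "raise_der (mon m)"])
  qed
next
  case (add F F')
  then show ?case by (simp add: raise_der_add algebra_simps)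
qed (simp add: raise_der_const_times mult.assoc distrib_left)

lemma raise_der_1 [simp]: "raise_der 1 = 0"
  using raise_der_mult[of 1 1] by simp

lemma raise_der_uminus: "raise_der (- F) = - raise_der F"
  using raise_der_add[of F "- F"] by (simp add: eq_neg_iff_add_eq_0 add.commute)

lemma raise_der_sum: "raise_der (sum f A) = (\<Sum>x\<in>A. raise_der (f x))"
  by (induction A rule: infinite_finite_induct) (simp_all add: raise_der_add)

lemma raise_der_power_sum: "raise_der (power_sum (Suc k)) = of_nat (Suc k) * power_sum (Suc (Suc k))"
  by (simp add: power_sum_def raise_der_def)

lemma raise_der_of_nat_times: "raise_der (of_nat n * F) = of_nat n * raise_der F"
  by (simp flip: sym_const_of_nat add: raise_der_const_times)

section \<open>Newton's identities and the derivation on complete homogeneous functions\<close>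

lemma newton_complete_hom:
  "of_nat (Suc n) * complete_hom (Suc n) =
    (\<Sum>k\<le>n. power_sum (Suc k) * complete_hom (n - k) :: 'a::field_char_0 sym)"
  unfolding complete_hom.simps
  using sym_const_inverse_of_nat[of "Suc n"
    "\<Sum>k\<le>n. power_sum (Suc k) * complete_hom (n - k) :: 'a sym"]
  by (simp only: mult.left_commute[of "of_nat _"] nat.simps not_False_eq_True)

lemma complete_hom_1: "complete_hom (Suc 0) = power_sum (Suc 0)"
  by simp

declare complete_hom.simps(2) [simp del]

text \<open>In generating functions: \<open>H = exp (\<Sum> p\<^sub>k t\<^sup>k / k)\<close> gives \<open>H' - p\<^sub>1 H\<close> for the image of \<open>H\<close>.\<close>

lemma raise_der_complete_hom:
  "raise_der (complete_hom n :: 'a::field_char_0 sym) =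
     of_nat (Suc n) * complete_hom (Suc n) - power_sum 1 * complete_hom n"
proof (induction n rule: less_induct)
  case (less n)
  show ?case
  proof (cases n)
    case 0
    then show ?thesis by (simp add: complete_hom_1)
  next
    case (Suc m)
    let ?h = "complete_hom :: nat \<Rightarrow> 'a sym" and ?p = "power_sum :: nat \<Rightarrow> 'a sym"
    have "of_nat (Suc m) * raise_der (?h (Suc m)) = raise_der (\<Sum>k\<le>m. ?p (Suc k) * ?h (m - k))"
      by (simp only: newton_complete_hom flip: raise_der_of_nat_times)
    also have "\<dots> = (\<Sum>k\<le>m. of_nat (Suc k) * (?p (Suc (Suc k)) * ?h (m - k))
        + ?p (Suc k) * (of_nat (Suc (m - k)) * ?h (Suc (m - k)) - ?p 1 * ?h (m - k)))"
      unfolding raise_der_sum raise_der_mult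
      by (rule sum.cong[OF refl]) (simp add: raise_der_power_sum less Suc del: of_nat_Suc)
    also have "\<dots> = (\<Sum>k\<le>m. of_nat (Suc k) * (?p (Suc (Suc k)) * ?h (m - k)))
        + (\<Sum>k\<le>m. of_nat (Suc m - k) * (?p (Suc k) * ?h (Suc m - k)))
        - ?p 1 * (\<Sum>k\<le>m. ?p (Suc k) * ?h (m - k))"
      by (simp add: sum.distrib sum_subtractf sum_distrib_left algebra_simps Suc_diff_le)
    also have "(\<Sum>k\<le>m. of_nat (Suc k) * (?p (Suc (Suc k)) * ?h (m - k)))
        = (\<Sum>k\<le>Suc m. of_nat k * (?p (Suc k) * ?h (Suc m - k)))"
      by (subst sum.atMost_Suc_shift) simp
    also have "(\<Sum>k\<le>m. of_nat (Suc m - k) * (?p (Suc k) * ?h (Suc m - k)))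
        = (\<Sum>k\<le>Suc m. of_nat (Suc m - k) * (?p (Suc k) * ?h (Suc m - k)))"
      by simp
    \<comment> \<open>After the index shift both sums run over the same products, and the
      coefficients k and \<open>Suc m - k\<close> add up to the constant \<open>Suc m\<close>;
      Newton's identity of the next degree applies.\<close>
    also have "(\<Sum>k\<le>Suc m. of_nat k * (?p (Suc k) * ?h (Suc m - k))) + \<dots>
        = (\<Sum>k\<le>Suc m. of_nat (Suc m) * (?p (Suc k) * ?h (Suc m - k)))"
      unfolding sum.distrib[symmetric] distrib_right[symmetric] of_nat_add[symmetric] by simp
    also have "\<dots> = of_nat (Suc m) * (of_nat (Suc (Suc m)) * ?h (Suc (Suc m)))"
      by (simp only: newton_complete_hom flip: sum_distrib_left)
    also have "(\<Sum>k\<le>m. ?p (Suc k) * ?h (m - k)) = of_nat (Suc m) * ?h (Suc m)"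
      by (simp only: newton_complete_hom)
    finally have eq: "of_nat (Suc m) * raise_der (?h (Suc m)) =
        of_nat (Suc m) * (of_nat (Suc (Suc m)) * ?h (Suc (Suc m)) - ?p 1 * ?h (Suc m))"
      by (simp add: algebra_simps del: of_nat_Suc)
    have "raise_der (?h (Suc m)) = of_nat (Suc (Suc m)) * ?h (Suc (Suc m)) - ?p 1 * ?h (Suc m)"
      using arg_cong[OF eq, of "(*) (sym_const (1 / of_nat (Suc m)))"]
      by (simp only: sym_const_inverse_of_nat nat.simps not_False_eq_True)
    then show ?thesis by (simp only: Suc)
  qed
qed

section \<open>Determinants and the addition of a box\<close>

text \<open>Matrices given by functions of two indices: replacing a row or a column becomes an
  if-expression, free of carrier conditions.\<close>

definition detf :: "nat \<Rightarrow> (nat \<Rightarrow> nat \<Rightarrow> 'r::comm_ring_1) \<Rightarrow> 'r" where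
  "detf n a = Determinant.det (Matrix.mat n n (\<lambda>(i, j). a i j))"

lemma detf_expand:
  "detf n a = (\<Sum>p | p permutes {0..<n}. signof p * (\<Prod>i\<in>{0..<n}. a i (p i)))"
proof -
  have "(\<Prod>i\<in>{0..<n}. Matrix.mat n n (\<lambda>(i, j). a i j) $$ (i, p i)) = (\<Prod>i\<in>{0..<n}. a i (p i))"
    if "p permutes {0..<n}" for p
    by (rule prod.cong[OF refl]) (use permutes_in_image[OF that] in auto)
  then show ?thesis
    unfolding detf_def by (subst det_def'[of _ n]) (auto intro!: sum.cong)
qed

lemma detf_cong:
  assumes "\<And>i j. i < n \<Longrightarrow> j < n \<Longrightarrow> a i j = b i j"
  shows "detf n a = detf n b"
  unfolding detf_def by (rule arg_cong[where f = Determinant.det]) (auto simp: assms)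

lemma detf_identical_rows:
  assumes "i \<noteq> k" "i < n" "k < n" "\<And>j. j < n \<Longrightarrow> a i j = a k j"
  shows "detf n a = 0"
  unfolding detf_def
  by (rule det_identical_rows[of _ n i k]) (use assms in auto)

lemma detf_identical_columns:
  assumes "j \<noteq> l" "j < n" "l < n" "\<And>i. i < n \<Longrightarrow> a i j = a i l"
  shows "detf n a = 0"
  unfolding detf_def
  by (rule det_identical_columns[of _ n j l]) (use assms in auto)

abbreviation row_subst :: "nat \<Rightarrow> (nat \<Rightarrow> 'r) \<Rightarrow> (nat \<Rightarrow> nat \<Rightarrow> 'r) \<Rightarrow> nat \<Rightarrow> nat \<Rightarrow> 'r" where
  "row_subst i b a \<equiv> \<lambda>k l. if k = i then b l else a k l"

abbreviation col_subst :: "nat \<Rightarrow> (nat \<Rightarrow> 'r) \<Rightarrow> (nat \<Rightarrow> nat \<Rightarrow> 'r) \<Rightarrow> nat \<Rightarrow> nat \<Rightarrow> 'r" where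
  "col_subst j b a \<equiv> \<lambda>k l. if l = j then b k else a k l"

lemma prod_subst_one:
  fixes f g :: "nat \<Rightarrow> 'r::comm_ring_1"
  assumes "i < n"
  shows "(\<Prod>k\<in>{0..<n}. if k = i then g k else f k) = g i * (\<Prod>k\<in>{0..<n} - {i}. f k)"
proof -
  have "(\<Prod>k\<in>{0..<n}. if k = i then g k else f k) =
      (if i = i then g i else f i) * (\<Prod>k\<in>{0..<n} - {i}. if k = i then g k else f k)"
    using assms by (intro prod.remove) auto
  also have "(\<Prod>k\<in>{0..<n} - {i}. if k = i then g k else f k) = (\<Prod>k\<in>{0..<n} - {i}. f k)"
    by (rule prod.cong) auto
  finally show ?thesis by simp
qed

lemma detf_row_expand:
  assumes "i < n"
  shows "detf n (row_subst i b a) =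
    (\<Sum>p | p permutes {0..<n}. signof p * (b (p i) * (\<Prod>k\<in>{0..<n} - {i}. a k (p k))))"
  unfolding detf_expand using prod_subst_one[OF assms]
  by (intro sum.cong refl arg_cong2[of _ _ _ _ "(*)"])

lemma detf_row_add:
  "i < n \<Longrightarrow> detf n (row_subst i (\<lambda>l. b l + c l) a) = detf n (row_subst i b a) + detf n (row_subst i c a)"
  by (simp only: detf_row_expand distrib_left distrib_right sum.distrib)

lemma detf_row_diff:
  "i < n \<Longrightarrow> detf n (row_subst i (\<lambda>l. b l - c l) a) = detf n (row_subst i b a) - detf n (row_subst i c a)"
  by (simp only: detf_row_expand left_diff_distrib right_diff_distrib sum_subtractf)

lemma detf_row_scale:
  "i < n \<Longrightarrow> detf n (row_subst i (\<lambda>l. x * b l) a) = x * detf n (row_subst i b a)"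
  by (simp only: detf_row_expand sum_distrib_left mult.left_commute[of x] mult.assoc)

text \<open>In the Leibniz expansion the factor of a permutation p in row i is also its only factor
  in column p i. Summing over the replaced row or over the replaced column therefore replaces each
  factor once, term by term.\<close>

lemma detf_rows_cols:
  "(\<Sum>i\<in>{0..<n}. detf n (row_subst i (b i) a)) = (\<Sum>j\<in>{0..<n}. detf n (col_subst j (\<lambda>k. b k j) a))"
proof -
  have "(\<Sum>i\<in>{0..<n}. \<Prod>k\<in>{0..<n}. row_subst i (b i) a k (p k)) =
      (\<Sum>j\<in>{0..<n}. \<Prod>k\<in>{0..<n}. col_subst j (\<lambda>k. b k j) a k (p k))"
    if p: "p permutes {0..<n}" for p
  proof -
    have "(\<Sum>j\<in>{0..<n}. \<Prod>k\<in>{0..<n}. col_subst j (\<lambda>k. b k j) a k (p k)) =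
        (\<Sum>i\<in>{0..<n}. \<Prod>k\<in>{0..<n}. col_subst (p i) (\<lambda>k. b k (p i)) a k (p k))"
      by (rule sum.reindex_bij_betw[symmetric]) (rule permutes_imp_bij[OF p])
    also have "\<dots> = (\<Sum>i\<in>{0..<n}. \<Prod>k\<in>{0..<n}. row_subst i (b i) a k (p k))"
      using permutes_inj[OF p] by (intro sum.cong prod.cong) (auto simp: inj_eq)
    finally show ?thesis by simp
  qed
  then show ?thesis
    unfolding detf_expand
    by (subst (1 2) sum.swap) (auto simp: sum_distrib_left[symmetric] intro!: sum.cong)
qed

lemma detf_transpose: "detf n a = detf n (\<lambda>i j. a j i)"
proof -
  have "Matrix.transpose_mat (Matrix.mat n n (\<lambda>(i, j). a i j)) = Matrix.mat n n (\<lambda>(i, j). a j i)"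
    by auto
  then show ?thesis unfolding detf_def by (metis det_transpose mat_carrier)
qed

lemma detf_col_scale:
  assumes "j < n"
  shows "detf n (col_subst j (\<lambda>k. x * b k) a) = x * detf n (col_subst j b a)"
  using detf_row_scale[OF assms, of x b "\<lambda>i j. a j i"]
  by (subst (1 2) detf_transpose) simp

lemma raise_der_prod:
  assumes "finite A"
  shows "raise_der (\<Prod>k\<in>A. f k) = (\<Sum>i\<in>A. \<Prod>k\<in>A. if k = i then raise_der (f k) else f k)"
  using assms
proof (induction A rule: finite_induct)
  case (insert x A)
  have "(\<Sum>i\<in>A. \<Prod>k\<in>insert x A. if k = i then raise_der (f k) else f k) =
      f x * (\<Sum>i\<in>A. \<Prod>k\<in>A. if k = i then raise_der (f k) else f k)"
    using insert.hyps by (auto simp: sum_distrib_left intro!: sum.cong)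
  moreover have "(\<Prod>k\<in>A. if k = x then raise_der (f k) else f k) = prod f A"
    using insert.hyps by (intro prod.cong) auto
  ultimately show ?case
    using insert.hyps by (simp add: raise_der_mult insert.IH)
qed simp

lemma raise_der_signof: "raise_der (signof p * F) = signof p * raise_der F"
  by (simp add: sign_def raise_der_uminus)

lemma raise_der_detf:
  "raise_der (detf n a) = (\<Sum>i\<in>{0..<n}. detf n (row_subst i (\<lambda>l. raise_der (a i l)) a))"
proof -
  have "raise_der (detf n a) = (\<Sum>p | p permutes {0..<n}. signof p *
      (\<Sum>i\<in>{0..<n}. \<Prod>k\<in>{0..<n}. if k = i then raise_der (a k (p k)) else a k (p k)))"
    by (simp add: detf_expand raise_der_sum raise_der_signof raise_der_prod)
  also have "\<dots> = (\<Sum>i\<in>{0..<n}. \<Sum>p | p permutes {0..<n}. signof p *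
      (\<Prod>k\<in>{0..<n}. if k = i then raise_der (a k (p k)) else a k (p k)))"
    unfolding sum_distrib_left by (rule sum.swap)
  also have "\<dots> = (\<Sum>i\<in>{0..<n}. detf n (row_subst i (\<lambda>l. raise_der (a i l)) a))"
    unfolding detf_expand by (intro sum.cong arg_cong2[of _ _ _ _ "(*)"] prod.cong refl) auto
  finally show ?thesis .
qed

section \<open>Jacobi--Trudi determinants under the increment of a row\<close>

definition complete_hom_int :: "int \<Rightarrow> 'a::field_char_0 sym" where
  "complete_hom_int m = (if m < 0 then 0 else complete_hom (nat m))"

text \<open>Extending h by 0 to negative indices is compatible with the formula: the critical index
  is m = -1, where the coefficient \<open>m + 1\<close> kills h_0 = 1.\<close>

lemma raise_der_complete_hom_int:
  "raise_der (complete_hom_int m :: 'a::field_char_0 sym) =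
     of_int (m + 1) * complete_hom_int (m + 1) - power_sum 1 * complete_hom_int m"
proof -
  consider "m < - 1" | "m = - 1" | "m \<ge> 0" by linarith
  then show ?thesis
  proof cases
    case 3
    then obtain n where m: "m = int n" using nonneg_int_cases by blast
    have "nat (int n + 1) = Suc n" by simp
    then show ?thesis
      using raise_der_complete_hom[of n, where 'a = 'a]
      by (simp add: m complete_hom_int_def add.commute)
  qed (simp_all add: complete_hom_int_def)
qed

text \<open>The Jacobi--Trudi determinant with \<open>a i = \<nu>\<^sub>i - i\<close>.\<close>

definition jacobi_trudi :: "nat \<Rightarrow> (nat \<Rightarrow> int) \<Rightarrow> 'a::field_char_0 sym" where
  "jacobi_trudi n a = detf n (\<lambda>i j. complete_hom_int (a i + int j))"

text \<open>The columns carry the shifts 0, ..., n - 2, n, with a gap at n - 1. By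
  \<open>sum_jacobi_trudi_incr\<close> this determinant is the sum of all increments of one
  row.\<close>

definition jacobi_trudi_gap :: "nat \<Rightarrow> (nat \<Rightarrow> int) \<Rightarrow> 'a::field_char_0 sym" where
  "jacobi_trudi_gap n a =
    detf n (col_subst (n - 1) (\<lambda>i. complete_hom_int (a i + int n)) (\<lambda>i j. complete_hom_int (a i + int j)))"

lemma jacobi_trudi_row_incr:
  "jacobi_trudi n (a(i := a i + 1)) =
     detf n (row_subst i (\<lambda>l. complete_hom_int (a i + int (Suc l))) (\<lambda>i j. complete_hom_int (a i + int j)))"
  unfolding jacobi_trudi_def by (rule detf_cong) (auto simp: algebra_simps)

lemma jacobi_trudi_eq_0:
  assumes "i \<noteq> k" "i < n" "k < n" "a i = a k"
  shows "jacobi_trudi n a = 0"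
  unfolding jacobi_trudi_def by (rule detf_identical_rows[OF assms(1-3)]) (simp add: assms(4))

text \<open>A shifted column j coincides with column j + 1, so its determinant vanishes; only the
  last column has no right neighbour.\<close>

lemma sum_col_shift:
  fixes a :: "nat \<Rightarrow> int" and x :: "nat \<Rightarrow> 'a::field_char_0 sym"
  assumes "n > 0"
  shows "(\<Sum>j\<in>{0..<n}. detf n (col_subst j (\<lambda>k. x j * complete_hom_int (a k + int (Suc j)))
      (\<lambda>i j. complete_hom_int (a i + int j)))) = x (n - 1) * jacobi_trudi_gap n a"
proof -
  have "detf n (col_subst j (\<lambda>k. x j * complete_hom_int (a k + int (Suc j)))
      (\<lambda>i j. complete_hom_int (a i + int j))) = (if j = n - 1 then x (n - 1) * jacobi_trudi_gap n a else 0)"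
    if j: "j < n" for j
  proof (cases "j = n - 1")
    case True
    then have "n = Suc j" using assms by simp
    then show ?thesis unfolding detf_col_scale[OF j] jacobi_trudi_gap_def by (simp only:) simp
  next
    case False
    then have "Suc j < n" using j by linarith
    then have "detf n (col_subst j (\<lambda>k. complete_hom_int (a k + int (Suc j)) :: 'a sym)
      (\<lambda>i j. complete_hom_int (a i + int j))) = 0"
      by (intro detf_identical_columns[of j "Suc j"]) auto
    then show ?thesis using False by (simp only: detf_col_scale[OF j]) simp
  qed
  then show ?thesis using assms by (simp add: sum.delta)
qed

lemma sum_jacobi_trudi_incr:
  fixes a :: "nat \<Rightarrow> int"
  assumes "n > 0"
  shows "(\<Sum>i\<in>{0..<n}. jacobi_trudi n (a(i := a i + 1))) = (jacobi_trudi_gap n a :: 'a::field_char_0 sym)"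
  unfolding jacobi_trudi_row_incr
  using detf_rows_cols[of n "\<lambda>i l. complete_hom_int (a i + int (Suc l))"
      "\<lambda>i j. complete_hom_int (a i + int j) :: 'a sym"] sum_col_shift[OF assms, of "\<lambda>_. 1" a]
  by (simp only: mult_1)

text \<open>The entry h_{a_i + j} produces the factor a_i + j + 1. The part a_i + 1 depends on the
  row only and factors out; the part j depends on the column only, and summed over columns it leaves
  n - 1 times the gap determinant, that is, n - 1 times the sum of all increments.\<close>

lemma raise_der_jacobi_trudi:
  fixes a :: "nat \<Rightarrow> int"
  assumes "n > 0"
  shows "raise_der (jacobi_trudi n a :: 'a::field_char_0 sym) =
    (\<Sum>i\<in>{0..<n}. of_int (a i + int n) * jacobi_trudi n (a(i := a i + 1)))
    - of_nat n * (power_sum 1 * jacobi_trudi n a)"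
proof -
  let ?A = "\<lambda>i j. complete_hom_int (a i + int j) :: 'a sym"
  have row: "detf n (row_subst i (\<lambda>l. raise_der (?A i l)) ?A) =
      of_int (a i + 1) * jacobi_trudi n (a(i := a i + 1)) +
      detf n (row_subst i (\<lambda>l. of_nat l * complete_hom_int (a i + int (Suc l))) ?A) -
      power_sum 1 * jacobi_trudi n a" if i: "i < n" for i
  proof -
    have "detf n (row_subst i (\<lambda>l. raise_der (?A i l)) ?A) =
        detf n (row_subst i (\<lambda>l. (of_int (a i + 1) * complete_hom_int (a i + int (Suc l)) +
        of_nat l * complete_hom_int (a i + int (Suc l))) - power_sum 1 * ?A i l) ?A)"
      by (rule detf_cong) (simp add: raise_der_complete_hom_int algebra_simps)
    moreover have "detf n (row_subst i (?A i) ?A) = jacobi_trudi n a"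
      unfolding jacobi_trudi_def by (rule detf_cong) auto
    ultimately show ?thesis
      by (simp only: detf_row_diff[OF i] detf_row_add[OF i] detf_row_scale[OF i] jacobi_trudi_row_incr)
  qed
  have "(\<Sum>i\<in>{0..<n}. detf n (row_subst i (\<lambda>l. of_nat l * complete_hom_int (a i + int (Suc l))) ?A))
      = of_nat (n - 1) * jacobi_trudi_gap n a"
    by (subst detf_rows_cols) (rule sum_col_shift[OF assms])
  also have "\<dots> = (\<Sum>i\<in>{0..<n}. of_nat (n - 1) * jacobi_trudi n (a(i := a i + 1)))"
    by (simp only: sum_jacobi_trudi_incr[OF assms] flip: sum_distrib_left)
  finally have "raise_der (jacobi_trudi n a :: 'a sym) =
      (\<Sum>i\<in>{0..<n}. of_int (a i + 1) * jacobi_trudi n (a(i := a i + 1)) +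
        of_nat (n - 1) * jacobi_trudi n (a(i := a i + 1))) - of_nat n * (power_sum 1 * jacobi_trudi n a)"
    unfolding jacobi_trudi_def[of n a] raise_der_detf
    by (simp add: row sum.distrib sum_subtractf jacobi_trudi_def[of n a, symmetric])
  moreover have "of_int (a i + 1) * F + of_nat (n - 1) * F = of_int (a i + int n) * F" for i and F :: "'a sym"
    using assms by (simp add: of_nat_diff algebra_simps)
  ultimately show ?thesis by (simp only:)
qed

text \<open>A new row of length 1 has the entries h_{1 - n + j}: zeros, then h_0 = 1 and h_1 = p_1
  in the last two columns. Laplace expansion along it leaves two cofactors.\<close>

lemma jacobi_trudi_new_row:
  assumes "n > 0"
  shows "jacobi_trudi (Suc n) (a(n := 1 - int n)) =
    power_sum 1 * jacobi_trudi n a - (jacobi_trudi_gap n a :: 'a::field_char_0 sym)"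
proof -
  let ?b = "a(n := 1 - int n)"
  define M :: "'a sym mat" where
    "M = Matrix.mat (Suc n) (Suc n) (\<lambda>(i, j). complete_hom_int (?b i + int j))"
  have M: "M \<in> carrier_mat (Suc n) (Suc n)" by (simp add: M_def)
  obtain k where k: "n = Suc k" using assms gr0_implies_Suc by blast
  have cof1: "cofactor M n n = jacobi_trudi n a"
    unfolding cofactor_def jacobi_trudi_def detf_def
    by (auto simp: M_def mat_delete_def intro!: arg_cong[where f = Determinant.det])
  have cof2: "cofactor M n k = - jacobi_trudi_gap n a"
    unfolding cofactor_def jacobi_trudi_gap_def detf_def
    by (auto simp: M_def mat_delete_def k intro!: arg_cong[where f = Determinant.det])
  have "jacobi_trudi (Suc n) ?b = (\<Sum>j<Suc n. M $$ (n, j) * cofactor M n j)"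
    unfolding jacobi_trudi_def detf_def M_def[symmetric]
    by (rule laplace_expansion_row[OF M]) simp
  also have "\<dots> = (\<Sum>j<k. M $$ (n, j) * cofactor M n j) + M $$ (n, k) * cofactor M n k + M $$ (n, n) * cofactor M n n"
    by (simp add: k)
  also have "(\<Sum>j<k. M $$ (n, j) * cofactor M n j) = 0"
    by (rule sum.neutral) (auto simp: M_def k complete_hom_int_def)
  also have "M $$ (n, k) = 1" by (simp add: M_def k complete_hom_int_def)
  also have "M $$ (n, n) = power_sum 1" by (simp add: M_def complete_hom_int_def complete_hom_1)
  finally show ?thesis by (simp add: cof1 cof2 fun_upd_def)
qed

lemma schur_jacobi_trudi: "schur \<nu> = jacobi_trudi (length \<nu>) (\<lambda>i. int (\<nu> ! i) - int i)"
  unfolding schur_def jacobi_trudi_def detf_def complete_hom_int_def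
  by (rule arg_cong[where f = Determinant.det], rule eq_matI)
    (auto intro!: arg_cong[where f = complete_hom])

lemma jacobi_trudi_cong: "(\<And>i. i < n \<Longrightarrow> a i = b i) \<Longrightarrow> jacobi_trudi n a = jacobi_trudi n b"
  unfolding jacobi_trudi_def by (rule detf_cong) simp

lemma schur_Nil [simp]: "schur [] = 1"
  by (simp add: schur_def)

section \<open>Adding a box to a partition: Pieri's rule for p_1 and its content-weighted
  version\<close>

definition row_len :: "nat list \<Rightarrow> nat \<Rightarrow> nat" where
  "row_len \<nu> i = (if i < length \<nu> then \<nu> ! i else 0)"

definition add_row :: "nat list \<Rightarrow> nat \<Rightarrow> nat list" where
  "add_row \<nu> i = (if i < length \<nu> then \<nu>[i := Suc (\<nu> ! i)] else \<nu> @ [1])"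

definition addable_rows :: "nat list \<Rightarrow> nat set" where
  "addable_rows \<nu> = {i. i \<le> length \<nu> \<and> (i = 0 \<or> row_len \<nu> i < row_len \<nu> (i - 1))}"

lemma row_len_antimono:
  assumes "\<nu> \<in> young" "i \<le> k"
  shows "row_len \<nu> k \<le> row_len \<nu> i"
proof (cases "i = k \<or> \<not> k < length \<nu>")
  case False
  then have "\<nu> ! k \<le> \<nu> ! i"
    using assms sorted_wrt_nth_less[of "(\<ge>)" \<nu> i k] by (simp add: young_def)
  then show ?thesis using False assms(2) by (simp add: row_len_def)
qed (auto simp: row_len_def)

lemma row_len_pos: "\<nu> \<in> young \<Longrightarrow> 0 < row_len \<nu> i \<longleftrightarrow> i < length \<nu>"
proof (cases "i < length \<nu>")
  case True
  assume "\<nu> \<in> young"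
  then have "\<nu> ! i \<noteq> 0" using nth_mem[OF True] unfolding young_def by (metis (mono_tags, lifting) mem_Collect_eq)
  then show ?thesis using True by (simp add: row_len_def)
qed (simp add: row_len_def)

lemma schur_add_row:
  assumes "i < length \<nu>"
  shows "schur (add_row \<nu> i) =
    jacobi_trudi (length \<nu>) ((\<lambda>i. int (\<nu> ! i) - int i)(i := int (\<nu> ! i) - int i + 1))"
  unfolding schur_jacobi_trudi using assms
  by (auto simp: add_row_def nth_list_update intro!: jacobi_trudi_cong)

text \<open>A row that cannot be extended is as long as the one above it, so its increment makes two
  rows of the determinant equal. Sums over all rows thus reduce to the addable ones.\<close>

lemma schur_not_addable:
  assumes "\<nu> \<in> young" "i < length \<nu>" "i \<notin> addable_rows \<nu>"
  shows "jacobi_trudi (length \<nu>) ((\<lambda>i. int (\<nu> ! i) - int i)(i := int (\<nu> ! i) - int i + 1)) = 0"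
proof -
  have "i \<noteq> 0" and ge: "row_len \<nu> i \<ge> row_len \<nu> (i - 1)"
    using assms(2,3) by (auto simp: addable_rows_def not_less)
  then obtain k where k: "i = Suc k" using not0_implies_Suc by blast
  have "\<nu> ! i = \<nu> ! k"
    using ge row_len_antimono[OF assms(1), of k i] assms(2) k by (simp add: row_len_def)
  then show ?thesis
    using assms(2) k by (intro jacobi_trudi_eq_0[of i k]) simp_all
qed

lemma addable_rows_split:
  assumes "\<nu> \<in> young"
  shows "addable_rows \<nu> = insert (length \<nu>) {i\<in>{0..<length \<nu>}. i \<in> addable_rows \<nu>}"
proof -
  have "length \<nu> \<in> addable_rows \<nu>"
  proof (cases "length \<nu> = 0")
    case False
    then have "0 < row_len \<nu> (length \<nu> - 1)" using row_len_pos[OF assms] by simp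
    then show ?thesis by (simp add: addable_rows_def row_len_def)
  qed (simp add: addable_rows_def)
  moreover have "i \<le> length \<nu>" if "i \<in> addable_rows \<nu>" for i
    using that by (simp add: addable_rows_def)
  ultimately show ?thesis by force
qed

lemma sum_addable_rows:
  fixes x :: "nat \<Rightarrow> 'a::field_char_0 sym"
  assumes "\<nu> \<in> young"
  shows "(\<Sum>i\<in>addable_rows \<nu>. x i * schur (add_row \<nu> i)) =
    x (length \<nu>) * schur (\<nu> @ [1]) + (\<Sum>i\<in>{0..<length \<nu>}. x i *
      jacobi_trudi (length \<nu>) ((\<lambda>i. int (\<nu> ! i) - int i)(i := int (\<nu> ! i) - int i + 1)))"
proof -
  have "(\<Sum>i\<in>addable_rows \<nu>. x i * schur (add_row \<nu> i)) =
    x (length \<nu>) * schur (\<nu> @ [1]) +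
    (\<Sum>i\<in>{i\<in>{0..<length \<nu>}. i \<in> addable_rows \<nu>}. x i * schur (add_row \<nu> i))"
    by (subst addable_rows_split[OF assms], subst sum.insert) (auto simp: add_row_def)
  also have "(\<Sum>i\<in>{i\<in>{0..<length \<nu>}. i \<in> addable_rows \<nu>}. x i * schur (add_row \<nu> i)) =
    (\<Sum>i\<in>{0..<length \<nu>}. x i *
      jacobi_trudi (length \<nu>) ((\<lambda>i. int (\<nu> ! i) - int i)(i := int (\<nu> ! i) - int i + 1)))"
    by (rule sum.mono_neutral_cong_left)
      (auto simp: schur_not_addable[OF assms] schur_add_row)
  finally show ?thesis .
qed

lemma schur_new_row:
  assumes "\<nu> \<noteq> []"
  shows "schur (\<nu> @ [1]) = power_sum 1 * schur \<nu> -
    jacobi_trudi_gap (length \<nu>) (\<lambda>i. int (\<nu> ! i) - int i)"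
proof -
  have "schur (\<nu> @ [1]) = jacobi_trudi (Suc (length \<nu>))
      ((\<lambda>i. int (\<nu> ! i) - int i)(length \<nu> := 1 - int (length \<nu>)))"
    unfolding schur_jacobi_trudi by (auto simp: nth_append intro!: jacobi_trudi_cong)
  also have "\<dots> = power_sum 1 * schur \<nu> - jacobi_trudi_gap (length \<nu>) (\<lambda>i. int (\<nu> ! i) - int i)"
    unfolding schur_jacobi_trudi using assms by (intro jacobi_trudi_new_row) simp
  finally show ?thesis .
qed

lemma schur_single_box: "schur [1] = power_sum 1"
  by (simp add: schur_jacobi_trudi jacobi_trudi_def detf_def det_single complete_hom_int_def complete_hom_1)

text \<open>The increments of existing rows add up to the gap determinant, and
  \<open>schur_new_row\<close> says that the new row supplies exactly what is missing from p_1 S.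
  The empty partition is separate because a gap determinant needs a last column.\<close>

lemma power_sum_1_schur:
  assumes "\<nu> \<in> young"
  shows "power_sum 1 * schur \<nu> = (\<Sum>i\<in>addable_rows \<nu>. schur (add_row \<nu> i))"
proof (cases "\<nu> = []")
  case True
  then have "addable_rows \<nu> = {0}" by (auto simp: addable_rows_def)
  then show ?thesis using True by (simp add: add_row_def schur_single_box[simplified])
next
  case False
  then have len: "length \<nu> > 0" by simp
  show ?thesis
    using sum_addable_rows[OF assms, of "\<lambda>_. 1"]
    unfolding sum_jacobi_trudi_incr[OF len] schur_new_row[OF False] mult_1 diff_add_cancel by (rule sym)
qed

text \<open>The determinant formula has coefficients a_i + n and the correction - n p_1 S. Expanding
  the correction by Pieri's rule lowers each coefficient to a_i, the content of the added box, and
  leaves - n, the content of the first box of a new row.\<close>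

lemma raise_der_schur:
  fixes \<nu> :: "nat list"
  assumes "\<nu> \<in> young"
  shows "raise_der (schur \<nu> :: 'a::field_char_0 sym) =
    (\<Sum>i\<in>addable_rows \<nu>. of_int (content (i, row_len \<nu> i)) * schur (add_row \<nu> i))"
proof (cases "\<nu> = []")
  case True
  then have "addable_rows \<nu> = {0}" by (auto simp: addable_rows_def)
  then show ?thesis using True by (simp add: content_def row_len_def)
next
  case False
  then have len: "length \<nu> > 0" by simp
  let ?n = "length \<nu>" and ?a = "\<lambda>i. int (\<nu> ! i) - int i"
  let ?S = "\<lambda>i. jacobi_trudi ?n (?a(i := ?a i + 1)) :: 'a sym"
  have "raise_der (schur \<nu> :: 'a sym) = (\<Sum>i\<in>{0..<?n}. of_int (?a i + int ?n) * ?S i)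
      - of_nat ?n * (power_sum 1 * schur \<nu>)"
    unfolding schur_jacobi_trudi by (rule raise_der_jacobi_trudi[OF len])
  also have "power_sum 1 * schur \<nu> = schur (\<nu> @ [1]) + (\<Sum>i\<in>{0..<?n}. ?S i)"
    unfolding sum_jacobi_trudi_incr[OF len] schur_new_row[OF False] by simp
  also have "(\<Sum>i\<in>{0..<?n}. of_int (?a i + int ?n) * ?S i) -
      of_nat ?n * (schur (\<nu> @ [1]) + (\<Sum>i\<in>{0..<?n}. ?S i)) =
      of_int (content (?n, row_len \<nu> ?n)) * schur (\<nu> @ [1]) +
      (\<Sum>i\<in>{0..<?n}. of_int (content (i, row_len \<nu> i)) * ?S i)"
  proof -
    have "(\<Sum>i\<in>{0..<?n}. of_int (?a i + int ?n) * ?S i) =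
        (\<Sum>i\<in>{0..<?n}. of_int (content (i, row_len \<nu> i)) * ?S i) + of_nat ?n * (\<Sum>i\<in>{0..<?n}. ?S i)"
      unfolding sum_distrib_left sum.distrib[symmetric] distrib_right[symmetric]
      by (rule sum.cong) (simp_all add: content_def row_len_def)
    moreover have "of_int (content (?n, row_len \<nu> ?n)) = (- of_nat ?n :: 'a sym)"
      by (simp add: content_def row_len_def)
    ultimately show ?thesis by (simp only: distrib_left) simp
  qed
  finally show ?thesis by (simp only: sum_addable_rows[OF assms])
qed

section \<open>Young diagrams as sets of boxes\<close>

text \<open>Order ideals of pairs in place of lists: adding and removing boxes become set
  operations, and unions and intersections remain available.\<close>

definition diagram :: "(nat \<times> nat) set \<Rightarrow> bool" where
  "diagram X \<longleftrightarrow> finite X \<and> (\<forall>i j i' j'. (i, j) \<in> X \<and> i' \<le> i \<and> j' \<le> j \<longrightarrow> (i', j') \<in> X)"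

definition addable :: "(nat \<times> nat) set \<Rightarrow> (nat \<times> nat) set" where
  "addable X = {b. b \<notin> X \<and> diagram (insert b X)}"

definition removable :: "(nat \<times> nat) set \<Rightarrow> (nat \<times> nat) set" where
  "removable X = {b \<in> X. diagram (X - {b})}"

lemma diagram_finite: "diagram X \<Longrightarrow> finite X"
  by (simp add: diagram_def)

lemma diagram_down: "diagram X \<Longrightarrow> (i, j) \<in> X \<Longrightarrow> i' \<le> i \<Longrightarrow> j' \<le> j \<Longrightarrow> (i', j') \<in> X"
  unfolding diagram_def by blast

lemma diagram_empty [simp]: "diagram {}"
  by (simp add: diagram_def)

lemma mem_boxes_iff: "(i, j) \<in> boxes \<nu> \<longleftrightarrow> j < row_len \<nu> i"
  by (simp add: boxes_def row_len_def)

lemma boxes_Nil [simp]: "boxes [] = {}"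
  by (simp add: boxes_def)

lemma boxes_Sigma: "boxes \<nu> = (SIGMA i:{0..<length \<nu>}. {0..<row_len \<nu> i})"
  by (auto simp: mem_boxes_iff row_len_def split: if_splits)

lemma finite_boxes [simp]: "finite (boxes \<nu>)"
  unfolding boxes_Sigma by simp

lemma card_boxes: "card (boxes \<nu>) = sum_list \<nu>"
proof -
  have "card (boxes \<nu>) = (\<Sum>i\<in>{0..<length \<nu>}. row_len \<nu> i)"
    unfolding boxes_Sigma by (subst card_SigmaI) auto
  also have "\<dots> = (\<Sum>i\<in>{0..<length \<nu>}. \<nu> ! i)"
    by (rule sum.cong) (simp_all add: row_len_def)
  finally show ?thesis by (simp add: sum_list_sum_nth)
qed

lemma diagram_boxes:
  assumes "\<nu> \<in> young"
  shows "diagram (boxes \<nu>)"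
  unfolding diagram_def
proof (intro conjI allI impI)
  fix i j i' j'
  assume "(i, j) \<in> boxes \<nu> \<and> i' \<le> i \<and> j' \<le> j"
  then show "(i', j') \<in> boxes \<nu>"
    using row_len_antimono[OF assms, of i' i] by (simp add: mem_boxes_iff)
qed simp

lemma row_len_eqI:
  assumes "\<nu> \<in> young" "\<mu> \<in> young" "\<And>i. row_len \<nu> i = row_len \<mu> i"
  shows "\<nu> = \<mu>"
proof (rule nth_equalityI)
  show len: "length \<nu> = length \<mu>"
    using row_len_pos[OF assms(1)] row_len_pos[OF assms(2)] assms(3) by (metis linorder_neq_iff)
  show "\<nu> ! i = \<mu> ! i" if "i < length \<nu>" for i
    using assms(3)[of i] that len by (simp add: row_len_def)
qed

lemma inj_on_boxes: "inj_on boxes young"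
proof (rule inj_onI)
  fix \<nu> \<mu> assume *: "\<nu> \<in> young" "\<mu> \<in> young" "boxes \<nu> = boxes \<mu>"
  have "row_len \<nu> i = row_len \<mu> i" for i
  proof -
    have "j < row_len \<nu> i \<longleftrightarrow> j < row_len \<mu> i" for j
      using *(3) by (simp flip: mem_boxes_iff)
    then show ?thesis by (metis linorder_neq_iff)
  qed
  then show "\<nu> = \<mu>" by (rule row_len_eqI[OF *(1,2)])
qed

lemma down_closed_nat_set:
  fixes A :: "nat set"
  assumes "finite A" "\<And>i j. i \<in> A \<Longrightarrow> j \<le> i \<Longrightarrow> j \<in> A"
  shows "A = {0..<card A}"
proof (rule card_subset_eq[symmetric])
  show "{0..<card A} \<subseteq> A"
  proof
    fix i assume i: "i \<in> {0..<card A}"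
    show "i \<in> A"
    proof (rule ccontr)
      assume "i \<notin> A"
      then have "A \<subseteq> {0..<i}" using assms(2) by (metis atLeast0LessThan lessThan_iff not_le subsetI)
      then have "card A \<le> i" using card_mono[of "{0..<i}" A] by simp
      then show False using i by simp
    qed
  qed
qed (use assms(1) in simp_all)

text \<open>Every row and the first column are finite initial segments of nat, so their
  cardinalities give the parts and the length.\<close>

lemma ex_young_boxes:
  assumes "diagram X"
  shows "\<exists>\<nu>\<in>young. boxes \<nu> = X"
proof -
  define r where "r i = card {j. (i, j) \<in> X}" for i
  define n where "n = card {i. (i, 0) \<in> X}"
  have fin: "finite {j. (i, j) \<in> X}" for i
    using finite_vimageI[OF diagram_finite[OF assms], of "Pair i"] by (simp add: inj_on_def vimage_def)
  have col: "(k, 0) \<in> X" if "(i, 0) \<in> X" "k \<le> i" for i k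
    by (rule diagram_down[OF assms that]) simp
  have row: "(i, k) \<in> X" if "(i, j) \<in> X" "k \<le> j" for i j k
    by (rule diagram_down[OF assms that(1) le_refl that(2)])
  have "finite {i. (i, 0) \<in> X}"
    using finite_vimageI[OF diagram_finite[OF assms], of "\<lambda>i. (i, 0)"] by (simp add: inj_on_def vimage_def)
  then have n: "{i. (i, 0) \<in> X} = {0..<n}"
    unfolding n_def
    by (rule down_closed_nat_set) (blast intro: col)
  have r: "{j. (i, j) \<in> X} = {0..<r i}" for i
    unfolding r_def
    by (rule down_closed_nat_set[OF fin]) (blast intro: row)
  have X: "(i, j) \<in> X \<longleftrightarrow> j < r i" for i j
    using arg_cong[OF r[of i], of "\<lambda>A. j \<in> A"] by simp
  have n': "r i > 0 \<longleftrightarrow> i < n" for i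
    using arg_cong[OF n, of "\<lambda>A. i \<in> A"] X[of i 0] by simp
  have mono: "r k \<le> r i" if "i \<le> k" for i k
  proof (rule ccontr)
    assume "\<not> r k \<le> r i"
    then have "(k, r i) \<in> X" by (simp add: X)
    then have "(i, r i) \<in> X" by (rule diagram_down[OF assms _ that order_refl])
    then show False by (simp add: X)
  qed
  let ?\<nu> = "map r [0..<n]"
  have "?\<nu> \<in> young"
    using n' by (simp add: young_def sorted_wrt_iff_nth_less mono image_iff)
  moreover have "boxes ?\<nu> = X"
  proof -
    have "j < row_len ?\<nu> i \<longleftrightarrow> j < r i" for i j
      using n'[of i] by (auto simp: row_len_def)
    then have "(i, j) \<in> boxes ?\<nu> \<longleftrightarrow> (i, j) \<in> X" for i j by (simp only: mem_boxes_iff X)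
    then show ?thesis by auto
  qed
  ultimately show ?thesis by blast
qed

definition part :: "(nat \<times> nat) set \<Rightarrow> nat list" where
  "part X = inv_into young boxes X"

lemma part_boxes [simp]: "\<nu> \<in> young \<Longrightarrow> part (boxes \<nu>) = \<nu>"
  unfolding part_def by (rule inv_into_f_f[OF inj_on_boxes])

lemma boxes_part [simp]: "diagram X \<Longrightarrow> boxes (part X) = X"
  unfolding part_def using ex_young_boxes by (auto intro!: f_inv_into_f)

lemma part_young [simp]: "diagram X \<Longrightarrow> part X \<in> young"
  using ex_young_boxes by fastforce

lemma diagram_cases:
  assumes "diagram X"
  obtains \<nu> where "\<nu> \<in> young" "X = boxes \<nu>"
  using ex_young_boxes[OF assms] by blast

section \<open>Addable and removable boxes in terms of rows\<close>

lemma row_len_add_row: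
  assumes "i \<le> length \<nu>"
  shows "row_len (add_row \<nu> i) k = (if k = i then Suc (row_len \<nu> i) else row_len \<nu> k)"
  using assms by (auto simp: row_len_def add_row_def nth_list_update nth_append)

lemma boxes_add_row:
  assumes "i \<le> length \<nu>"
  shows "boxes (add_row \<nu> i) = insert (i, row_len \<nu> i) (boxes \<nu>)"
proof -
  have "(k, j) \<in> boxes (add_row \<nu> i) \<longleftrightarrow> (k, j) \<in> insert (i, row_len \<nu> i) (boxes \<nu>)" for k j
    by (auto simp: mem_boxes_iff row_len_add_row[OF assms])
  then show ?thesis by auto
qed

lemma add_row_young:
  assumes "\<nu> \<in> young" "i \<in> addable_rows \<nu>"
  shows "add_row \<nu> i \<in> young"
proof -
  have i: "i \<le> length \<nu>" using assms(2) by (simp add: addable_rows_def)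
  have "add_row \<nu> i ! l \<le> add_row \<nu> i ! k" if "k < l" "l < length (add_row \<nu> i)" for k l
  proof -
    have "row_len (add_row \<nu> i) l \<le> row_len (add_row \<nu> i) k"
    proof (cases "l = i")
      case True
      then have "row_len \<nu> i < row_len \<nu> (i - 1)" "k \<le> i - 1"
        using assms(2) that by (auto simp: addable_rows_def)
      then show ?thesis
        using row_len_antimono[OF assms(1), of k "i - 1"] that True by (simp add: row_len_add_row[OF i])
    next
      case False
      then show ?thesis
        using row_len_antimono[OF assms(1), of k l] that by (auto simp: row_len_add_row[OF i])
    qed
    then show ?thesis using that by (simp add: row_len_def)
  qed
  moreover have "0 \<notin> set (add_row \<nu> i)"
    using assms(1) set_update_subset_insert[of \<nu> i "Suc (\<nu> ! i)"]
    by (auto simp: add_row_def young_def)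
  ultimately show ?thesis by (simp add: young_def sorted_wrt_iff_nth_less)
qed

lemma addable_boxes:
  assumes "\<nu> \<in> young"
  shows "addable (boxes \<nu>) = (\<lambda>i. (i, row_len \<nu> i)) ` addable_rows \<nu>"
proof (intro equalityI subsetI)
  fix b assume "b \<in> addable (boxes \<nu>)"
  then obtain i j where b: "b = (i, j)" "(i, j) \<notin> boxes \<nu>" and d: "diagram (insert (i, j) (boxes \<nu>))"
    by (cases b) (auto simp: addable_def)
  have j: "j = row_len \<nu> i"
  proof (rule ccontr)
    assume "j \<noteq> row_len \<nu> i"
    then have "row_len \<nu> i < j" using b(2) by (simp add: mem_boxes_iff)
    then show False using diagram_down[OF d, of i j i "row_len \<nu> i"] by (simp add: mem_boxes_iff)
  qed
  have up: "(i - 1, j) \<in> boxes \<nu>" if "i > 0"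
    using diagram_down[OF d, of i j "i - 1" j] that by auto
  have "i \<le> length \<nu>"
  proof (cases "i = 0")
    case False
    then have "row_len \<nu> (i - 1) > 0" using up by (simp add: mem_boxes_iff)
    then show ?thesis by (simp add: row_len_def split: if_splits)
  qed simp
  then have "i \<in> addable_rows \<nu>"
    using up j by (auto simp: addable_rows_def mem_boxes_iff)
  then show "b \<in> (\<lambda>i. (i, row_len \<nu> i)) ` addable_rows \<nu>" using b(1) j by auto
next
  fix b assume "b \<in> (\<lambda>i. (i, row_len \<nu> i)) ` addable_rows \<nu>"
  then obtain i where i: "i \<in> addable_rows \<nu>" "b = (i, row_len \<nu> i)" by auto
  then have "i \<le> length \<nu>" by (simp add: addable_rows_def)
  then show "b \<in> addable (boxes \<nu>)"
    using diagram_boxes[OF add_row_young[OF assms i(1)]] i(2)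
    by (simp add: addable_def boxes_add_row mem_boxes_iff)
qed

lemma removable_boxes:
  assumes "\<nu> \<in> young"
  shows "removable (boxes \<nu>) =
    (\<lambda>i. (i, row_len \<nu> i - 1)) ` {i\<in>{0..<length \<nu>}. row_len \<nu> (Suc i) < row_len \<nu> i}"
proof (intro equalityI subsetI)
  fix b assume "b \<in> removable (boxes \<nu>)"
  then obtain i j where b: "b = (i, j)" "j < row_len \<nu> i" and d: "diagram (boxes \<nu> - {(i, j)})"
    by (cases b) (auto simp: removable_def mem_boxes_iff)
  have "\<not> Suc j < row_len \<nu> i"
    using diagram_down[OF d, of i "Suc j" i j] by (auto simp: mem_boxes_iff)
  then have j: "j = row_len \<nu> i - 1" using b(2) by linarith
  have "\<not> j < row_len \<nu> (Suc i)"
    using diagram_down[OF d, of "Suc i" j i j] by (auto simp: mem_boxes_iff)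
  then have "row_len \<nu> (Suc i) < row_len \<nu> i" using b(2) by linarith
  moreover have "i < length \<nu>" using b(2) by (simp add: row_len_def split: if_splits)
  ultimately show "b \<in> (\<lambda>i. (i, row_len \<nu> i - 1)) ` {i\<in>{0..<length \<nu>}. row_len \<nu> (Suc i) < row_len \<nu> i}"
    using b(1) j by auto
next
  fix b assume "b \<in> (\<lambda>i. (i, row_len \<nu> i - 1)) ` {i\<in>{0..<length \<nu>}. row_len \<nu> (Suc i) < row_len \<nu> i}"
  then obtain i where i: "row_len \<nu> (Suc i) < row_len \<nu> i" "b = (i, row_len \<nu> i - 1)" by auto
  have "diagram (boxes \<nu> - {b})"
    unfolding diagram_def
  proof (intro conjI allI impI)
    fix k l k' l'
    assume *: "(k, l) \<in> boxes \<nu> - {b} \<and> k' \<le> k \<and> l' \<le> l"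
    have "(k', l') \<noteq> b"
    proof
      assume eq: "(k', l') = b"
      show False
      proof (cases "k = i")
        case True
        then show False using * eq i by (auto simp: mem_boxes_iff)
      next
        case False
        then have "Suc i \<le> k" using * eq i by simp
        then have "row_len \<nu> k \<le> row_len \<nu> (Suc i)" by (rule row_len_antimono[OF assms])
        then show False using * eq i by (auto simp: mem_boxes_iff)
      qed
    qed
    then show "(k', l') \<in> boxes \<nu> - {b}"
      using * diagram_down[OF diagram_boxes[OF assms], of k l k' l'] by simp
  qed simp
  then show "b \<in> removable (boxes \<nu>)"
    using i by (simp add: removable_def mem_boxes_iff)
qed

lemma finite_addable: "diagram X \<Longrightarrow> finite (addable X)"
  by (erule diagram_cases) (simp add: addable_boxes addable_rows_def)

lemma finite_removable: "diagram X \<Longrightarrow> finite (removable X)"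
  by (simp add: removable_def diagram_finite)

lemma addable_diagram: "b \<in> addable X \<Longrightarrow> diagram (insert b X)"
  by (simp add: addable_def)

lemma removable_diagram: "b \<in> removable X \<Longrightarrow> diagram (X - {b})"
  by (simp add: removable_def)

text \<open>In the sum over all rows, non-addable rows cancel against non-removable ones;
  what remains telescopes along the rows and then along the first column.\<close>

lemma addable_removable_sum:
  fixes f :: "int \<Rightarrow> 'r::comm_ring_1"
  assumes "diagram X"
  shows "(\<Sum>b\<in>addable X. f (content b)) - (\<Sum>b\<in>removable X. f (content b)) =
    f 0 + (\<Sum>b\<in>X. f (content b + 1) - 2 * f (content b) + f (content b - 1))"
proof -
  obtain \<nu> where \<nu>: "\<nu> \<in> young" "X = boxes \<nu>" using assms by (rule diagram_cases)
  define r where "r = row_len \<nu>"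
  define n where "n = length \<nu>"
  define a where "a i = int (r i) - int i" for i
  define g where "g x = f x - f (x - 1)" for x
  have anti: "r (Suc i) \<le> r i" for i unfolding r_def by (rule row_len_antimono[OF \<nu>(1)]) simp
  have rn: "r n = 0" by (simp add: r_def n_def row_len_def)
  have add: "(\<Sum>b\<in>addable X. f (content b)) =
      f (a 0) + (\<Sum>i\<in>{0..<n}. if r (Suc i) < r i then f (a (Suc i)) else 0)"
  proof -
    have "(\<Sum>b\<in>addable X. f (content b)) = (\<Sum>i\<in>addable_rows \<nu>. f (a i))"
      unfolding \<nu>(2) addable_boxes[OF \<nu>(1)]
      by (subst sum.reindex) (auto simp: inj_on_def content_def a_def r_def)
    also have "\<dots> = (\<Sum>i\<le>n. if i = 0 \<or> r i < r (i - 1) then f (a i) else 0)"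
      by (rule sum.mono_neutral_cong_left) (auto simp: addable_rows_def n_def r_def)
    also have "\<dots> = f (a 0) + (\<Sum>i<n. if r (Suc i) < r i then f (a (Suc i)) else 0)"
      by (subst sum.atMost_shift) simp
    finally show ?thesis by (simp add: atLeast0LessThan)
  qed
  have rem: "(\<Sum>b\<in>removable X. f (content b)) =
      (\<Sum>i\<in>{0..<n}. if r (Suc i) < r i then f (a i - 1) else 0)"
  proof -
    have "(\<Sum>b\<in>removable X. f (content b)) =
        (\<Sum>i\<in>{i\<in>{0..<n}. r (Suc i) < r i}. f (a i - 1))"
      unfolding \<nu>(2) removable_boxes[OF \<nu>(1)] r_def n_def
      by (subst sum.reindex) (auto simp: inj_on_def content_def a_def r_def of_nat_diff intro!: sum.cong arg_cong[where f = f])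
    also have "\<dots> = (\<Sum>i\<in>{0..<n}. if r (Suc i) < r i then f (a i - 1) else 0)"
      by (rule sum.inter_filter) simp
    finally show ?thesis .
  qed
  have "(if r (Suc i) < r i then f (a (Suc i)) else 0) - (if r (Suc i) < r i then f (a i - 1) else 0) =
      (f (a (Suc i)) - f (a i)) + g (a i)" for i
  \<comment> \<open>If row \<open>Suc i\<close> is not addable, then
    \<open>a (Suc i) = a i - 1\<close> and the right-hand side cancels by itself.\<close>
  proof (cases "r (Suc i) < r i")
    case False
    then have "r (Suc i) = r i" using anti[of i] by simp
    then show ?thesis by (simp add: a_def g_def algebra_simps)
  qed (simp add: g_def)
  then have "(\<Sum>b\<in>addable X. f (content b)) - (\<Sum>b\<in>removable X. f (content b)) =
      f (a 0) + (\<Sum>i\<in>{0..<n}. (f (a (Suc i)) - f (a i)) + g (a i))"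
    unfolding add rem by (simp add: add_diff_eq[symmetric] sum_subtractf[symmetric])
  also have "\<dots> = f (a 0) + (f (a n) - f (a 0)) + (\<Sum>i\<in>{0..<n}. g (a i))"
    unfolding sum.distrib using sum_Suc_diff'[of 0 n "\<lambda>i. f (a i)"] by (simp add: add.assoc)
  also have "\<dots> = f (- int n) + (\<Sum>i\<in>{0..<n}. g (a i))"
    by (simp add: a_def rn)
  also have "(\<Sum>i\<in>{0..<n}. g (a i)) =
      (\<Sum>i\<in>{0..<n}. g (- int i) + (\<Sum>j\<in>{0..<r i}. g (int (Suc j) - int i) - g (int j - int i)))"
    by (rule sum.cong) (simp_all add: sum_Suc_diff'[of 0 _ "\<lambda>j. g (int j - int i)" for i, simplified] a_def)
  also have "\<dots> = (\<Sum>i\<in>{0..<n}. g (- int i)) +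
      (\<Sum>i\<in>{0..<n}. \<Sum>j\<in>{0..<r i}. g (int (Suc j) - int i) - g (int j - int i))"
    by (rule sum.distrib)
  also have "(\<Sum>i\<in>{0..<n}. g (- int i)) = - (\<Sum>i\<in>{0..<n}. f (- int (Suc i)) - f (- int i))"
  proof -
    have "- int i - 1 = - int (Suc i)" for i by simp
    then show ?thesis unfolding sum_negf[symmetric] g_def by (simp only: minus_diff_eq)
  qed
  also have "\<dots> = f 0 - f (- int n)"
    by (subst sum_Suc_diff'[of 0 n "\<lambda>i. f (- int i)"]) simp_all
  also have "(\<Sum>i\<in>{0..<n}. \<Sum>j\<in>{0..<r i}. g (int (Suc j) - int i) - g (int j - int i)) =
      (\<Sum>b\<in>X. g (content b + 1) - g (content b))"
    unfolding \<nu>(2) boxes_Sigma r_def n_def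
    by (subst sum.Sigma) (auto simp: content_def algebra_simps intro!: sum.cong)
  also have "\<dots> = (\<Sum>b\<in>X. f (content b + 1) - 2 * f (content b) + f (content b - 1))"
    by (rule sum.cong) (simp_all add: g_def algebra_simps)
  finally show ?thesis by (simp add: algebra_simps)
qed

section \<open>Schur functions indexed by diagrams\<close>

definition schur_of :: "(nat \<times> nat) set \<Rightarrow> 'a::field_char_0 sym" where
  "schur_of X = schur (part X)"

lemma schur_of_boxes: "\<nu> \<in> young \<Longrightarrow> schur_of (boxes \<nu>) = schur \<nu>"
  by (simp add: schur_of_def)

lemma young_Nil [simp]: "[] \<in> young"
  by (simp add: young_def)

lemma schur_of_empty [simp]: "schur_of {} = 1"
  using schur_of_boxes[of "[]"] by simp

lemma schur_addable_sum:
  fixes x :: "nat \<times> nat \<Rightarrow> 'a::field_char_0 sym"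
  assumes "\<nu> \<in> young"
  shows "(\<Sum>i\<in>addable_rows \<nu>. x (i, row_len \<nu> i) * schur (add_row \<nu> i)) =
    (\<Sum>b\<in>addable (boxes \<nu>). x b * schur_of (insert b (boxes \<nu>)))"
proof -
  have "schur_of (insert (i, row_len \<nu> i) (boxes \<nu>)) = (schur (add_row \<nu> i) :: 'a sym)" if "i \<in> addable_rows \<nu>" for i
  proof -
    have "i \<le> length \<nu>" using that by (simp add: addable_rows_def)
    then show ?thesis
      using add_row_young[OF assms that] by (simp flip: boxes_add_row add: schur_of_boxes)
  qed
  then show ?thesis
    unfolding addable_boxes[OF assms] by (subst sum.reindex) (auto simp: inj_on_def intro!: sum.cong)
qed

lemma power_sum_1_schur_of:
  assumes "diagram X"
  shows "power_sum 1 * schur_of X = (\<Sum>b\<in>addable X. schur_of (insert b X))"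
  using assms
proof (rule diagram_cases)
  fix \<nu> assume \<nu>: "\<nu> \<in> young" "X = boxes \<nu>"
  show ?thesis
    using power_sum_1_schur[OF \<nu>(1)] schur_addable_sum[OF \<nu>(1), of "\<lambda>_. 1"]
    unfolding \<nu>(2) schur_of_boxes[OF \<nu>(1)] mult_1 by (rule trans)
qed

lemma raise_der_schur_of:
  assumes "diagram X"
  shows "raise_der (schur_of X) = (\<Sum>b\<in>addable X. of_int (content b) * schur_of (insert b X))"
  using assms
proof (rule diagram_cases)
  fix \<nu> assume \<nu>: "\<nu> \<in> young" "X = boxes \<nu>"
  show ?thesis
    using raise_der_schur[OF \<nu>(1)] schur_addable_sum[OF \<nu>(1), of "\<lambda>b. of_int (content b)"]
    unfolding \<nu>(2) schur_of_boxes[OF \<nu>(1)] by (rule trans)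
qed

section \<open>The Schur functions form a homogeneous basis\<close>

definition weight :: "(nat \<Rightarrow>\<^sub>0 nat) \<Rightarrow> nat" where
  "weight m = (\<Sum>k\<in>Poly_Mapping.keys m. Poly_Mapping.lookup m k * Suc k)"

lemma weight_superset:
  assumes "finite K" "Poly_Mapping.keys m \<subseteq> K"
  shows "weight m = (\<Sum>k\<in>K. Poly_Mapping.lookup m k * Suc k)"
  unfolding weight_def
  by (rule sum.mono_neutral_left) (use assms in \<open>auto simp: in_keys_iff\<close>)

lemma weight_add: "weight (m + n) = weight m + weight n"
proof -
  let ?K = "Poly_Mapping.keys m \<union> Poly_Mapping.keys n"
  have K: "finite ?K" by simp
  show ?thesis
    unfolding weight_superset[OF K keys_add] weight_superset[OF K Un_upper1] weight_superset[OF K Un_upper2]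
    by (simp only: lookup_add distrib_right sum.distrib)
qed

lemma weight_single: "weight (Poly_Mapping.single k a) = a * Suc k"
  by (cases "a = 0") (simp_all add: weight_def)

lemma weight_0 [simp]: "weight 0 = 0"
  by (simp add: weight_def)

text \<open>A set of sizes instead of one size: independence and injectivity across several degrees
  then follow from one counting argument, without separating degrees.\<close>

definition diagrams :: "nat set \<Rightarrow> (nat \<times> nat) set set" where
  "diagrams N = {X. diagram X \<and> card X \<in> N}"

definition schur_span :: "nat \<Rightarrow> 'a::field_char_0 sym set" where
  "schur_span n = sym.span (schur_of ` diagrams {n})"

lemma card_insert_addable: "diagram X \<Longrightarrow> b \<in> addable X \<Longrightarrow> card (insert b X) = Suc (card X)"
  by (simp add: addable_def diagram_finite)

lemma schur_of_in_span: "diagram X \<Longrightarrow> schur_of X \<in> schur_span (card X)"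
  unfolding schur_span_def by (rule sym.span_base) (simp add: diagrams_def)

lemma schur_span_zero: "0 \<in> schur_span n"
  unfolding schur_span_def by (rule sym.span_zero)

lemma schur_span_add: "F \<in> schur_span n \<Longrightarrow> G \<in> schur_span n \<Longrightarrow> F + G \<in> schur_span n"
  unfolding schur_span_def by (rule sym.span_add)

lemma schur_span_diff: "F \<in> schur_span n \<Longrightarrow> G \<in> schur_span n \<Longrightarrow> F - G \<in> schur_span n"
  unfolding schur_span_def by (rule sym.span_diff)

lemma schur_span_const: "F \<in> schur_span n \<Longrightarrow> sym_const a * F \<in> schur_span n"
  unfolding schur_span_def by (rule sym.span_scale)

lemma schur_span_sum: "(\<And>x. x \<in> A \<Longrightarrow> f x \<in> schur_span n) \<Longrightarrow> sum f A \<in> schur_span n"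
  unfolding schur_span_def by (rule sym.span_sum)

lemma schur_span_linear_image:
  assumes F: "F \<in> schur_span n"
    and add: "\<And>F G. T (F + G) = T F + T G" and const: "\<And>a F. T (sym_const a * F) = sym_const a * T F"
    and schur: "\<And>X. diagram X \<Longrightarrow> card X = n \<Longrightarrow> T (schur_of X) \<in> schur_span m"
  shows "T F \<in> schur_span m"
  using F unfolding schur_span_def[of n]
proof (induction F rule: sym.span_induct_alt)
  case base
  have "T 0 = 0" using const[of 0 0] by simp
  then show ?case by (simp add: schur_span_zero)
next
  case (step a F G)
  then show ?case
    by (auto simp: add const diagrams_def intro!: schur_span_add schur_span_const schur)
qed

lemma power_sum_1_schur_span: "F \<in> schur_span n \<Longrightarrow> power_sum 1 * F \<in> schur_span (Suc n)"
proof (erule schur_span_linear_image)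
  fix X assume X: "diagram X" "card X = n"
  have "schur_of (insert b X) \<in> schur_span (Suc n)" if "b \<in> addable X" for b
    using schur_of_in_span[OF addable_diagram[OF that]] card_insert_addable[OF X(1) that] X(2) by simp
  then show "power_sum 1 * schur_of X \<in> schur_span (Suc n)"
    unfolding power_sum_1_schur_of[OF X(1)] by (rule schur_span_sum)
qed (simp_all only: distrib_left mult.left_commute)

lemma raise_der_schur_span: "F \<in> schur_span n \<Longrightarrow> raise_der F \<in> schur_span (Suc n)"
proof (erule schur_span_linear_image)
  fix X assume X: "diagram X" "card X = n"
  have "of_int (content b) * schur_of (insert b X) \<in> schur_span (Suc n)" if "b \<in> addable X" for b
    using schur_span_const[OF schur_of_in_span[OF addable_diagram[OF that]], of "of_int (content b)"]
      card_insert_addable[OF X(1) that] X(2) by (simp add: sym_const_of_int)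
  then show "raise_der (schur_of X) \<in> schur_span (Suc n)"
    unfolding raise_der_schur_of[OF X(1)] by (rule schur_span_sum)
qed (simp_all only: raise_der_add raise_der_const_times)

text \<open>The commutator of \<open>raise_der\<close> with multiplication by p_k is multiplication
  by k p_{k+1}. Hence whatever is stable under p_1 and \<open>raise_der\<close> is stable under all
  power sums.\<close>

lemma power_sum_Suc:
  fixes F :: "'a::field_char_0 sym"
  shows "power_sum (Suc (Suc k)) * F =
    sym_const (1 / of_nat (Suc k)) * (raise_der (power_sum (Suc k) * F) - power_sum (Suc k) * raise_der F)"
  using sym_const_inverse_of_nat[of "Suc k" "power_sum (Suc (Suc k)) * F"]
  by (simp only: raise_der_mult raise_der_power_sum add_diff_cancel_right' mult.assoc nat.simps not_False_eq_True)

lemma power_sum_schur_span: "F \<in> schur_span n \<Longrightarrow> power_sum (Suc k) * F \<in> schur_span (n + Suc k)"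
proof (induction k arbitrary: F n)
  case 0
  then show ?case using power_sum_1_schur_span[of F n] by simp
next
  case (Suc k)
  have "raise_der (power_sum (Suc k) * F) \<in> schur_span (Suc (n + Suc k))"
    by (intro raise_der_schur_span Suc)
  moreover have "power_sum (Suc k) * raise_der F \<in> schur_span (Suc n + Suc k)"
    by (intro raise_der_schur_span Suc)
  ultimately show ?case
    unfolding power_sum_Suc by (intro schur_span_const schur_span_diff) simp_all
qed

lemma mon_schur_span: "(mon m :: 'a::field_char_0 sym) \<in> schur_span (weight m)"
proof (induction "weight m" arbitrary: m rule: less_induct)
  case less
  show ?case
  proof (cases "m = 0")
    case True
    then show ?thesis using schur_of_in_span[of "{}", where 'a = 'a] by simp
  next
    case False
    then obtain k where k: "Poly_Mapping.lookup m k \<noteq> 0"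
      by (metis lookup_zero poly_mapping_eqI)
    define m' where "m' = m - Poly_Mapping.single k 1"
    have m: "m = m' + Poly_Mapping.single k 1"
      by (rule poly_mapping_eqI) (use k in \<open>auto simp: m'_def lookup_add lookup_minus lookup_single when_def\<close>)
    have w: "weight m = weight m' + Suc k"
      unfolding m weight_add weight_single by simp
    have "mon m = (power_sum (Suc k) * mon m' :: 'a sym)"
      unfolding m mon_add by (simp add: power_sum_def mult.commute)
    then show ?thesis
      unfolding w using power_sum_schur_span less[of m'] w by simp
  qed
qed

lemma diagram_bounded:
  assumes "diagram X" "card X \<le> n"
  shows "X \<subseteq> {0..<n} \<times> {0..<n}"
proof clarify
  fix i j assume ij: "(i, j) \<in> X"
  have "(\<lambda>k. (k, j)) ` {0..i} \<subseteq> X" "Pair i ` {0..j} \<subseteq> X"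
    using diagram_down[OF assms(1) ij] by auto
  from this[THEN card_mono[OF diagram_finite[OF assms(1)]]] assms(2)
  show "i \<in> {0..<n} \<and> j \<in> {0..<n}" by (simp add: card_image inj_on_def)
qed

lemma finite_diagrams:
  assumes "finite N"
  shows "finite (diagrams N)"
proof (rule finite_subset)
  show "diagrams N \<subseteq> Pow ({0..<Max N} \<times> {0..<Max N})"
    using diagram_bounded Max_ge[OF assms] unfolding diagrams_def by blast
qed simp

section \<open>Counting partitions against power sum monomials\<close>

definition part_mon :: "nat list \<Rightarrow> nat \<Rightarrow>\<^sub>0 nat" where
  "part_mon \<nu> = (\<Sum>x\<leftarrow>\<nu>. Poly_Mapping.single (x - 1) 1)"

lemma weight_part_mon: "0 \<notin> set \<nu> \<Longrightarrow> weight (part_mon \<nu>) = sum_list \<nu>"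
proof (induction \<nu>)
  case (Cons x \<nu>)
  then show ?case by (cases x) (simp_all add: part_mon_def weight_add weight_single)
qed (simp add: part_mon_def)

lemma lookup_part_mon: "0 \<notin> set \<nu> \<Longrightarrow> Poly_Mapping.lookup (part_mon \<nu>) k = count (mset \<nu>) (Suc k)"
proof (induction \<nu>)
  case (Cons x \<nu>)
  then show ?case by (cases x) (auto simp: part_mon_def lookup_add lookup_single when_def)
qed (simp add: part_mon_def)

text \<open>The exponents are the multiplicities of the parts, and a nonincreasing list is
  determined by its multiset.\<close>

lemma inj_on_part_mon: "inj_on part_mon young"
proof (rule inj_onI)
  fix \<nu> \<mu> assume *: "\<nu> \<in> young" "\<mu> \<in> young" "part_mon \<nu> = part_mon \<mu>"
  have nz: "0 \<notin> set \<nu>" "0 \<notin> set \<mu>" using *(1,2) by (simp_all add: young_def)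
  have "mset \<nu> = mset \<mu>"
  proof (rule multiset_eqI)
    fix x show "count (mset \<nu>) x = count (mset \<mu>) x"
    proof (cases x)
      case 0
      have "count (mset \<nu>) 0 = 0" "count (mset \<mu>) 0 = 0"
        using nz by (simp_all add: count_mset_0_iff)
      then show ?thesis by (simp only: 0)
    next
      case (Suc k)
      then show ?thesis using lookup_part_mon[OF nz(1), of k] lookup_part_mon[OF nz(2), of k] *(3) by simp
    qed
  qed
  moreover have "sorted (rev \<nu>)" "sorted (rev \<mu>)"
    using *(1,2) by (simp_all add: young_def sorted_wrt_rev)
  ultimately have "rev \<nu> = rev \<mu>"
    by (metis mset_rev properties_for_sort)
  then show "\<nu> = \<mu>" by simp
qed

lemma inj_mon: "inj (mon :: _ \<Rightarrow> 'a::field_char_0 sym)"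
  by (rule injI) (metis lookup_single_eq lookup_single_not_eq zero_neq_one)

lemma independent_mon: "\<not> sym.dependent (mon ` M :: 'a::field_char_0 sym set)"
proof
  assume "sym.dependent (mon ` M :: 'a sym set)"
  then obtain S :: "'a sym set" and u where S: "finite S" "S \<subseteq> mon ` M" and u: "\<exists>v\<in>S. u v \<noteq> 0"
    and eq: "(\<Sum>v\<in>S. sym_const (u v) * v) = 0"
    unfolding sym.dependent_explicit by blast
  from u obtain m where m: "mon m \<in> S" "u (mon m) \<noteq> 0" using S(2) by blast
  have "0 = (\<Sum>v\<in>S. u v * Poly_Mapping.lookup v m)"
    using arg_cong[OF eq, of "\<lambda>F. Poly_Mapping.lookup F m"]
    by (simp add: lookup_sum lookup_sym_const_times)
  also have "\<dots> = (\<Sum>v\<in>S. if v = mon m then u v else 0)"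
  proof (rule sum.cong[OF refl])
    fix v assume "v \<in> S"
    then obtain k where "v = mon k" using S(2) by blast
    moreover have "mon k = (mon m :: 'a sym) \<longleftrightarrow> k = m"
      using inj_mon[where 'a = 'a] by (simp add: inj_def) blast
    ultimately
    show "u v * Poly_Mapping.lookup v m = (if v = mon m then u v else 0)"
      by (simp add: lookup_single when_def)
  qed
  finally show False using S(1) m by simp
qed

text \<open>Partitions inject into monomials of the same weight, and the monomials are independent and
  spanned by the Schur functions: equality of the numbers forces everything.\<close>

lemma card_diagrams_le_independent:
  fixes B :: "'a::field_char_0 sym set"
  assumes N: "finite N" and B: "mon ` {m. weight m \<in> N} \<subseteq> sym.span B" "finite B"
  shows "card (diagrams N) \<le> card B"
proof -
  let ?M = "{m. weight m \<in> N}"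
  have M: "finite (mon ` ?M :: 'a sym set)" "card (mon ` ?M :: 'a sym set) \<le> card B"
    using sym.independent_span_bound[OF B(2) independent_mon B(1)] by simp_all
  then have fM: "finite ?M" using finite_imageD[OF _ inj_on_subset[OF inj_mon subset_UNIV]] by blast
  have "card (diagrams N) \<le> card ?M"
  proof (rule card_inj_on_le[OF _ _ fM])
    show "inj_on (\<lambda>X. part_mon (part X)) (diagrams N)"
    proof (rule inj_onI)
      fix X Y assume "X \<in> diagrams N" "Y \<in> diagrams N" "part_mon (part X) = part_mon (part Y)"
      then show "X = Y"
        using inj_onD[OF inj_on_part_mon, of "part X" "part Y"] boxes_part
        by (metis (mono_tags, lifting) diagrams_def mem_Collect_eq part_young)
    qed
    show "(\<lambda>X. part_mon (part X)) ` diagrams N \<subseteq> ?M"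
    proof clarify
      fix X assume X: "X \<in> diagrams N"
      then have "0 \<notin> set (part X)" using part_young[of X] by (simp add: young_def diagrams_def)
      moreover have "sum_list (part X) = card X"
        using X card_boxes[of "part X"] by (simp add: diagrams_def)
      ultimately show "weight (part_mon (part X)) \<in> N"
        using X by (simp add: weight_part_mon diagrams_def)
    qed
  qed
  also have "card ?M = card (mon ` ?M :: 'a sym set)"
    by (rule card_image[symmetric]) (rule inj_on_subset[OF inj_mon subset_UNIV])
  finally show ?thesis using M(2) by linarith
qed

lemma mon_span_diagrams: "mon ` {m. weight m \<in> N} \<subseteq> sym.span (schur_of ` diagrams N)"
proof clarify
  fix m assume "weight m \<in> N"
  then have "schur_span (weight m) \<subseteq> sym.span (schur_of ` diagrams N)"
    unfolding schur_span_def by (intro sym.span_mono) (auto simp: diagrams_def)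
  then show "mon m \<in> sym.span (schur_of ` diagrams N)" using mon_schur_span by blast
qed

lemma inj_on_schur_of_finite:
  assumes "finite N"
  shows "inj_on (schur_of :: _ \<Rightarrow> 'a::field_char_0 sym) (diagrams N)"
  using card_diagrams_le_independent[OF assms mon_span_diagrams, where 'a = 'a]
    card_image_le[OF finite_diagrams[OF assms], of "schur_of :: _ \<Rightarrow> 'a sym"] finite_diagrams[OF assms]
  by (intro eq_card_imp_inj_on) simp_all

text \<open>A redundant Schur function could be dropped without shrinking the span. The monomials
  would then be spanned by fewer elements than there are diagrams, contrary to the count.\<close>

lemma independent_schur_of_finite:
  assumes "finite N"
  shows "\<not> sym.dependent (schur_of ` diagrams N :: 'a::field_char_0 sym set)"
proof
  let ?B = "schur_of ` diagrams N :: 'a sym set"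
  assume "sym.dependent ?B"
  then obtain a where a: "a \<in> ?B" "a \<in> sym.span (?B - {a})"
    unfolding sym.dependent_def by blast
  have "?B \<subseteq> sym.span (?B - {a})"
    using a(2) sym.span_base[of _ "?B - {a}"] by blast
  then have "sym.span ?B \<subseteq> sym.span (?B - {a})"
    by (rule sym.span_minimal) (rule sym.subspace_span)
  then have "card (diagrams N) \<le> card (?B - {a})"
    using mon_span_diagrams[of N, where 'a = 'a] finite_diagrams[OF assms]
    by (intro card_diagrams_le_independent[OF assms]) auto
  also have "\<dots> < card ?B"
    using a(1) finite_diagrams[OF assms] by (intro psubset_card_mono) auto
  also have "\<dots> \<le> card (diagrams N)"
    by (rule card_image_le[OF finite_diagrams[OF assms]])
  finally show False by simp
qed

lemma inj_on_schur_of: "inj_on (schur_of :: _ \<Rightarrow> 'a::field_char_0 sym) {X. diagram X}"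
proof (rule inj_onI)
  fix X Y assume "X \<in> {X. diagram X}" "Y \<in> {X. diagram X}" "schur_of X = (schur_of Y :: 'a sym)"
  then show "X = Y"
    using inj_onD[OF inj_on_schur_of_finite[of "{card X, card Y}", where 'a = 'a], of X Y]
    by (simp add: diagrams_def)
qed

lemma independent_schur_of: "\<not> sym.dependent (schur_of ` {X. diagram X} :: 'a::field_char_0 sym set)"
proof
  assume "sym.dependent (schur_of ` {X. diagram X} :: 'a sym set)"
  then obtain S :: "'a sym set" and u where S: "finite S" "S \<subseteq> schur_of ` {X. diagram X}"
    and u: "\<exists>v\<in>S. u v \<noteq> 0" "(\<Sum>v\<in>S. sym_const (u v) * v) = 0"
    unfolding sym.dependent_explicit by blast
  obtain D where D: "D \<subseteq> {X. diagram X}" "finite D" "S = schur_of ` D"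
    using finite_subset_image[OF S] by blast
  have "S \<subseteq> schur_of ` diagrams (card ` D)" using D by (auto simp: diagrams_def)
  then have "sym.dependent (schur_of ` diagrams (card ` D) :: 'a sym set)"
    unfolding sym.dependent_explicit using S(1) u by blast
  then show False using independent_schur_of_finite[of "card ` D", where 'a = 'a] D(2) by simp
qed

text \<open>Homogeneity by counting rather than from the determinant: if S_X were outside the span
  of the monomials of its degree, adjoining it would give an independent set in the span of the
  Schur functions of that size with more elements than there are such functions.\<close>

lemma schur_of_homogeneous:
  assumes "diagram X"
  shows "(schur_of X :: 'a::field_char_0 sym) \<in> sym.span (mon ` {m. weight m = card X})"
proof (rule ccontr)
  let ?M = "mon ` {m. weight m = card X} :: 'a sym set" and ?N = "{card X}"
  let ?B = "schur_of ` diagrams ?N :: 'a sym set"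
  assume *: "schur_of X \<notin> sym.span ?M"
  have fB: "finite ?B" using finite_diagrams[of ?N] by simp
  have M: "?M \<subseteq> sym.span ?B" using mon_span_diagrams[of ?N, where 'a = 'a] by simp
  have ind: "\<not> sym.dependent (insert (schur_of X) ?M)"
    using * independent_mon by (rule sym.independent_insertI)
  have "insert (schur_of X) ?M \<subseteq> sym.span ?B"
    using M assms by (auto simp: diagrams_def intro!: sym.span_base)
  from sym.independent_span_bound[OF fB ind this]
  have fin: "finite (insert (schur_of X) ?M)" and le: "card (insert (schur_of X) ?M) \<le> card ?B" by simp_all
  have "card (diagrams ?N) \<le> card ?M"
    using fin by (intro card_diagrams_le_independent) (auto intro!: sym.span_base)
  moreover have "schur_of X \<notin> ?M" using * sym.span_base[of "schur_of X" ?M] by argo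
  ultimately have "card (diagrams ?N) < card ?B" using le fin by simp
  then show False using card_image_le[OF finite_diagrams[of ?N], of "schur_of :: _ \<Rightarrow> 'a sym"] by simp
qed

lemma span_schur_of: "sym.span (schur_of ` {X. diagram X}) = UNIV"
proof -
  have "F \<in> sym.span (schur_of ` {X. diagram X})" for F :: "'a::field_char_0 sym"
  proof (induction F rule: sym_induct)
    case (mon m)
    have "schur_span (weight m) \<subseteq> sym.span (schur_of ` {X. diagram X} :: 'a sym set)"
      unfolding schur_span_def by (intro sym.span_mono) (auto simp: diagrams_def)
    then show ?case using mon_schur_span by blast
  qed (simp_all add: sym.span_add sym.span_scale)
  then show ?thesis by auto
qed

section \<open>Coefficients in the Schur basis and linear extension from it\<close>

definition coef :: "(nat \<times> nat) set \<Rightarrow> 'a::field_char_0 sym \<Rightarrow> 'a" where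
  "coef X F = sym.representation (schur_of ` {X. diagram X}) F (schur_of X)"

lemma coef_add: "coef X (F + G) = coef X F + coef X G"
  by (simp add: coef_def sym.representation_add[OF independent_schur_of] span_schur_of)

lemma coef_const: "coef X (sym_const a * F) = a * coef X F"
  by (simp add: coef_def sym.representation_scale[OF independent_schur_of] span_schur_of)

lemma coef_0 [simp]: "coef X 0 = 0"
  by (simp add: coef_def sym.representation_zero)

lemma coef_schur_of:
  assumes "diagram X" "diagram Y"
  shows "coef X (schur_of Y :: 'a::field_char_0 sym) = (if X = Y then 1 else 0)"
proof -
  have "schur_of X = (schur_of Y :: 'a sym) \<longleftrightarrow> X = Y"
    using assms inj_onD[OF inj_on_schur_of] by blast
  moreover have "(schur_of Y :: 'a sym) \<in> schur_of ` {X. diagram X}" using assms by blast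
  ultimately show ?thesis
    by (simp add: coef_def sym.representation_basis[OF independent_schur_of])
qed

definition supp :: "'a::field_char_0 sym \<Rightarrow> (nat \<times> nat) set set" where
  "supp F = {X. diagram X \<and> coef X F \<noteq> 0}"

lemma supp_diagram: "supp F \<subseteq> {X. diagram X}"
  by (auto simp: supp_def)

lemma finite_supp: "finite (supp (F :: 'a::field_char_0 sym))"
proof (rule finite_imageD)
  show "finite ((schur_of :: _ \<Rightarrow> 'a sym) ` supp F)"
    by (rule finite_subset[OF _ sym.finite_representation[of "schur_of ` {X. diagram X}" F]])
      (auto simp: supp_def coef_def)
  show "inj_on (schur_of :: _ \<Rightarrow> 'a sym) (supp F)"
    by (rule inj_on_subset[OF inj_on_schur_of]) (auto simp: supp_def)
qed

lemma schur_expand: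
  fixes F :: "'a::field_char_0 sym"
  shows "F = (\<Sum>X\<in>supp F. sym_const (coef X F) * schur_of X)"
proof -
  let ?r = "sym.representation (schur_of ` {X. diagram X}) F"
  have "{v. ?r v \<noteq> 0} = schur_of ` supp F"
    using sym.representation_ne_zero[of "schur_of ` {X. diagram X}" F] by (auto simp: supp_def coef_def)
  then have "(\<Sum>v | ?r v \<noteq> 0. sym_const (?r v) * v) = (\<Sum>X\<in>supp F. sym_const (coef X F) * schur_of X)"
    by (simp add: sum.reindex[OF inj_on_subset[OF inj_on_schur_of]] supp_def Collect_mono coef_def)
  then show ?thesis
    using sym.sum_nonzero_representation_eq[OF independent_schur_of, of F] by (simp add: span_schur_of)
qed

lemma schur_induct [case_names schur add const]:
  fixes F :: "'a::field_char_0 sym"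
  assumes "\<And>X. diagram X \<Longrightarrow> P (schur_of X)" "\<And>F G. P F \<Longrightarrow> P G \<Longrightarrow> P (F + G)"
    "\<And>a F. P F \<Longrightarrow> P (sym_const a * F)"
  shows "P F"
proof -
  have P0: "P 0" using assms(3)[OF assms(1)[OF diagram_empty], of 0] by simp
  have "P (\<Sum>X\<in>K. sym_const (a X) * schur_of X)" if "finite K" "K \<subseteq> {X. diagram X}" for K a
    using that by (induction K rule: finite_induct) (auto intro: assms P0)
  from this[OF finite_supp[of F], of "\<lambda>X. coef X F"] show ?thesis
    by (subst schur_expand) (auto simp: supp_def)
qed

definition schur_ext :: "((nat \<times> nat) set \<Rightarrow> 'a sym) \<Rightarrow> 'a::field_char_0 sym \<Rightarrow> 'a sym" where
  "schur_ext T F = (\<Sum>X\<in>supp F. sym_const (coef X F) * T X)"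

lemma schur_ext_superset:
  assumes "finite K" "supp F \<subseteq> K" "K \<subseteq> {X. diagram X}"
  shows "schur_ext T F = (\<Sum>X\<in>K. sym_const (coef X F) * T X)"
  unfolding schur_ext_def
  by (rule sum.mono_neutral_left) (use assms in \<open>auto simp: supp_def\<close>)

lemma schur_ext_add: "schur_ext T (F + G) = schur_ext T F + schur_ext T G"
proof -
  let ?K = "supp F \<union> supp G"
  have K: "finite ?K" "?K \<subseteq> {X. diagram X}"
    using finite_supp[of F] finite_supp[of G] supp_diagram[of F] supp_diagram[of G] by simp_all
  have "supp (F + G) \<subseteq> ?K" by (auto simp: supp_def coef_add)
  from schur_ext_superset[OF K(1) this K(2)] schur_ext_superset[OF K(1) Un_upper1 K(2)]
    schur_ext_superset[OF K(1) Un_upper2 K(2)]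
  show ?thesis by (simp add: coef_add sym_const_add distrib_right sum.distrib)
qed

lemma schur_ext_const: "schur_ext T (sym_const a * F) = sym_const a * schur_ext T F"
proof -
  have "supp (sym_const a * F) \<subseteq> supp F" by (auto simp: supp_def coef_const)
  then have "schur_ext T (sym_const a * F) = (\<Sum>X\<in>supp F. sym_const (coef X (sym_const a * F)) * T X)"
    by (rule schur_ext_superset[OF finite_supp _ supp_diagram])
  then show ?thesis
    unfolding schur_ext_def[of T F] sum_distrib_left coef_const sym_const_mult by (simp only: mult.assoc)
qed

lemma schur_ext_schur_of [simp]:
  fixes T :: "(nat \<times> nat) set \<Rightarrow> 'a::field_char_0 sym"
  assumes X: "diagram X"
  shows "schur_ext T (schur_of X) = T X"
proof -
  have "Y \<in> supp (schur_of X :: 'a sym) \<longleftrightarrow> Y = X" for Y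
    using coef_schur_of[of Y X, where 'a = 'a] X by (auto simp: supp_def split: if_splits)
  then have "supp (schur_of X :: 'a sym) = {X}" by auto
  then show ?thesis by (simp add: schur_ext_def coef_schur_of X)
qed

section \<open>Box removal operators\<close>

definition sym_linear :: "('a::field_char_0 sym \<Rightarrow> 'a sym) \<Rightarrow> bool" where
  "sym_linear T \<longleftrightarrow> (\<forall>F G. T (F + G) = T F + T G) \<and> (\<forall>a F. T (sym_const a * F) = sym_const a * T F)"

lemma sym_linearI:
  "(\<And>F G. T (F + G) = T F + T G) \<Longrightarrow> (\<And>a F. T (sym_const a * F) = sym_const a * T F) \<Longrightarrow> sym_linear T"
  by (simp add: sym_linear_def)

lemma sym_linear_add: "sym_linear T \<Longrightarrow> T (F + G) = T F + T G"
  by (simp add: sym_linear_def)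

lemma sym_linear_const: "sym_linear T \<Longrightarrow> T (sym_const a * F) = sym_const a * T F"
  by (simp add: sym_linear_def)

lemma sym_linear_0: "sym_linear T \<Longrightarrow> T 0 = 0"
  using sym_linear_const[of T 0 0] by simp

lemma sym_linear_uminus: "sym_linear T \<Longrightarrow> T (- F) = - T F"
  using sym_linear_const[of T "- 1" F] by (simp add: sym_const_uminus)

lemma sym_linear_diff: "sym_linear T \<Longrightarrow> T (F - G) = T F - T G"
  using sym_linear_add[of T F "- G"] by (simp add: sym_linear_uminus)

lemma sym_linear_numeral: "sym_linear T \<Longrightarrow> T (numeral n * F) = numeral n * T F"
  using sym_linear_const[of T "numeral n" F] by (simp add: sym_const_numeral)

lemma sym_linear_of_nat: "sym_linear T \<Longrightarrow> T (of_nat n * F) = of_nat n * T F"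
  using sym_linear_const[of T "of_nat n" F] by (simp add: sym_const_of_nat)

lemma sym_linear_sum: "sym_linear T \<Longrightarrow> T (sum f A) = (\<Sum>x\<in>A. T (f x))"
  by (induction A rule: infinite_finite_induct) (simp_all add: sym_linear_0 sym_linear_add)

lemma sym_linear_mult: "sym_linear (\<lambda>F. G * F)"
  by (rule sym_linearI) (simp_all add: distrib_left mult.left_commute)

lemma sym_linear_raise_der: "sym_linear raise_der"
  by (rule sym_linearI) (simp_all add: raise_der_add raise_der_const_times)

lemma sym_linear_schur_ext: "sym_linear (schur_ext T)"
  by (rule sym_linearI) (simp_all add: schur_ext_add schur_ext_const)

lemma sym_linear_comp: "sym_linear S \<Longrightarrow> sym_linear T \<Longrightarrow> sym_linear (\<lambda>F. S (T F))"
  by (simp add: sym_linear_def)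

lemma sym_linear_plus: "sym_linear S \<Longrightarrow> sym_linear T \<Longrightarrow> sym_linear (\<lambda>F. S F + T F)"
  by (simp add: sym_linear_def distrib_left)

lemma sym_linear_minus: "sym_linear S \<Longrightarrow> sym_linear T \<Longrightarrow> sym_linear (\<lambda>F. S F - T F)"
  by (simp add: sym_linear_def right_diff_distrib)

lemma sym_linear_scale: "sym_linear T \<Longrightarrow> sym_linear (\<lambda>F. G * T F)"
  by (simp add: sym_linear_def distrib_left mult.left_commute)

lemma sym_linear_eqI:
  assumes "sym_linear S" "sym_linear T" "\<And>X. diagram X \<Longrightarrow> S (schur_of X) = T (schur_of X)"
  shows "S F = T F"
  by (induction F rule: schur_induct)
    (simp_all add: assms sym_linear_add[OF assms(1)] sym_linear_add[OF assms(2)]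
      sym_linear_const[OF assms(1)] sym_linear_const[OF assms(2)])

definition lower :: "(nat \<times> nat \<Rightarrow> 'a) \<Rightarrow> 'a::field_char_0 sym \<Rightarrow> 'a sym" where
  "lower g = schur_ext (\<lambda>X. \<Sum>b\<in>removable X. sym_const (g b) * schur_of (X - {b}))"

definition diagonal :: "((nat \<times> nat) set \<Rightarrow> 'a) \<Rightarrow> 'a::field_char_0 sym \<Rightarrow> 'a sym" where
  "diagonal d = schur_ext (\<lambda>X. sym_const (d X) * schur_of X)"

text \<open>A predicate, unlike \<open>lower\<close>, because the raising operators are already
  given as multiplication by p_1 and as the derivation.\<close>

definition raises :: "(nat \<times> nat \<Rightarrow> 'a) \<Rightarrow> ('a::field_char_0 sym \<Rightarrow> 'a sym) \<Rightarrow> bool" where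
  "raises f U \<longleftrightarrow> sym_linear U \<and>
     (\<forall>X. diagram X \<longrightarrow> U (schur_of X) = (\<Sum>b\<in>addable X. sym_const (f b) * schur_of (insert b X)))"

lemma sym_linear_lower: "sym_linear (lower g)"
  by (simp add: lower_def sym_linear_schur_ext)

lemma sym_linear_diagonal: "sym_linear (diagonal d)"
  by (simp add: diagonal_def sym_linear_schur_ext)

lemma lower_schur_of:
  "diagram X \<Longrightarrow> lower g (schur_of X) = (\<Sum>b\<in>removable X. sym_const (g b) * schur_of (X - {b}))"
  by (simp add: lower_def)

lemma diagonal_schur_of: "diagram X \<Longrightarrow> diagonal d (schur_of X) = sym_const (d X) * schur_of X"
  by (simp add: diagonal_def)

lemma raises_power_sum_1: "raises (\<lambda>_. 1) (\<lambda>F. power_sum 1 * F)"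
  unfolding raises_def sym_const_1 mult_1
  by (intro conjI allI impI sym_linear_mult power_sum_1_schur_of)

lemma raises_raise_der: "raises (\<lambda>b. of_int (content b) :: 'a::field_char_0) raise_der"
  unfolding raises_def
proof (intro conjI allI impI)
  fix X :: "(nat \<times> nat) set" assume "diagram X"
  then show "raise_der (schur_of X) =
      (\<Sum>b\<in>addable X. sym_const (of_int (content b)) * schur_of (insert b X) :: 'a sym)"
    using raise_der_schur_of[of X, where 'a = 'a] by (simp only: sym_const_of_int)
qed (rule sym_linear_raise_der)

lemma diagram_Int:
  assumes "diagram X" "diagram Y"
  shows "diagram (X \<inter> Y)"
  unfolding diagram_def[of "X \<inter> Y"]
proof (intro conjI allI impI)
  fix i j i' j'
  assume "(i, j) \<in> X \<inter> Y \<and> i' \<le> i \<and> j' \<le> j"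
  then show "(i', j') \<in> X \<inter> Y"
    using diagram_down[OF assms(1), of i j i' j'] diagram_down[OF assms(2), of i j i' j'] by simp
qed (simp add: assms diagram_finite)

lemma diagram_Un:
  assumes "diagram X" "diagram Y"
  shows "diagram (X \<union> Y)"
  unfolding diagram_def[of "X \<union> Y"]
proof (intro conjI allI impI)
  fix i j i' j'
  assume "(i, j) \<in> X \<union> Y \<and> i' \<le> i \<and> j' \<le> j"
  then show "(i', j') \<in> X \<union> Y"
    using diagram_down[OF assms(1), of i j i' j'] diagram_down[OF assms(2), of i j i' j'] by auto
qed (simp add: assms diagram_finite)

lemma addable_removable:
  assumes "diagram X"
  shows "b \<in> addable X \<Longrightarrow> b \<in> removable (insert b X)"
    and "b \<in> removable X \<Longrightarrow> b \<in> addable (X - {b})"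
  using assms by (auto simp: addable_def removable_def insert_absorb)

text \<open>Adding one box and removing a different one may be done in either order, since the
  intermediate diagrams are recovered as X \<inter> (X + b - b') and X \<union> (X - b' +
  b).\<close>

lemma addable_removable_swap:
  assumes X: "diagram X" and ne: "b \<noteq> b'"
  shows "b \<in> addable X \<and> b' \<in> removable (insert b X) \<longleftrightarrow> b' \<in> removable X \<and> b \<in> addable (X - {b'})"
proof -
  have eq: "insert b X - {b'} = insert b (X - {b'})" using ne by auto
  have "diagram (X - {b'})" if "diagram (insert b X - {b'})"
  proof -
    have "X \<inter> (insert b X - {b'}) = X - {b'}" by auto
    with diagram_Int[OF X that] show ?thesis by simp
  qed
  moreover have "diagram (insert b X)" if "diagram (insert b (X - {b'}))" "b' \<in> X"
  proof -
    have "X \<union> insert b (X - {b'}) = insert b X" using that(2) by auto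
    with diagram_Un[OF X that(1)] show ?thesis by simp
  qed
  ultimately show ?thesis
    using ne by (auto simp: addable_def removable_def eq)
qed

lemma sum_split_diagonal:
  fixes h :: "'b \<times> 'b \<Rightarrow> 'c::comm_monoid_add"
  assumes "finite P"
  shows "sum h P = (\<Sum>x | (x, x) \<in> P. h (x, x)) + (\<Sum>x\<in>{x\<in>P. fst x \<noteq> snd x}. h x)"
proof -
  have "(\<Sum>x | (x, x) \<in> P. h (x, x)) = (\<Sum>x\<in>{x\<in>P. fst x = snd x}. h x)"
    by (rule sum.reindex_bij_witness[of _ fst "\<lambda>x. (x, x)"]) auto
  moreover have "sum h P = (\<Sum>x\<in>{x\<in>P. fst x = snd x}. h x) + (\<Sum>x\<in>{x\<in>P. fst x \<noteq> snd x}. h x)"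
    using assms by (subst sum.union_disjoint[symmetric]) (auto intro: sum.cong)
  ultimately show ?thesis by simp
qed

text \<open>Both orders reach the same diagrams with the same weights as long as the added and the
  removed box differ. Only returning to X by adding and removing the same box depends on the order,
  and this gives the diagonal term.\<close>

lemma lower_raises_commute:
  fixes U :: "'a::field_char_0 sym \<Rightarrow> 'a sym"
  assumes U: "raises f U"
  shows "lower g (U F) = U (lower g F) +
    diagonal (\<lambda>X. (\<Sum>b\<in>addable X. f b * g b) - (\<Sum>b\<in>removable X. f b * g b)) F"
proof (rule sym_linear_eqI[of "\<lambda>F. lower g (U F)" "\<lambda>F. U (lower g F) +
    diagonal (\<lambda>X. (\<Sum>b\<in>addable X. f b * g b) - (\<Sum>b\<in>removable X. f b * g b)) F"])
  note lin = sym_linear_lower sym_linear_diagonal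
  have linU: "sym_linear U" using U by (simp add: raises_def)
  show "sym_linear (\<lambda>F. lower g (U F))" by (rule sym_linear_comp[OF sym_linear_lower linU])
  show "sym_linear (\<lambda>F. U (lower g F) +
      diagonal (\<lambda>X. (\<Sum>b\<in>addable X. f b * g b) - (\<Sum>b\<in>removable X. f b * g b)) F)"
    by (rule sym_linear_plus[OF sym_linear_comp[OF linU sym_linear_lower] sym_linear_diagonal])
  fix X :: "(nat \<times> nat) set" assume X: "diagram X"
  let ?h = "\<lambda>(b, b'). sym_const (f b * g b') * schur_of (insert b X - {b'}) :: 'a sym"
  let ?k = "\<lambda>(b, b'). sym_const (f b * g b') * schur_of (insert b (X - {b'})) :: 'a sym"
  let ?P = "Sigma (addable X) (\<lambda>b. removable (insert b X))"
  \<comment> \<open>Pairs are written as (added box, removed box) in both sets, although in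
    \<open>?Q\<close> the removal happens first; the off-diagonal parts then coincide as
    sets.\<close>
  let ?Q = "{(b, b'). b' \<in> removable X \<and> b \<in> addable (X - {b'})}"
  have fP: "finite ?P"
    using X by (auto intro!: finite_SigmaI simp: finite_addable finite_removable addable_diagram)
  have Q: "?Q = prod.swap ` Sigma (removable X) (\<lambda>b'. addable (X - {b'}))" by force
  have fQ: "finite ?Q"
    unfolding Q using X
    by (auto intro!: finite_imageI finite_SigmaI simp: finite_addable finite_removable removable_diagram)
  have off: "{x\<in>?P. fst x \<noteq> snd x} = {x\<in>?Q. fst x \<noteq> snd x}"
  proof (rule Set.set_eqI)
    fix x :: "(nat \<times> nat) \<times> (nat \<times> nat)"
    obtain b b' where x: "x = (b, b')" by (cases x)
    show "x \<in> {x\<in>?P. fst x \<noteq> snd x} \<longleftrightarrow> x \<in> {x\<in>?Q. fst x \<noteq> snd x}"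
      using addable_removable_swap[OF X, of b b'] unfolding x by auto
  qed
  have "lower g (U (schur_of X)) = (\<Sum>b\<in>addable X. sym_const (f b) * (\<Sum>b'\<in>removable (insert b X).
      sym_const (g b') * schur_of (insert b X - {b'})))"
    using U X by (simp add: raises_def sym_linear_sum[OF lin(1)] sym_linear_const[OF lin(1)]
      lower_schur_of addable_diagram)
  also have "\<dots> = (\<Sum>b\<in>addable X. \<Sum>b'\<in>removable (insert b X).
      sym_const (f b * g b') * schur_of (insert b X - {b'}))"
    by (simp only: sum_distrib_left sym_const_mult mult.assoc)
  also have "\<dots> = sum ?h ?P"
    by (rule sum.Sigma) (use X in \<open>simp_all add: finite_addable finite_removable addable_diagram\<close>)
  also have "\<dots> = (\<Sum>b | (b, b) \<in> ?P. ?h (b, b)) + (\<Sum>x\<in>{x\<in>?P. fst x \<noteq> snd x}. ?h x)"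
    by (rule sum_split_diagonal[OF fP])
  also have "(\<Sum>x\<in>{x\<in>?P. fst x \<noteq> snd x}. ?h x) = (\<Sum>x\<in>{x\<in>?Q. fst x \<noteq> snd x}. ?k x)"
    unfolding off by (rule sum.cong) (auto simp: insert_Diff_if)
  also have "(\<Sum>b | (b, b) \<in> ?P. ?h (b, b)) = (\<Sum>b\<in>addable X. sym_const (f b * g b)) * schur_of X"
  proof -
    have "(b, b) \<in> ?P \<longleftrightarrow> b \<in> addable X" for b using addable_removable(1)[OF X, of b] by auto
    moreover have "insert b X - {b} = X" if "b \<in> addable X" for b using that by (auto simp: addable_def)
    ultimately show ?thesis by (simp add: sum_distrib_right)
  qed
  finally have L: "lower g (U (schur_of X)) = (\<Sum>b\<in>addable X. sym_const (f b * g b)) * schur_of X +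
      (\<Sum>x\<in>{x\<in>?Q. fst x \<noteq> snd x}. ?k x)" .
  have "U (lower g (schur_of X)) = (\<Sum>b'\<in>removable X. sym_const (g b') * (\<Sum>b\<in>addable (X - {b'}).
      sym_const (f b) * schur_of (insert b (X - {b'}))))"
    using U X by (simp add: raises_def sym_linear_sum[OF linU] sym_linear_const[OF linU]
      lower_schur_of removable_diagram)
  also have "\<dots> = (\<Sum>b'\<in>removable X. \<Sum>b\<in>addable (X - {b'}).
      sym_const (f b * g b') * schur_of (insert b (X - {b'})))"
    by (simp only: sum_distrib_left sym_const_mult mult.assoc mult.left_commute)
  also have "\<dots> = (\<Sum>(b', b)\<in>Sigma (removable X) (\<lambda>b'. addable (X - {b'})).
      sym_const (f b * g b') * schur_of (insert b (X - {b'})))"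
    by (rule sum.Sigma) (use X in \<open>simp_all add: finite_addable finite_removable removable_diagram\<close>)
  also have "\<dots> = sum ?k ?Q"
    unfolding Q by (subst sum.reindex) (auto simp: inj_on_def case_prod_beta)
  also have "\<dots> = (\<Sum>b | (b, b) \<in> ?Q. ?k (b, b)) + (\<Sum>x\<in>{x\<in>?Q. fst x \<noteq> snd x}. ?k x)"
    by (rule sum_split_diagonal[OF fQ])
  also have "(\<Sum>b | (b, b) \<in> ?Q. ?k (b, b)) = (\<Sum>b\<in>removable X. sym_const (f b * g b)) * schur_of X"
  proof -
    have "(b, b) \<in> ?Q \<longleftrightarrow> b \<in> removable X" for b using addable_removable(2)[OF X, of b] by auto
    moreover have "insert b (X - {b}) = X" if "b \<in> removable X" for b using that by (auto simp: removable_def)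
    ultimately show ?thesis by (simp add: sum_distrib_right)
  qed
  finally show "lower g (U (schur_of X)) = U (lower g (schur_of X)) +
      diagonal (\<lambda>X. (\<Sum>b\<in>addable X. f b * g b) - (\<Sum>b\<in>removable X. f b * g b)) (schur_of X)"
    unfolding L by (simp add: diagonal_schur_of[OF X] sym_const_diff sym_const_sum left_diff_distrib)
qed

definition size_op :: "'a::field_char_0 sym \<Rightarrow> 'a sym" where
  "size_op = diagonal (\<lambda>X. of_nat (card X))"

definition content_op :: "'a::field_char_0 sym \<Rightarrow> 'a sym" where
  "content_op = diagonal (\<lambda>X. \<Sum>b\<in>X. of_int (content b))"

lemma sym_linear_size_op: "sym_linear size_op" and sym_linear_content_op: "sym_linear content_op"
  by (simp_all add: size_op_def content_op_def sym_linear_diagonal)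

text \<open>If \<open>d\<close> grows by \<open>g b\<close> with every added box \<open>b\<close>,
  commuting it with a raising operator multiplies the weights by \<open>g\<close>. For the size this
  reproduces the operator; for the sum of contents it turns p_1 into
  \<open>raise_der\<close>.\<close>

lemma diagonal_raises:
  assumes U: "raises f U" "raises (\<lambda>b. f b * g b) V"
    and d: "\<And>X b. diagram X \<Longrightarrow> b \<in> addable X \<Longrightarrow> d (insert b X) = d X + g b"
  shows "diagonal d (U F) = U (diagonal d F) + V F"
proof (rule sym_linear_eqI[of "\<lambda>F. diagonal d (U F)" "\<lambda>F. U (diagonal d F) + V F"])
  have lin: "sym_linear U" "sym_linear V" using U by (simp_all add: raises_def)
  show "sym_linear (\<lambda>F. diagonal d (U F))"
    by (rule sym_linear_comp[OF sym_linear_diagonal lin(1)])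
  show "sym_linear (\<lambda>F. U (diagonal d F) + V F)"
    by (rule sym_linear_plus[OF sym_linear_comp[OF lin(1) sym_linear_diagonal] lin(2)])
  fix X :: "(nat \<times> nat) set" assume X: "diagram X"
  have "sym_const (f b) * (sym_const (d X + g b) * schur_of (insert b X)) =
      sym_const (d X) * (sym_const (f b) * schur_of (insert b X)) + sym_const (f b * g b) * schur_of (insert b X)" for b
    by (simp only: sym_const_add sym_const_mult distrib_left distrib_right ac_simps)
  then show "diagonal d (U (schur_of X)) = U (diagonal d (schur_of X)) + V (schur_of X)"
    using U X by (simp add: raises_def sym_linear_sum[OF sym_linear_diagonal] sym_linear_const[OF lin(1)]
        sym_linear_const[OF sym_linear_diagonal] diagonal_schur_of addable_diagram d
        sum.distrib[symmetric] sum_distrib_left)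
qed

lemma lower_diagonal:
  assumes d: "\<And>X b. diagram X \<Longrightarrow> b \<in> removable X \<Longrightarrow> d X = d (X - {b}) + g b"
  shows "lower f (diagonal d F) = diagonal d (lower f F) + lower (\<lambda>b. g b * f b) F"
proof (rule sym_linear_eqI[of "\<lambda>F. lower f (diagonal d F)" "\<lambda>F. diagonal d (lower f F) + lower (\<lambda>b. g b * f b) F"])
  note lin = sym_linear_lower sym_linear_diagonal
  show "sym_linear (\<lambda>F. lower f (diagonal d F))"
    by (rule sym_linear_comp[OF lin])
  show "sym_linear (\<lambda>F. diagonal d (lower f F) + lower (\<lambda>b. g b * f b) F)"
    by (rule sym_linear_plus[OF sym_linear_comp[OF lin(2,1)] lin(1)])
  fix X :: "(nat \<times> nat) set" assume X: "diagram X"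
  have "sym_const (d X) * (sym_const (f b) * schur_of (X - {b})) =
      sym_const (f b) * (sym_const (d (X - {b})) * schur_of (X - {b})) + sym_const (g b * f b) * schur_of (X - {b})"
    if "b \<in> removable X" for b
    by (simp only: d[OF X that] sym_const_add sym_const_mult distrib_left distrib_right ac_simps)
  then show "lower f (diagonal d (schur_of X)) = diagonal d (lower f (schur_of X)) + lower (\<lambda>b. g b * f b) (schur_of X)"
    using X by (simp add: sym_linear_sum[OF lin(2)] sym_linear_const[OF lin(1)] sym_linear_const[OF lin(2)]
        diagonal_schur_of lower_schur_of removable_diagram sum.distrib[symmetric] sum_distrib_left)
qed

lemma size_op_raises:
  assumes "raises f U"
  shows "size_op (U F) = U (size_op F) + U F"
  unfolding size_op_def
  by (rule diagonal_raises[where g = "\<lambda>_. 1"]) (use assms in \<open>simp_all add: card_insert_addable\<close>)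

lemma card_removable: "diagram X \<Longrightarrow> b \<in> removable X \<Longrightarrow> card X = Suc (card (X - {b}))"
  using card.remove[of X b] by (simp add: removable_def diagram_finite)

lemma lower_size_op: "lower f (size_op F) = size_op (lower f F) + lower f F"
  using lower_diagonal[of "\<lambda>X. of_nat (card X)" "\<lambda>_. 1" f F]
  by (simp add: size_op_def card_removable)

lemma content_op_raises:
  assumes "raises f U" "raises (\<lambda>b. f b * of_int (content b)) V"
  shows "content_op (U F) = U (content_op F) + V F"
  unfolding content_op_def
  by (rule diagonal_raises[OF assms]) (simp add: addable_def diagram_finite)

lemma lower_content_op:
  "lower f (content_op F) = content_op (lower f F) + lower (\<lambda>b. of_int (content b) * f b) F"
  unfolding content_op_def
proof (rule lower_diagonal)
  fix X b assume "diagram X" "b \<in> removable X"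
  then show "(\<Sum>b\<in>X. of_int (content b)) = (\<Sum>b\<in>X - {b}. of_int (content b)) + of_int (content b)"
    by (subst sum.remove[of X b]) (auto simp: removable_def diagram_finite)
qed

section \<open>The Laguerre form\<close>

lemma diagonal_cong:
  assumes "\<And>X. diagram X \<Longrightarrow> d X = d' X"
  shows "diagonal d F = diagonal d' F"
  by (rule sym_linear_eqI[OF sym_linear_diagonal sym_linear_diagonal])
    (simp add: diagonal_schur_of assms)

text \<open>The diagonal terms occurring in the commutators with \<open>D\<close> are affine in the
  size and in the sum of contents.\<close>

lemma diagonal_affine:
  fixes F :: "'a::field_char_0 sym"
  shows "diagonal (\<lambda>X. a * of_nat (card X) + (b * (\<Sum>x\<in>X. of_int (content x)) + c)) F =
    sym_const a * size_op F + (sym_const b * content_op F + sym_const c * F)"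
proof (rule sym_linear_eqI[of "diagonal (\<lambda>X. a * of_nat (card X) + (b * (\<Sum>x\<in>X. of_int (content x)) + c))"
    "\<lambda>F. sym_const a * size_op F + (sym_const b * content_op F + sym_const c * F)"])
  show "sym_linear (\<lambda>F :: 'a sym. sym_const a * size_op F + (sym_const b * content_op F + sym_const c * F))"
    by (rule sym_linear_plus[OF sym_linear_scale[OF sym_linear_size_op]
          sym_linear_plus[OF sym_linear_scale[OF sym_linear_content_op] sym_linear_mult]])
  fix X :: "(nat \<times> nat) set" assume "diagram X"
  then show "diagonal (\<lambda>X. a * of_nat (card X) + (b * (\<Sum>x\<in>X. of_int (content x)) + c)) (schur_of X) =
      sym_const a * size_op (schur_of X) + (sym_const b * content_op (schur_of X) + sym_const c * schur_of X)"
    by (simp only: size_op_def content_op_def diagonal_schur_of sym_const_add sym_const_mult distrib_right mult.assoc)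
qed (rule sym_linear_diagonal)

lemma sum_triangle_box:
  fixes h :: "nat \<Rightarrow> nat \<Rightarrow> 'c::comm_monoid_add"
  assumes "\<And>i j. i \<ge> K \<or> j \<ge> M \<Longrightarrow> h i j = 0"
  shows "(\<Sum>i<K. \<Sum>j<M. h i j) = (\<Sum>k<K + M. \<Sum>i\<le>k. h i (k - i))"
proof -
  have fin: "finite {(i, j). i + j < K + M}"
    by (rule finite_subset[of _ "{..<K + M} \<times> {..<K + M}"]) auto
  have "(\<Sum>i<K. \<Sum>j<M. h i j) = (\<Sum>(i, j)\<in>{..<K} \<times> {..<M}. h i j)"
    by (rule sum.cartesian_product)
  also have "\<dots> = (\<Sum>(i, j)\<in>{(i, j). i + j < K + M}. h i j)"
    by (rule sum.mono_neutral_left[OF fin]) (auto simp: not_less intro!: assms)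
  also have "\<dots> = (\<Sum>k<K + M. \<Sum>i\<le>k. h i (k - i))"
    by (rule sum.triangle_reindex)
  finally show ?thesis .
qed

section \<open>Commutators of the Laguerre lowering operator\<close>

locale laguerre =
  fixes z z' :: "'a::field_char_0"
begin

definition box_weight :: "nat \<times> nat \<Rightarrow> 'a" where
  "box_weight b = (z + of_int (content b)) * (z' + of_int (content b))"

definition D :: "'a sym \<Rightarrow> 'a sym" where
  "D = lower box_weight"

definition D\<^sub>1 :: "'a sym \<Rightarrow> 'a sym" where
  "D\<^sub>1 = lower (\<lambda>b. of_int (content b) * box_weight b)"

text \<open>The adjoint of multiplication by p_2 for the form defined later: p_2 is the commutator
  of \<open>raise_der\<close> with p_1, whose adjoints are \<open>D\<^sub>1\<close> and
  \<open>D\<close>.\<close>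

definition D\<^sub>2 :: "'a sym \<Rightarrow> 'a sym" where
  "D\<^sub>2 F = D (D\<^sub>1 F) - D\<^sub>1 (D F)"

definition mul\<^sub>1 :: "'a sym \<Rightarrow> 'a sym" where
  "mul\<^sub>1 F = power_sum 1 * F"

definition mul\<^sub>2 :: "'a sym \<Rightarrow> 'a sym" where
  "mul\<^sub>2 F = power_sum 2 * F"

definition s :: "'a sym" where "s = sym_const (z + z')"

definition t :: "'a sym" where "t = sym_const (z * z')"

lemma lin_D: "sym_linear D" and lin_D1: "sym_linear D\<^sub>1"
  by (simp_all add: D_def D\<^sub>1_def sym_linear_lower)

lemma lin_D2: "sym_linear D\<^sub>2"
  unfolding D\<^sub>2_def by (intro sym_linear_minus sym_linear_comp[OF lin_D lin_D1] sym_linear_comp[OF lin_D1 lin_D])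

lemma lin_mul1: "sym_linear mul\<^sub>1" and lin_mul2: "sym_linear mul\<^sub>2"
  unfolding mul\<^sub>1_def mul\<^sub>2_def by (rule sym_linear_mult)+

lemma raises_mul1: "raises (\<lambda>_. 1) mul\<^sub>1"
  unfolding mul\<^sub>1_def by (rule raises_power_sum_1)

text \<open>The polynomial (z + c) (z' + c) has constant second difference 2 and value z z' at c =
  0, so the diagonal term is 2 |X| + z z'.\<close>

lemma D_mul1: "D (mul\<^sub>1 F) = mul\<^sub>1 (D F) + (2 * size_op F + t * F)"
proof -
  have "diagonal (\<lambda>X. (\<Sum>b\<in>addable X. 1 * box_weight b) - (\<Sum>b\<in>removable X. 1 * box_weight b)) F
      = diagonal (\<lambda>X. 2 * of_nat (card X) + (0 * (\<Sum>x\<in>X. of_int (content x)) + z * z')) F"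
  proof (rule diagonal_cong)
    fix X assume X: "diagram X"
    show "(\<Sum>b\<in>addable X. 1 * box_weight b) - (\<Sum>b\<in>removable X. 1 * box_weight b) =
        2 * of_nat (card X) + (0 * (\<Sum>x\<in>X. of_int (content x)) + z * z')"
      using addable_removable_sum[OF X, of "\<lambda>c. (z + of_int c) * (z' + of_int c)"]
      by (simp add: box_weight_def algebra_simps)
  qed
  then show ?thesis
    unfolding D_def lower_raises_commute[OF raises_mul1] diagonal_affine
    by (simp add: sym_const_numeral t_def)
qed

text \<open>For the cubic c (z + c) (z' + c) the second difference is 6 c + 2 (z + z'), and the
  value at 0 vanishes; this is where the sum of contents comes in.\<close>

lemma D_raise: "D (raise_der F) = raise_der (D F) + (6 * content_op F + 2 * (s * size_op F))"
proof -
  have "diagonal (\<lambda>X. (\<Sum>b\<in>addable X. of_int (content b) * box_weight b) -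
        (\<Sum>b\<in>removable X. of_int (content b) * box_weight b)) F
      = diagonal (\<lambda>X. 2 * (z + z') * of_nat (card X) + (6 * (\<Sum>x\<in>X. of_int (content x)) + 0)) F"
  proof (rule diagonal_cong)
    fix X assume X: "diagram X"
    have "(\<Sum>b\<in>X. 2 * (z + z') + 6 * of_int (content b)) =
        2 * (z + z') * of_nat (card X) + 6 * (\<Sum>b\<in>X. of_int (content b))"
      by (simp add: sum.distrib sum_distrib_left)
    moreover have "(\<Sum>b\<in>X. 2 * (z + z') + 6 * of_int (content b)) =
        (\<Sum>b\<in>X. of_int (content b + 1) * ((z + of_int (content b + 1)) * (z' + of_int (content b + 1))) -
          2 * (of_int (content b) * ((z + of_int (content b)) * (z' + of_int (content b)))) +
          of_int (content b - 1) * ((z + of_int (content b - 1)) * (z' + of_int (content b - 1))))"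
      by (rule sum.cong) (simp_all add: algebra_simps)
    ultimately show "(\<Sum>b\<in>addable X. of_int (content b) * box_weight b) -
        (\<Sum>b\<in>removable X. of_int (content b) * box_weight b) =
        2 * (z + z') * of_nat (card X) + (6 * (\<Sum>x\<in>X. of_int (content x)) + 0)"
      using addable_removable_sum[OF X, of "\<lambda>c. of_int c * ((z + of_int c) * (z' + of_int c))"]
      by (simp only: box_weight_def) simp
  qed
  then show ?thesis
    unfolding D_def lower_raises_commute[OF raises_raise_der] diagonal_affine
    by (simp add: sym_const_add sym_const_mult sym_const_numeral s_def distrib_left distrib_right mult.assoc)
qed

lemma size_op_mul1: "size_op (mul\<^sub>1 F) = mul\<^sub>1 (size_op F) + mul\<^sub>1 F"
  by (rule size_op_raises[OF raises_mul1])

lemma size_op_raise: "size_op (raise_der F) = raise_der (size_op F) + raise_der F"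
  by (rule size_op_raises[OF raises_raise_der])

lemma content_op_mul1: "content_op (mul\<^sub>1 F) = mul\<^sub>1 (content_op F) + raise_der F"
  by (rule content_op_raises[OF raises_mul1]) (simp add: raises_raise_der)

lemma D_size_op: "D (size_op F) = size_op (D F) + D F"
  and D_content_op: "D (content_op F) = content_op (D F) + D\<^sub>1 F"
  by (simp_all add: D_def D\<^sub>1_def lower_size_op lower_content_op)

lemma mul2_eq: "mul\<^sub>2 F = raise_der (mul\<^sub>1 F) - mul\<^sub>1 (raise_der F)"
  by (simp add: mul\<^sub>1_def mul\<^sub>2_def raise_der_mult numeral_2_eq_2 raise_der_power_sum)

text \<open>Jacobi identity for [D, [R, p_1]], R being the derivation: [6 content + 2 s size, p_1] =
  6 R + 2 s p_1 and [R, 2 size + t] = - 2 R.\<close>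

lemma D_mul2: "D (mul\<^sub>2 F) = mul\<^sub>2 (D F) + (4 * raise_der F + 2 * (s * mul\<^sub>1 F))"
proof -
  have lin: "sym_linear raise_der" by (rule sym_linear_raise_der)
  have s: "T (s * F) = s * T F" if "sym_linear T" for T F
    unfolding s_def by (rule sym_linear_const[OF that])
  have t: "T (t * F) = t * T F" if "sym_linear T" for T F
    unfolding t_def by (rule sym_linear_const[OF that])
  show ?thesis
    unfolding mul2_eq
    by (simp add: sym_linear_diff[OF lin_D] D_mul1 D_raise raise_der_add
        sym_linear_add[OF lin_mul1] sym_linear_numeral[OF lin] sym_linear_numeral[OF lin_mul1]
        s[OF lin] s[OF lin_mul1] t[OF lin] t[OF lin_mul1]
        size_op_mul1 size_op_raise content_op_mul1 distrib_left)
qed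

subsection \<open>The exponential of the lowering operator\<close>

lemma lin_D_funpow: "sym_linear (D ^^ n)"
  by (induction n) (simp_all add: sym_linear_def sym_linear_add[OF lin_D] sym_linear_const[OF lin_D])

lemma D_funpow_schur_of:
  assumes "diagram X" "n > card X"
  shows "(D ^^ n) (schur_of X) = 0"
  using assms
proof (induction n arbitrary: X)
  case (Suc n)
  have "(D ^^ n) (schur_of (X - {b})) = 0" if "b \<in> removable X" for b
    using Suc.IH[OF removable_diagram[OF that]] card_removable[OF Suc.prems(1) that] Suc.prems(2) by simp
  moreover have "D (schur_of X) = (\<Sum>b\<in>removable X. sym_const (box_weight b) * schur_of (X - {b}))"
    unfolding D_def by (rule lower_schur_of[OF Suc.prems(1)])
  ultimately show ?case
    by (simp add: funpow_Suc_right sym_linear_sum[OF lin_D_funpow] sym_linear_const[OF lin_D_funpow]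
        del: funpow.simps)
qed simp

text \<open>The exponential series stops at the size of the diagram, since each \<open>D\<close>
  removes a box. The cutoff depends on the basis element, hence the linear extension from the Schur
  basis.\<close>

definition exp_D :: "'a \<Rightarrow> 'a sym \<Rightarrow> 'a sym" where
  "exp_D x = schur_ext (\<lambda>X. \<Sum>n<Suc (card X). sym_const (x ^ n / fact n) * (D ^^ n) (schur_of X))"

lemma lin_exp_D: "sym_linear (exp_D x)"
  by (simp add: exp_D_def sym_linear_schur_ext)

text \<open>For a given F one cutoff serves all x, and every larger one as well; in this form the
  statement passes to sums by taking the maximum.\<close>

lemma exp_D_bound:
  "\<exists>M. (\<forall>n\<ge>M. (D ^^ n) F = 0) \<and> (\<forall>x. \<forall>N\<ge>M. exp_D x F = (\<Sum>n<N. sym_const (x ^ n / fact n) * (D ^^ n) F))"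
proof (induction F rule: schur_induct)
  case (schur X)
  have "exp_D x (schur_of X) = (\<Sum>n<N. sym_const (x ^ n / fact n) * (D ^^ n) (schur_of X))"
    if "N \<ge> Suc (card X)" for x N
    unfolding exp_D_def schur_ext_schur_of[OF schur]
    by (rule sum.mono_neutral_left) (use that in \<open>auto simp: D_funpow_schur_of[OF schur]\<close>)
  then show ?case
    by (intro exI[of _ "Suc (card X)"]) (simp add: D_funpow_schur_of[OF schur])
next
  case (add F G)
  then obtain M M' where
    "\<forall>n\<ge>M. (D ^^ n) F = 0" "\<forall>x. \<forall>N\<ge>M. exp_D x F = (\<Sum>n<N. sym_const (x ^ n / fact n) * (D ^^ n) F)"
    "\<forall>n\<ge>M'. (D ^^ n) G = 0" "\<forall>x. \<forall>N\<ge>M'. exp_D x G = (\<Sum>n<N. sym_const (x ^ n / fact n) * (D ^^ n) G)"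
    by blast
  note M = this
  show ?case
  proof (intro exI[of _ "max M M'"] conjI allI impI)
    fix n assume "max M M' \<le> n"
    then show "(D ^^ n) (F + G) = 0" using M(1,3) by (simp add: sym_linear_add[OF lin_D_funpow])
  next
    fix x N assume "max M M' \<le> N"
    then have "exp_D x F = (\<Sum>n<N. sym_const (x ^ n / fact n) * (D ^^ n) F)"
      "exp_D x G = (\<Sum>n<N. sym_const (x ^ n / fact n) * (D ^^ n) G)" using M(2,4) by simp_all
    then show "exp_D x (F + G) = (\<Sum>n<N. sym_const (x ^ n / fact n) * (D ^^ n) (F + G))"
      by (simp only: sym_linear_add[OF lin_D_funpow] sym_linear_add[OF lin_exp_D] distrib_left sum.distrib)
  qed
next
  case (const a F)
  then obtain M where
    "\<forall>n\<ge>M. (D ^^ n) F = 0" "\<forall>x. \<forall>N\<ge>M. exp_D x F = (\<Sum>n<N. sym_const (x ^ n / fact n) * (D ^^ n) F)"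
    by blast
  note M = this
  show ?case
  proof (intro exI[of _ M] conjI allI impI)
    fix n assume "M \<le> n"
    then show "(D ^^ n) (sym_const a * F) = 0" using M(1) by (simp add: sym_linear_const[OF lin_D_funpow])
  next
    fix x N assume "M \<le> N"
    then have "exp_D x F = (\<Sum>n<N. sym_const (x ^ n / fact n) * (D ^^ n) F)" using M(2) by simp
    then show "exp_D x (sym_const a * F) = (\<Sum>n<N. sym_const (x ^ n / fact n) * (D ^^ n) (sym_const a * F))"
      by (simp only: sym_linear_const[OF lin_D_funpow] sym_linear_const[OF lin_exp_D]
        sum_distrib_left mult.left_commute)
  qed
qed

lemma D_nilpotent: obtains M where "\<And>n. n \<ge> M \<Longrightarrow> (D ^^ n) F = 0"
  using exp_D_bound[of F] by blast

lemma exp_D_eq: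
  assumes "\<And>n. n \<ge> N \<Longrightarrow> (D ^^ n) F = 0"
  shows "exp_D x F = (\<Sum>n<N. sym_const (x ^ n / fact n) * (D ^^ n) F)"
proof -
  obtain M where M: "\<forall>x. \<forall>N\<ge>M. exp_D x F = (\<Sum>n<N. sym_const (x ^ n / fact n) * (D ^^ n) F)"
    using exp_D_bound[of F] by blast
  have "exp_D x F = (\<Sum>n<max M N. sym_const (x ^ n / fact n) * (D ^^ n) F)"
    using M by simp
  also have "\<dots> = (\<Sum>n<N. sym_const (x ^ n / fact n) * (D ^^ n) F)"
    by (rule sum.mono_neutral_right) (auto simp: assms)
  finally show ?thesis .
qed

lemma exp_D_0: "exp_D 0 F = F"
proof -
  obtain M where M: "\<And>n. n \<ge> M \<Longrightarrow> (D ^^ n) F = 0" using D_nilpotent[of F] by blast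
  have "exp_D 0 F = (\<Sum>n<Suc M. sym_const (0 ^ n / fact n) * (D ^^ n) F)"
    by (rule exp_D_eq) (simp add: M)
  also have "\<dots> = (\<Sum>n\<in>{0}. sym_const (0 ^ n / fact n) * (D ^^ n) F)"
    by (rule sum.mono_neutral_right) (auto simp: power_0_left)
  finally show ?thesis by simp
qed

text \<open>Cauchy product of the two finite series and the binomial theorem. With
  \<open>exp_D_0\<close> it makes \<open>exp_D (- 1)\<close> the inverse of
  \<open>exp_D 1\<close>.\<close>

lemma exp_D_add: "exp_D x (exp_D y F) = exp_D (x + y) F"
proof -
  obtain M where M: "\<And>n. n \<ge> M \<Longrightarrow> (D ^^ n) F = 0" using D_nilpotent[of F] by blast
  have inner: "exp_D x ((D ^^ j) F) = (\<Sum>i<M. sym_const (x ^ i / fact i) * (D ^^ (i + j)) F)" for j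
  proof -
    have comp: "(D ^^ (i + j)) F = (D ^^ i) ((D ^^ j) F)" for i by (simp add: funpow_add)
    show ?thesis unfolding comp by (rule exp_D_eq) (simp add: M flip: comp)
  qed
  have binom: "(\<Sum>i\<le>k. (x ^ i / fact i) * (y ^ (k - i) / fact (k - i))) = (x + y) ^ k / fact k" for k
    unfolding binomial_ring sum_divide_distrib
    by (rule sum.cong) (simp_all add: binomial_fact field_simps)
  have y: "exp_D y F = (\<Sum>j<M. sym_const (y ^ j / fact j) * (D ^^ j) F)"
    by (rule exp_D_eq) (rule M)
  have "exp_D x (exp_D y F) = (\<Sum>j<M. \<Sum>i<M. sym_const (y ^ j / fact j) *
      (sym_const (x ^ i / fact i) * (D ^^ (i + j)) F))"
    unfolding y sym_linear_sum[OF lin_exp_D] sym_linear_const[OF lin_exp_D] inner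
    by (simp only: sum_distrib_left)
  also have "\<dots> = (\<Sum>i<M. \<Sum>j<M. sym_const ((x ^ i / fact i) * (y ^ j / fact j)) * (D ^^ (i + j)) F)"
    by (subst sum.swap) (simp only: sym_const_mult ac_simps)
  also have "\<dots> = (\<Sum>k<M + M. \<Sum>i\<le>k. sym_const ((x ^ i / fact i) * (y ^ (k - i) / fact (k - i))) *
      (D ^^ (i + (k - i))) F)"
    by (rule sum_triangle_box) (auto simp: M)
  also have "\<dots> = (\<Sum>k<M + M. sym_const ((x + y) ^ k / fact k) * (D ^^ k) F)"
  proof (rule sum.cong[OF refl])
    fix k
    have "(\<Sum>i\<le>k. sym_const ((x ^ i / fact i) * (y ^ (k - i) / fact (k - i))) * (D ^^ (i + (k - i))) F) =
        (\<Sum>i\<le>k. sym_const ((x ^ i / fact i) * (y ^ (k - i) / fact (k - i))) * (D ^^ k) F)"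
      by (rule sum.cong) simp_all
    then show "(\<Sum>i\<le>k. sym_const ((x ^ i / fact i) * (y ^ (k - i) / fact (k - i))) * (D ^^ (i + (k - i))) F) =
        sym_const ((x + y) ^ k / fact k) * (D ^^ k) F"
      by (simp only: sum_distrib_right[symmetric] sym_const_sum[symmetric] binom)
  qed
  also have "\<dots> = exp_D (x + y) F"
    by (rule exp_D_eq[symmetric]) (simp add: M)
  finally show ?thesis .
qed

text \<open>If \<open>a\<^sub>k = ad\<^sub>D\<^sup>k(a\<^sub>0) / k!\<close>, then \<open>e\<^sup>D a\<^sub>0 = (\<Sum>\<^sub>k a\<^sub>k) e\<^sup>D\<close>.\<close>

lemma exp_D_conjugate:
  assumes lin: "\<And>k. sym_linear (A k)"
    and comm: "\<And>k F. D (A k F) = A k (D F) + of_nat (Suc k) * A (Suc k) F"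
    and zero: "\<And>k F. k \<ge> K \<Longrightarrow> A k F = 0"
  shows "exp_D 1 (A 0 F) = (\<Sum>k<K. A k (exp_D 1 F))"
proof -
  define d where "d n F = sym_const (1 / fact n) * (D ^^ n) F" for n F
  have D_d: "D (d n F) = of_nat (Suc n) * d (Suc n) F" for n F
  proof -
    have "1 / fact n = (of_nat (Suc n) * (1 / fact (Suc n)) :: 'a)"
      by (simp del: of_nat_Suc)
    then show ?thesis
      unfolding d_def sym_linear_const[OF lin_D]
      by (simp only: sym_const_mult sym_const_of_nat mult.assoc funpow.simps comp_apply)
  qed
  \<comment> \<open>With the divided powers D^n / n! and the divided commutators \<open>A k\<close>,
    the Leibniz rule for D^n applied to a composition carries no binomial coefficients.\<close>
  have d_A: "d n (A 0 F) = (\<Sum>k\<le>n. A k (d (n - k) F))" for n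
  proof (induction n)
    case 0
    show ?case by (simp add: d_def)
  next
    case (Suc n)
    have "of_nat (Suc n) * d (Suc n) (A 0 F) = (\<Sum>k\<le>n. D (A k (d (n - k) F)))"
      by (simp only: D_d[symmetric] Suc sym_linear_sum[OF lin_D])
    also have "\<dots> = (\<Sum>k\<le>n. of_nat (Suc n - k) * A k (d (Suc n - k) F)) +
        (\<Sum>k\<le>n. of_nat (Suc k) * A (Suc k) (d (Suc n - Suc k) F))"
      unfolding sum.distrib[symmetric]
      by (rule sum.cong) (simp_all only: comm D_d sym_linear_of_nat[OF lin] Suc_diff_le atMost_iff diff_Suc_Suc)
    also have "(\<Sum>k\<le>n. of_nat (Suc n - k) * A k (d (Suc n - k) F)) =
        (\<Sum>k\<le>Suc n. of_nat (Suc n - k) * A k (d (Suc n - k) F))"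
      by simp
    also have "(\<Sum>k\<le>n. of_nat (Suc k) * A (Suc k) (d (Suc n - Suc k) F)) =
        (\<Sum>k\<le>Suc n. of_nat k * A k (d (Suc n - k) F))"
      by (subst sum.atMost_Suc_shift) simp
    also have "(\<Sum>k\<le>Suc n. of_nat (Suc n - k) * A k (d (Suc n - k) F)) + \<dots> =
        of_nat (Suc n) * (\<Sum>k\<le>Suc n. A k (d (Suc n - k) F))"
      unfolding sum.distrib[symmetric] distrib_right[symmetric] of_nat_add[symmetric] sum_distrib_left
      by (rule sum.cong) simp_all
    finally have "of_nat (Suc n) * d (Suc n) (A 0 F) = of_nat (Suc n) * (\<Sum>k\<le>Suc n. A k (d (Suc n - k) F))" .
    from arg_cong[OF this, of "(*) (sym_const (1 / of_nat (Suc n)))"] show ?case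
      by (simp only: sym_const_inverse_of_nat nat.simps not_False_eq_True)
  qed
  obtain M where M: "\<And>n. n \<ge> M \<Longrightarrow> (D ^^ n) F = 0" using D_nilpotent[of F] by blast
  have dM: "d n F = 0" if "n \<ge> M" for n using M[OF that] by (simp add: d_def)
  have D_A: "(D ^^ n) (A 0 F) = 0" if "n \<ge> K + M" for n
  proof -
    have "A k (d (n - k) F) = 0" for k
      using zero[of k] dM[of "n - k"] that sym_linear_0[OF lin[of k]] by (cases "k \<ge> K") simp_all
    then have "d n (A 0 F) = 0" by (simp add: d_A)
    moreover have "sym_const (fact n) * d n (A 0 F) = (D ^^ n) (A 0 F)"
      unfolding d_def mult.assoc[symmetric] sym_const_mult[symmetric] by simp
    ultimately show ?thesis by simp
  qed
  have "exp_D 1 (A 0 F) = (\<Sum>n<K + M. sym_const (1 ^ n / fact n) * (D ^^ n) (A 0 F))"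
    by (rule exp_D_eq[OF D_A])
  also have "\<dots> = (\<Sum>n<K + M. d n (A 0 F))"
    by (simp add: d_def)
  also have "\<dots> = (\<Sum>n<K + M. \<Sum>k\<le>n. A k (d (n - k) F))" by (simp only: d_A)
  also have "\<dots> = (\<Sum>k<K. \<Sum>m<M. A k (d m F))"
    by (rule sum_triangle_box[symmetric]) (auto simp: dM zero sym_linear_0[OF lin])
  also have "\<dots> = (\<Sum>k<K. A k (exp_D 1 F))"
  proof -
    have "exp_D 1 F = (\<Sum>m<M. sym_const (1 ^ m / fact m) * (D ^^ m) F)"
      by (rule exp_D_eq) (rule M)
    then show ?thesis by (simp add: d_def sym_linear_sum[OF lin])
  qed
  finally show ?thesis .
qed

text \<open>Every commutator with \<open>D\<close> lowers the degree by one. Multiplication by p_2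
  has degree 2 and its chain ends with the adjoint, of degree -2, so five terms suffice; shorter
  chains are padded with 0.\<close>

lemma exp_D_conjugate4:
  assumes lin: "sym_linear A" "sym_linear A\<^sub>1" "sym_linear A\<^sub>2" "sym_linear A\<^sub>3" "sym_linear A\<^sub>4"
    and comm: "\<And>F. D (A F) = A (D F) + A\<^sub>1 F" "\<And>F. D (A\<^sub>1 F) = A\<^sub>1 (D F) + 2 * A\<^sub>2 F"
      "\<And>F. D (A\<^sub>2 F) = A\<^sub>2 (D F) + 3 * A\<^sub>3 F" "\<And>F. D (A\<^sub>3 F) = A\<^sub>3 (D F) + 4 * A\<^sub>4 F"
      "\<And>F. D (A\<^sub>4 F) = A\<^sub>4 (D F)"
  shows "exp_D 1 (A F) = A (exp_D 1 F) + A\<^sub>1 (exp_D 1 F) + A\<^sub>2 (exp_D 1 F) + A\<^sub>3 (exp_D 1 F) + A\<^sub>4 (exp_D 1 F)"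
proof -
  define B where "B k = (if k = 0 then A else if k = 1 then A\<^sub>1 else if k = 2 then A\<^sub>2
    else if k = 3 then A\<^sub>3 else if k = 4 then A\<^sub>4 else (\<lambda>_. 0))" for k :: nat
  have "sym_linear (B k)" for k
    unfolding B_def by (simp add: lin) (simp add: sym_linear_def)
  moreover have "D (B k F) = B k (D F) + of_nat (Suc k) * B (Suc k) F" for k F
  proof -
    consider "k = 0" | "k = 1" | "k = 2" | "k = 3" | "k = 4" | "k > 4" by linarith
    then show ?thesis by cases (simp_all add: B_def comm sym_linear_0[OF lin_D])
  qed
  moreover have "B k F = 0" if "k \<ge> 5" for k F using that by (simp add: B_def)
  ultimately have "exp_D 1 (B 0 F) = (\<Sum>k<5. B k (exp_D 1 F))" by (rule exp_D_conjugate)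
  then show ?thesis by (simp add: B_def eval_nat_numeral)
qed

end

section \<open>Symmetry of multiplication\<close>

lemma sym_algebra_induct [case_names one power_sum mult add const]:
  fixes F :: "'a::field_char_0 sym"
  assumes "P 1" "\<And>k. P (power_sum (Suc k))" "\<And>F G. P F \<Longrightarrow> P G \<Longrightarrow> P (F * G)"
    "\<And>F G. P F \<Longrightarrow> P G \<Longrightarrow> P (F + G)" "\<And>a F. P F \<Longrightarrow> P (sym_const a * F)"
  shows "P F"
proof (induction F rule: sym_induct)
  case (mon m)
  show ?case
  proof (induction "weight m" arbitrary: m rule: less_induct)
    case less
    show ?case
    proof (cases "m = 0")
      case True
      then show ?thesis using assms(1) by simp
    next
      case False
      then obtain k where k: "Poly_Mapping.lookup m k \<noteq> 0"
        by (metis lookup_zero poly_mapping_eqI)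
      define m' where "m' = m - Poly_Mapping.single k 1"
      have m: "m = m' + Poly_Mapping.single k 1"
        by (rule poly_mapping_eqI) (use k in \<open>auto simp: m'_def lookup_add lookup_minus lookup_single when_def\<close>)
      have "weight m' < weight m"
        unfolding m weight_add weight_single by simp
      then have "P (power_sum (Suc k) * mon m')" by (intro assms less)
      moreover have "mon m = (power_sum (Suc k) * mon m' :: 'a sym)"
        unfolding m mon_add by (simp add: power_sum_def mult.commute)
      ultimately show ?thesis by simp
    qed
  qed
qed (auto intro: assms)

section \<open>The weighted bilinear form and adjoint operators\<close>

context laguerre
begin

definition diagram_weight :: "(nat \<times> nat) set \<Rightarrow> 'a" where
  "diagram_weight X = (\<Prod>b\<in>X. box_weight b)"

text \<open>Bilinear without conjugation, so that everything up to the integrals stays algebraic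
  over any field of characteristic 0.\<close>

definition form :: "'a sym \<Rightarrow> 'a sym \<Rightarrow> 'a" where
  "form F G = (\<Sum>X\<in>supp F. coef X F * (coef X G * diagram_weight X))"

lemma form_superset:
  assumes "finite K" "supp F \<subseteq> K" "K \<subseteq> {X. diagram X}"
  shows "form F G = (\<Sum>X\<in>K. coef X F * (coef X G * diagram_weight X))"
  unfolding form_def
  by (rule sum.mono_neutral_left) (use assms in \<open>auto simp: supp_def\<close>)

lemma form_commute: "form F G = form G F"
proof -
  let ?K = "supp F \<union> supp G"
  have K: "finite ?K" "?K \<subseteq> {X. diagram X}"
    using finite_supp[of F] finite_supp[of G] supp_diagram[of F] supp_diagram[of G] by simp_all
  show ?thesis
    unfolding form_superset[OF K(1) Un_upper1 K(2)] form_superset[OF K(1) Un_upper2 K(2)]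
    by (simp only: mult.left_commute)
qed

lemma form_add_right: "form F (G + H) = form F G + form F H"
  by (simp add: form_def coef_add distrib_left distrib_right sum.distrib)

lemma form_const_right: "form F (sym_const a * G) = a * form F G"
  by (simp add: form_def coef_const sum_distrib_left mult.assoc mult.left_commute[of _ a])

lemma form_add_left: "form (G + H) F = form G F + form H F"
  by (simp only: form_commute[of _ F] form_add_right)

lemma form_const_left: "form (sym_const a * G) F = a * form G F"
  by (simp only: form_commute[of _ F] form_const_right)

lemma form_0_right [simp]: "form F 0 = 0"
  using form_const_right[of F 0 0] by simp

lemma form_uminus_right: "form F (- G) = - form F G"
  using form_const_right[of F "- 1" G] by (simp add: sym_const_uminus)

lemma form_diff_right: "form F (G - H) = form F G - form F H"
  using form_add_right[of F G "- H"] by (simp add: form_uminus_right)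

lemma form_diff_left: "form (G - H) F = form G F - form H F"
  by (simp only: form_commute[of _ F] form_diff_right)

lemma form_numeral_right: "form F (numeral n * G) = numeral n * form F G"
  using form_const_right[of F "numeral n" G] by (simp add: sym_const_numeral)

lemma form_numeral_left: "form (numeral n * G) F = numeral n * form G F"
  by (simp only: form_commute[of _ F] form_numeral_right)

lemma form_sum_right: "form F (sum f A) = (\<Sum>x\<in>A. form F (f x))"
  by (induction A rule: infinite_finite_induct) (simp_all add: form_add_right)

lemma form_sum_left: "form (sum f A) F = (\<Sum>x\<in>A. form (f x) F)"
  by (simp only: form_commute[of _ F] form_sum_right)

lemma form_schur_of_left:
  assumes "diagram X"
  shows "form (schur_of X) G = coef X G * diagram_weight X"
proof -
  have "supp (schur_of X :: 'a sym) \<subseteq> {X}"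
    using assms by (auto simp: supp_def coef_schur_of split: if_splits)
  then show ?thesis
    using form_superset[of "{X}" "schur_of X" G] assms by (simp add: coef_schur_of)
qed

lemma form_schur_of:
  assumes "diagram X" "diagram Y"
  shows "form (schur_of X) (schur_of Y) = (if X = Y then diagram_weight X else 0)"
  by (simp add: form_schur_of_left coef_schur_of assms)

lemma form_adjointI:
  assumes S: "sym_linear S" and T: "sym_linear T"
    and "\<And>X Y. diagram X \<Longrightarrow> diagram Y \<Longrightarrow> form (S (schur_of X)) (schur_of Y) = form (schur_of X) (T (schur_of Y))"
  shows "form (S F) G = form F (T G)"
proof (induction F rule: schur_induct)
  case (schur X)
  show ?case
    by (induction G rule: schur_induct)
      (simp_all add: assms(3)[OF schur] form_add_right form_const_right sym_linear_add[OF T] sym_linear_const[OF T])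
qed (simp_all add: form_add_left form_const_left sym_linear_add[OF S] sym_linear_const[OF S])

lemma form_diagonal: "form (diagonal d F) G = form F (diagonal d G)"
  by (rule form_adjointI[OF sym_linear_diagonal sym_linear_diagonal])
    (auto simp: diagonal_schur_of form_const_left form_const_right form_schur_of)

text \<open>Adding the box b multiplies the diagram weight by the box weight of b; this factor is
  what the adjoint lowering operator acquires.\<close>

lemma form_raises:
  assumes "raises f U"
  shows "form (U F) G = form F (lower (\<lambda>b. f b * box_weight b) G)"
proof (rule form_adjointI[OF _ sym_linear_lower])
  show "sym_linear U" using assms by (simp add: raises_def)
  fix X Y assume X: "diagram X" and Y: "diagram Y"
  have eq: "b \<in> addable X \<and> insert b X = Y \<longleftrightarrow> b \<in> removable Y \<and> Y - {b} = X" for b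
    using X Y by (auto simp: addable_def removable_def insert_absorb)
  have wt: "diagram_weight (insert b X) = box_weight b * diagram_weight X" if "b \<in> addable X" for b
    using that X by (simp add: diagram_weight_def addable_def diagram_finite)
  have "form (U (schur_of X)) (schur_of Y) =
      (\<Sum>b\<in>addable X. if insert b X = Y then f b * diagram_weight Y else 0)"
    using assms X Y by (auto simp: raises_def form_sum_left form_const_left form_schur_of addable_diagram intro!: sum.cong)
  also have "\<dots> = (\<Sum>b\<in>{b\<in>addable X. insert b X = Y}. f b * diagram_weight Y)"
    by (rule sum.inter_filter[symmetric]) (rule finite_addable[OF X])
  also have "\<dots> = (\<Sum>b\<in>{b\<in>removable Y. Y - {b} = X}. f b * box_weight b * diagram_weight X)"
  proof (rule sum.cong)
    show "{b\<in>addable X. insert b X = Y} = {b\<in>removable Y. Y - {b} = X}"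
      using eq by blast
    fix b assume "b \<in> {b\<in>removable Y. Y - {b} = X}"
    then have "b \<in> addable X" "insert b X = Y" using eq by blast+
    then show "f b * diagram_weight Y = f b * box_weight b * diagram_weight X"
      using wt[of b] by (simp add: mult.assoc)
  qed
  also have "\<dots> = (\<Sum>b\<in>removable Y. if Y - {b} = X then f b * box_weight b * diagram_weight X else 0)"
    by (rule sum.inter_filter) (rule finite_removable[OF Y])
  also have "\<dots> = form (schur_of X) (lower (\<lambda>b. f b * box_weight b) (schur_of Y))"
    unfolding lower_schur_of[OF Y] form_sum_right form_const_right
    by (rule sum.cong) (auto simp: form_schur_of X removable_diagram)
  finally show "form (U (schur_of X)) (schur_of Y) =
      form (schur_of X) (lower (\<lambda>b. f b * box_weight b) (schur_of Y))" .
qed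

lemma form_mul1: "form (mul\<^sub>1 F) G = form F (D G)"
  using form_raises[OF raises_mul1] by (simp add: D_def)

lemma form_raise: "form (raise_der F) G = form F (D\<^sub>1 G)"
  using form_raises[OF raises_raise_der] by (simp add: D\<^sub>1_def)

lemma form_mul2: "form (mul\<^sub>2 F) G = form F (D\<^sub>2 G)"
  by (simp add: mul2_eq D\<^sub>2_def form_diff_left form_diff_right form_mul1 form_raise)

lemma form_D: "form (D F) G = form F (mul\<^sub>1 G)"
  and form_D1: "form (D\<^sub>1 F) G = form F (raise_der G)"
  and form_D2: "form (D\<^sub>2 F) G = form F (mul\<^sub>2 G)"
  by (simp_all only: form_commute[of _ G] form_mul1[symmetric] form_raise[symmetric] form_mul2[symmetric])
    (rule form_commute)+

lemma form_size_op: "form (size_op F) G = form F (size_op G)"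
  by (simp add: size_op_def form_diagonal)

lemma form_s: "form (s * F) G = (z + z') * form F G" "form F (s * G) = (z + z') * form F G"
  and form_t: "form (t * F) G = z * z' * form F G" "form F (t * G) = z * z' * form F G"
  by (simp_all only: s_def t_def form_const_left form_const_right)

end

text \<open>With nonzero box weights all diagram weights are nonzero and the form is nondegenerate,
  so identities between operators can be checked on their adjoints.\<close>

locale laguerre_nondegenerate = laguerre +
  assumes box_weight_nonzero: "box_weight b \<noteq> 0"
begin

lemma diagram_weight_nonzero: "diagram X \<Longrightarrow> diagram_weight X \<noteq> 0"
  by (simp add: diagram_weight_def box_weight_nonzero diagram_finite)

lemma form_nondegenerate:
  assumes "\<And>G. form G F = 0"
  shows "F = 0"
proof -
  have "coef X F = 0" if "diagram X" for X
    using assms[of "schur_of X"] diagram_weight_nonzero[OF that] by (simp add: form_schur_of_left[OF that])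
  then have "supp F = {}" by (auto simp: supp_def)
  then show ?thesis using schur_expand[of F] by simp
qed

text \<open>This is the adjoint of p_1 p_2 = p_2 p_1; no direct computation with box removals is
  required.\<close>

lemma D_D2: "D (D\<^sub>2 F) = D\<^sub>2 (D F)"
proof -
  have "form G (D (D\<^sub>2 F) - D\<^sub>2 (D F)) = 0" for G
  proof -
    have "mul\<^sub>2 (mul\<^sub>1 G) = mul\<^sub>1 (mul\<^sub>2 G)"
      by (simp only: mul\<^sub>1_def mul\<^sub>2_def mult.left_commute)
    then show ?thesis by (simp add: form_diff_right flip: form_mul1 form_mul2)
  qed
  then have "D (D\<^sub>2 F) - D\<^sub>2 (D F) = 0" by (rule form_nondegenerate)
  then show ?thesis by simp
qed

lemma D_D1: "D (D\<^sub>1 F) = D\<^sub>1 (D F) + D\<^sub>2 F"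
  by (simp add: D\<^sub>2_def)

lemma D_s: "D (s * F) = s * D F" and D_t: "D (t * F) = t * D F"
  unfolding s_def t_def by (rule sym_linear_const[OF lin_D])+

abbreviation e where "e \<equiv> exp_D 1"

section \<open>Conjugation of the generating operators by e^D\<close>

lemma lin_zero: "sym_linear (\<lambda>F. 0)"
  by (simp add: sym_linear_def)

lemma exp_mul1: "e (mul\<^sub>1 F) = mul\<^sub>1 (e F) + 2 * size_op (e F) + t * e F + D (e F)"
proof -
  have "e (mul\<^sub>1 F) = mul\<^sub>1 (e F) + (2 * size_op (e F) + t * e F) + D (e F) + 0 + 0"
    by (rule exp_D_conjugate4[where A = mul\<^sub>1 and A\<^sub>1 = "\<lambda>F. 2 * size_op F + t * F" and A\<^sub>2 = D
          and A\<^sub>3 = "\<lambda>_. 0" and A\<^sub>4 = "\<lambda>_. 0"])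
      (simp_all add: lin_mul1 lin_D lin_zero sym_linear_plus sym_linear_scale[OF sym_linear_size_op] sym_linear_mult
        D_mul1 sym_linear_add[OF lin_D] sym_linear_numeral[OF lin_D] D_t D_size_op sym_linear_0[OF lin_D])
  then show ?thesis by simp
qed

lemma exp_raise: "e (raise_der F) = raise_der (e F) + (6 * content_op (e F) + 2 * (s * size_op (e F))) +
    (3 * D\<^sub>1 (e F) + s * D (e F)) + D\<^sub>2 (e F)"
proof -
  have "e (raise_der F) = raise_der (e F) + (6 * content_op (e F) + 2 * (s * size_op (e F))) +
    (3 * D\<^sub>1 (e F) + s * D (e F)) + D\<^sub>2 (e F) + 0"
    by (rule exp_D_conjugate4[where A = raise_der and A\<^sub>1 = "\<lambda>F. 6 * content_op F + 2 * (s * size_op F)"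
          and A\<^sub>2 = "\<lambda>F. 3 * D\<^sub>1 F + s * D F" and A\<^sub>3 = D\<^sub>2 and A\<^sub>4 = "\<lambda>_. 0"])
      (simp_all add: sym_linear_raise_der lin_D lin_D1 lin_D2 lin_zero sym_linear_plus sym_linear_scale
        sym_linear_size_op sym_linear_content_op
        D_raise sym_linear_add[OF lin_D] sym_linear_numeral[OF lin_D] D_s D_size_op D_content_op D_D1 D_D2
        sym_linear_0[OF lin_D] distrib_left)
  then show ?thesis by simp
qed

text \<open>The successive terms are the iterated commutators with \<open>D\<close>, each divided by
  its position in the chain; for instance [D, 4 R + 2 s p_1] is twice the third term, R being the
  derivation.\<close>

lemma exp_mul2: "e (mul\<^sub>2 F) = mul\<^sub>2 (e F) + (4 * raise_der (e F) + 2 * (s * mul\<^sub>1 (e F))) +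
    (12 * content_op (e F) + 6 * (s * size_op (e F)) + s * (t * e F)) +
    (4 * D\<^sub>1 (e F) + 2 * (s * D (e F))) + D\<^sub>2 (e F)"
  by (rule exp_D_conjugate4[where A = mul\<^sub>2 and A\<^sub>1 = "\<lambda>F. 4 * raise_der F + 2 * (s * mul\<^sub>1 F)"
        and A\<^sub>2 = "\<lambda>F. 12 * content_op F + 6 * (s * size_op F) + s * (t * F)"
        and A\<^sub>3 = "\<lambda>F. 4 * D\<^sub>1 F + 2 * (s * D F)" and A\<^sub>4 = D\<^sub>2])
    (simp_all add: sym_linear_raise_der lin_D lin_D1 lin_D2 lin_mul1 lin_mul2 sym_linear_plus sym_linear_scale
      sym_linear_size_op sym_linear_content_op sym_linear_mult
      D_raise D_mul1 D_mul2 sym_linear_add[OF lin_D] sym_linear_numeral[OF lin_D] D_s D_t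
      D_size_op D_content_op D_D1 D_D2 distrib_left)

text \<open>The combination for which \<open>e\<^sup>D Q e\<^sup>-\<^sup>D\<close> is skew-adjoint.\<close>

definition Q :: "'a sym \<Rightarrow> 'a sym" where
  "Q F = 2 * raise_der F - mul\<^sub>2 F + s * mul\<^sub>1 F"

text \<open>The coefficients of \<open>Q\<close> are forced here: 2 \<open>raise_der\<close> - p_2
  removes the content term, and adding s p_1 removes the size term and the constant. What remains is
  T' - T with T = 2 \<open>raise_der\<close> + s p_1 + p_2 and T' its adjoint.\<close>

lemma exp_Q: "e (Q F) = 2 * D\<^sub>1 (e F) + s * D (e F) + D\<^sub>2 (e F)
    - 2 * raise_der (e F) - s * mul\<^sub>1 (e F) - mul\<^sub>2 (e F)"
proof -
  have "e (s * G) = s * e G" for G unfolding s_def by (rule sym_linear_const[OF lin_exp_D])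
  then have "e (Q F) = 2 * e (raise_der F) - e (mul\<^sub>2 F) + s * e (mul\<^sub>1 F)"
    by (simp add: Q_def sym_linear_add[OF lin_exp_D] sym_linear_diff[OF lin_exp_D] sym_linear_numeral[OF lin_exp_D])
  then show ?thesis
    unfolding exp_raise exp_mul1 exp_mul2 by (simp add: algebra_simps)
qed

lemma form_exp_mul1: "form (e (mul\<^sub>1 F)) (e G) = form (e F) (e (mul\<^sub>1 G))"
  by (simp add: exp_mul1 form_add_left form_add_right form_numeral_left form_numeral_right
      form_mul1 form_D form_size_op form_t)

text \<open>An operator minus its adjoint changes sign when moved to the other argument.\<close>

lemma form_exp_Q: "form (e (Q F)) (e G) = - form (e F) (e (Q G))"
  by (simp add: exp_Q form_add_left form_add_right form_diff_left form_diff_right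
      form_numeral_left form_numeral_right form_mul1 form_D form_mul2 form_D2 form_raise form_D1 form_s)

text \<open>Multiplications by p_1 and p_2 commute with p_k, so only the derivation contributes to
  the commutator.\<close>

lemma Q_power_sum:
  "Q (power_sum (Suc k) * F) - power_sum (Suc k) * Q F = 2 * (of_nat (Suc k) * (power_sum (Suc (Suc k)) * F))"
  by (simp add: Q_def mul\<^sub>1_def mul\<^sub>2_def raise_der_mult raise_der_power_sum algebra_simps)

text \<open>The commutator of a skew operator with a symmetric one is symmetric. By
  \<open>Q_power_sum\<close> it is 2 k p_{k+1} after conjugation, which carries the induction from
  p_k to p_{k+1}.\<close>

lemma form_exp_power_sum:
  "form (e (power_sum (Suc k) * F)) (e G) = form (e F) (e (power_sum (Suc k) * G))"
proof (induction k arbitrary: F G)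
  case 0
  show ?case using form_exp_mul1 by (simp add: mul\<^sub>1_def)
next
  case (Suc k)
  let ?p = "power_sum (Suc k) :: 'a sym" and ?q = "power_sum (Suc (Suc k)) :: 'a sym"
  have step: "2 * (of_nat (Suc k) * e (?q * H)) = e (Q (?p * H)) - e (?p * Q H)" for H
    unfolding sym_linear_diff[OF lin_exp_D, symmetric] Q_power_sum
    by (simp only: sym_linear_numeral[OF lin_exp_D] sym_linear_of_nat[OF lin_exp_D])
  have scale: "form (2 * (of_nat n * F)) G = 2 * of_nat n * form F G"
    "form F (2 * (of_nat n * G)) = 2 * of_nat n * form F G" for n F G
    by (simp_all only: form_numeral_left form_numeral_right sym_const_of_nat[symmetric]
        form_const_left form_const_right mult.assoc)
  have "2 * of_nat (Suc k) * form (e (?q * F)) (e G) = form (e (Q (?p * F))) (e G) - form (e (?p * Q F)) (e G)"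
    by (simp only: scale(1)[symmetric] step form_diff_left)
  also have "\<dots> = form (e F) (e (Q (?p * G))) - form (e F) (e (?p * Q G))"
    by (simp only: Suc.IH form_exp_Q minus_minus diff_minus_eq_add) simp
  also have "\<dots> = 2 * of_nat (Suc k) * form (e F) (e (?q * G))"
    by (simp only: scale(2)[symmetric] step form_diff_right)
  finally show ?case by (simp del: of_nat_Suc)
qed

lemma form_exp_mult: "form (e (F * G)) (e H) = form (e G) (e (F * H))"
proof (induction F arbitrary: G H rule: sym_algebra_induct)
  case (mult F F')
  then show ?case by (simp only: mult.assoc) (simp only: mult.left_commute)
qed (simp_all add: form_exp_power_sum distrib_right mult.assoc
    sym_linear_add[OF lin_exp_D] sym_linear_const[OF lin_exp_D]
    form_add_left form_add_right form_const_left form_const_right)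

lemma exp_D_1: "exp_D x 1 = 1"
proof -
  have "exp_D x (schur_of {}) = schur_of {}"
    unfolding exp_D_def by (subst schur_ext_schur_of) simp_all
  then show ?thesis by simp
qed

text \<open>The coefficient of 1 is the form with 1, since the empty diagram has weight 1, and e^D
  fixes 1. Symmetry then moves the factor F to the other argument.\<close>

theorem coef_empty_exp_mult: "coef {} (e (F * G)) = form (e F) (e G)"
proof -
  have "coef {} (e (F * G)) = form (e 1) (e (F * G))"
    using form_schur_of_left[OF diagram_empty, of "e (F * G)"] by (simp add: exp_D_1 diagram_weight_def)
  also have "\<dots> = form (e F) (e G)"
    using form_exp_mult[of F 1 G] by simp
  finally show ?thesis .
qed

end

section \<open>Standard tableaux\<close>

text \<open>Tableaux on an arbitrary set of boxes rather than on a pair of partitions, so that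
  deleting a box stays within the notion.\<close>

definition tableaux :: "(nat \<times> nat) set \<Rightarrow> (nat \<times> nat \<Rightarrow> nat) set" where
  "tableaux S = {T \<in> extensional S. bij_betw T S {1..card S} \<and>
     (\<forall>i j j'. (i, j) \<in> S \<and> (i, j') \<in> S \<and> j < j' \<longrightarrow> T (i, j) < T (i, j')) \<and>
     (\<forall>i i' j. (i, j) \<in> S \<and> (i', j) \<in> S \<and> i < i' \<longrightarrow> T (i, j) < T (i', j))}"

lemma skew_dim_eq: "skew_dim \<nu> \<mu> = card (tableaux (boxes \<nu> - boxes \<mu>))"
  by (simp add: skew_dim_def standard_tableaux_def tableaux_def skew_def)

lemma tableauxD:
  assumes "T \<in> tableaux S"
  shows "T \<in> extensional S" "bij_betw T S {1..card S}"
    "(i, j) \<in> S \<Longrightarrow> (i, j') \<in> S \<Longrightarrow> j < j' \<Longrightarrow> T (i, j) < T (i, j')"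
    "(i, j) \<in> S \<Longrightarrow> (i', j) \<in> S \<Longrightarrow> i < i' \<Longrightarrow> T (i, j) < T (i', j)"
  using assms by (simp_all add: tableaux_def)

lemma finite_tableaux: "finite S \<Longrightarrow> finite (tableaux S)"
  by (rule finite_subset[OF _ finite_PiE[of S "\<lambda>_. {1..card S}"]])
    (auto simp: tableaux_def PiE_def bij_betw_def)

lemma tableaux_empty: "tableaux {} = {\<lambda>_. undefined}"
  by (auto simp: tableaux_def bij_betw_def)

text \<open>Any other box weakly below and to the right of b would carry a larger entry than b, so
  the largest entry sits at a corner.\<close>

lemma tableaux_max_removable:
  assumes X: "diagram X" and Y: "diagram Y" and T: "T \<in> tableaux (X - Y)"
    and b: "b \<in> X - Y" "T b = card (X - Y)"
  shows "b \<in> removable X"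
proof -
  have le: "T x \<le> card (X - Y)" if "x \<in> X - Y" for x
    using bij_betwE[OF tableauxD(2)[OF T]] that by auto
  have "diagram (X - {b})"
    unfolding diagram_def[of "X - {b}"]
  proof (intro conjI allI impI)
    fix i j i' j'
    assume *: "(i, j) \<in> X - {b} \<and> i' \<le> i \<and> j' \<le> j"
    have "(i', j') \<noteq> b"
    proof
      assume eq: "(i', j') = b"
      have in': "(i', j') \<in> X - Y" using b(1) eq by simp
      \<comment> \<open>Entries increase along rows and columns only, so the comparison of (i', j')
        with (i, j) passes through the elbow (i', j), which has to lie in the skew diagram
        too.\<close>
      have mid: "(i', j) \<in> X - Y"
        using diagram_down[OF X, of i j i' j] diagram_down[OF Y, of i' j i' j'] * in' by auto
      have ij: "(i, j) \<in> X - Y"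
        using diagram_down[OF Y, of i j i' j'] * in' by auto
      have "T (i', j') \<le> T (i', j)"
        using tableauxD(3)[OF T in' mid] * by (cases "j' = j") auto
      moreover have "T (i', j) \<le> T (i, j)"
        using tableauxD(4)[OF T mid ij] * by (cases "i' = i") auto
      moreover have "T (i', j') \<noteq> T (i, j)"
        using inj_onD[OF bij_betw_imp_inj_on[OF tableauxD(2)[OF T]], of "(i', j')" "(i, j)"] in' ij eq * by auto
      ultimately show False using le[OF ij] b(2) eq by simp
    qed
    then show "(i', j') \<in> X - {b}"
      using * diagram_down[OF X, of i j i' j'] by simp
  qed (simp add: diagram_finite[OF X])
  then show ?thesis using b(1) by (simp add: removable_def)
qed

text \<open>Deleting the largest entry and putting it back are inverse to each other; monotonicity
  survives the second because nothing of X lies to the right of a corner in its row or below it in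
  its column.\<close>

lemma card_tableaux_max:
  assumes X: "diagram X" and b: "b \<in> removable X" "b \<notin> Y"
  shows "card {T \<in> tableaux (X - Y). T b = card (X - Y)} = card (tableaux (X - {b} - Y))"
proof -
  let ?S = "X - Y" and ?R = "X - {b} - Y"
  have bS: "b \<in> ?S" using b by (simp add: removable_def)
  have fin: "finite ?S" using diagram_finite[OF X] by simp
  have R: "?R = ?S - {b}" by auto
  then have S: "?S = insert b ?R" using bS by auto
  have card: "card ?S = Suc (card ?R)" unfolding R by (rule card.remove[OF fin bS])
  obtain p q where pq: "b = (p, q)" by fastforce
  have corner: "\<not> (i = p \<and> q < j \<or> j = q \<and> p < i)" if "(i, j) \<in> X" for i j
    using diagram_down[OF removable_diagram[OF b(1)], of i j p q] that pq by auto
  have "bij_betw (\<lambda>T. restrict T ?R) {T \<in> tableaux ?S. T b = card ?S} (tableaux ?R)"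
  proof (rule bij_betw_byWitness[where f' = "\<lambda>T. T(b := card ?S)"])
    show "\<forall>T\<in>{T \<in> tableaux ?S. T b = card ?S}. (restrict T ?R)(b := card ?S) = T"
    proof
      fix T assume T: "T \<in> {T \<in> tableaux ?S. T b = card ?S}"
      then have "T \<in> extensional ?S" by (simp add: tableaux_def)
      then show "(restrict T ?R)(b := card ?S) = T"
        using T S by (intro ext) (auto simp: extensional_def)
    qed
    show "\<forall>T\<in>tableaux ?R. restrict (T(b := card ?S)) ?R = T"
    proof
      fix T assume "T \<in> tableaux ?R"
      then have "T \<in> extensional ?R" by (simp add: tableaux_def)
      then show "restrict (T(b := card ?S)) ?R = T"
        by (intro ext) (auto simp: extensional_def)
    qed
    show "(\<lambda>T. restrict T ?R) ` {T \<in> tableaux ?S. T b = card ?S} \<subseteq> tableaux ?R"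
    proof clarify
      fix T assume T: "T \<in> tableaux ?S" "T b = card ?S"
      have "bij_betw T (?S - {b}) ({1..card ?S} - {T b})"
      proof (rule bij_betw_subset[OF tableauxD(2)[OF T(1)]])
        show "T ` (?S - {b}) = {1..card ?S} - {T b}"
          using inj_on_image_set_diff[of T ?S ?S "{b}"] tableauxD(2)[OF T(1)] bS by (simp add: bij_betw_def)
      qed auto
      moreover have "{1..card ?S} - {T b} = {1..card ?R}" using T(2) card by auto
      ultimately have "bij_betw (restrict T ?R) ?R {1..card ?R}"
        unfolding R by (simp add: bij_betw_cong[of "?S - {b}" "restrict T (?S - {b})" T])
      then show "restrict T ?R \<in> tableaux ?R"
        using tableauxD(3,4)[OF T(1)] by (simp add: tableaux_def)
    qed
    show "(\<lambda>T. T(b := card ?S)) ` tableaux ?R \<subseteq> {T \<in> tableaux ?S. T b = card ?S}"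
    proof clarify
      fix T assume T: "T \<in> tableaux ?R"
      let ?T = "T(b := card ?S)"
      have lt: "T x < card ?S" if "x \<in> ?R" for x
      proof -
        have "T x \<in> {1..card ?R}" using bij_betwE[OF tableauxD(2)[OF T]] that by blast
        then show ?thesis using card by simp
      qed
      have "bij_betw ?T ?R {1..card ?R}"
        using tableauxD(2)[OF T] by (subst bij_betw_cong[of ?R ?T T]) auto
      then have "bij_betw ?T (?R \<union> {b}) ({1..card ?R} \<union> {?T b})"
        by (intro notIn_Un_bij_betw) (auto simp: card)
      moreover have "{1..card ?R} \<union> {?T b} = {1..card ?S}" using card by auto
      ultimately have "bij_betw ?T ?S {1..card ?S}" using S by simp
      moreover have "?T \<in> extensional ?S"
        using tableauxD(1)[OF T] S by (auto simp: extensional_def)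
      moreover have "?T (i, j) < ?T (i, j')" if "(i, j) \<in> ?S" "(i, j') \<in> ?S" "j < j'" for i j j'
      proof -
        have "(i, j) \<noteq> b" using corner[of i j'] that pq by auto
        moreover from this have "(i, j) \<in> ?R" using that by simp
        moreover have "(i, j') \<in> ?R" if "(i, j') \<noteq> b" using that \<open>(i, j') \<in> ?S\<close> by simp
        ultimately show ?thesis using tableauxD(3)[OF T, of i j j'] lt \<open>j < j'\<close> by auto
      qed
      moreover have "?T (i, j) < ?T (i', j)" if "(i, j) \<in> ?S" "(i', j) \<in> ?S" "i < i'" for i i' j
      proof -
        have "(i, j) \<noteq> b" using corner[of i' j] that pq by auto
        moreover from this have "(i, j) \<in> ?R" using that by simp
        moreover have "(i', j) \<in> ?R" if "(i', j) \<noteq> b" using that \<open>(i', j) \<in> ?S\<close> by simp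
        ultimately show ?thesis using tableauxD(4)[OF T, of i j i'] lt \<open>i < i'\<close> by auto
      qed
      ultimately show "?T \<in> tableaux ?S \<and> ?T b = card ?S"
        unfolding tableaux_def by simp
    qed
  qed
  then show ?thesis by (rule bij_betw_same_card)
qed

text \<open>Tableaux are classified by the box of their largest entry, which is a corner of X
  outside Y.\<close>

lemma card_tableaux_rec:
  assumes X: "diagram X" and Y: "diagram Y" and ne: "X - Y \<noteq> {}"
  shows "card (tableaux (X - Y)) = (\<Sum>b\<in>{b\<in>removable X. b \<notin> Y}. card (tableaux (X - {b} - Y)))"
proof -
  let ?A = "\<lambda>b. {T \<in> tableaux (X - Y). T b = card (X - Y)}"
  have fin: "finite (X - Y)" using diagram_finite[OF X] by simp
  have "tableaux (X - Y) = (\<Union>b\<in>{b\<in>removable X. b \<notin> Y}. ?A b)"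
  proof (intro equalityI subsetI)
    fix T assume T: "T \<in> tableaux (X - Y)"
    have "card (X - Y) \<in> {1..card (X - Y)}"
      using fin ne by (simp add: Suc_le_eq card_gt_0_iff)
    then obtain b where b: "b \<in> X - Y" "T b = card (X - Y)"
      using tableauxD(2)[OF T] unfolding bij_betw_def by (metis (no_types, lifting) imageE)
    then have "b \<in> {b\<in>removable X. b \<notin> Y}" "T \<in> ?A b"
      using tableaux_max_removable[OF X Y T b] T by simp_all
    then show "T \<in> (\<Union>b\<in>{b\<in>removable X. b \<notin> Y}. ?A b)" by (rule UN_I)
  qed auto
  moreover have "card (\<Union>b\<in>{b\<in>removable X. b \<notin> Y}. ?A b) = (\<Sum>b\<in>{b\<in>removable X. b \<notin> Y}. card (?A b))"
  proof (rule card_UN_disjoint)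
    show "finite {b\<in>removable X. b \<notin> Y}" using finite_removable[OF X] by simp
    show "\<forall>b\<in>{b\<in>removable X. b \<notin> Y}. finite (?A b)" using finite_tableaux[OF fin] by simp
    show "\<forall>b\<in>{b\<in>removable X. b \<notin> Y}. \<forall>b'\<in>{b\<in>removable X. b \<notin> Y}. b \<noteq> b' \<longrightarrow> ?A b \<inter> ?A b' = {}"
    proof (intro ballI impI)
      fix b b' assume *: "b \<in> {b\<in>removable X. b \<notin> Y}" "b' \<in> {b\<in>removable X. b \<notin> Y}" "b \<noteq> b'"
      then have "b \<in> X - Y" "b' \<in> X - Y" by (auto simp: removable_def)
      then have "T b \<noteq> T b'" if "T \<in> tableaux (X - Y)" for T
        using inj_onD[OF bij_betw_imp_inj_on[OF tableauxD(2)[OF that]], of b b'] *(3) by auto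
      then have False if "T \<in> ?A b \<inter> ?A b'" for T
        using that by (metis (mono_tags, lifting) IntE mem_Collect_eq)
      then show "?A b \<inter> ?A b' = {}" by blast
    qed
  qed
  ultimately show ?thesis by (simp add: card_tableaux_max[OF X])
qed

section \<open>Powers of the lowering operator as sums over tableaux\<close>

definition subdiagrams :: "(nat \<times> nat) set \<Rightarrow> (nat \<times> nat) set set" where
  "subdiagrams X = {Y. diagram Y \<and> Y \<subseteq> X}"

lemma finite_subdiagrams: "diagram X \<Longrightarrow> finite (subdiagrams X)"
  unfolding subdiagrams_def by (rule finite_subset[of _ "Pow X"]) (auto simp: diagram_finite)

context laguerre
begin

text \<open>The n-th power of \<open>D\<close> runs through all ways of removing n boxes one at a
  time. Those ending at Y are the standard tableaux of X - Y, and all of them have the same product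
  of box weights.\<close>

lemma D_funpow_schur_of_tableaux:
  assumes "diagram X"
  shows "(D ^^ n) (schur_of X) = (\<Sum>Y\<in>{Y\<in>subdiagrams X. card X = card Y + n}.
    sym_const (of_nat (card (tableaux (X - Y))) * (\<Prod>b\<in>X - Y. box_weight b)) * schur_of Y)"
  using assms
proof (induction n arbitrary: X)
  case 0
  have "Y = X" if "Y \<subseteq> X" "card X = card Y" for Y
    using card_subset_eq[OF diagram_finite[OF 0] that(1)] that(2) by simp
  then have "{Y\<in>subdiagrams X. card X = card Y + 0} = {X}"
    using 0 by (auto simp: subdiagrams_def)
  then show ?case by (simp add: tableaux_empty)
next
  case (Suc n)
  let ?A = "{Y\<in>subdiagrams X. card X = card Y + Suc n}"
  have fA: "finite ?A" using finite_subdiagrams[OF Suc.prems] by simp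
  have sub: "{Y\<in>subdiagrams (X - {b}). card (X - {b}) = card Y + n} = {Y\<in>?A. b \<notin> Y}"
    if "b \<in> removable X" for b
    using card_removable[OF Suc.prems that] by (auto simp: subdiagrams_def)
  have weight: "(\<Prod>b'\<in>X - Y. box_weight b') = box_weight b * (\<Prod>b'\<in>X - {b} - Y. box_weight b')"
    if "b \<in> removable X" "b \<notin> Y" for b Y
  proof -
    have "X - {b} - Y = X - Y - {b}" by auto
    moreover have "(\<Prod>b'\<in>X - Y. box_weight b') = box_weight b * (\<Prod>b'\<in>X - Y - {b}. box_weight b')"
      using that diagram_finite[OF Suc.prems] by (intro prod.remove) (auto simp: removable_def)
    ultimately show ?thesis by simp
  qed
  let ?t = "\<lambda>b Y. sym_const (of_nat (card (tableaux (X - {b} - Y))) * (\<Prod>b\<in>X - Y. box_weight b)) * schur_of Y :: 'a sym"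
  have "(D ^^ Suc n) (schur_of X) = (\<Sum>b\<in>removable X. sym_const (box_weight b) * (D ^^ n) (schur_of (X - {b})))"
    by (simp add: funpow_Suc_right D_def lower_schur_of[OF Suc.prems] del: funpow.simps)
      (simp add: sym_linear_sum[OF lin_D_funpow] sym_linear_const[OF lin_D_funpow] flip: D_def)
  also have "\<dots> = (\<Sum>b\<in>removable X. \<Sum>Y\<in>{Y\<in>?A. b \<notin> Y}. ?t b Y)"
  proof (rule sum.cong[OF refl])
    fix b assume b: "b \<in> removable X"
    show "sym_const (box_weight b) * (D ^^ n) (schur_of (X - {b})) = (\<Sum>Y\<in>{Y\<in>?A. b \<notin> Y}. ?t b Y)"
      unfolding Suc.IH[OF removable_diagram[OF b]] sub[OF b] sum_distrib_left
    proof (rule sum.cong[OF refl])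
      fix Y assume "Y \<in> {Y\<in>?A. b \<notin> Y}"
      then have "b \<notin> Y" by simp
      then show "sym_const (box_weight b) * (sym_const (of_nat (card (tableaux (X - {b} - Y))) *
          (\<Prod>b\<in>X - {b} - Y. box_weight b)) * schur_of Y) = ?t b Y"
        unfolding weight[OF b \<open>b \<notin> Y\<close>] sym_const_mult by (simp only: ac_simps)
    qed
  qed
  also have "\<dots> = (\<Sum>Y\<in>?A. \<Sum>b\<in>{b\<in>removable X. b \<notin> Y}. ?t b Y)"
    by (rule sum.swap_restrict[OF finite_removable[OF Suc.prems] fA])
  also have "\<dots> = (\<Sum>Y\<in>?A. sym_const (of_nat (card (tableaux (X - Y))) * (\<Prod>b\<in>X - Y. box_weight b)) * schur_of Y)"
  proof (rule sum.cong[OF refl])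
    fix Y assume Y: "Y \<in> ?A"
    have "X - Y \<noteq> {}"
    proof
      assume "X - Y = {}"
      then have "card X \<le> card Y" using Y by (intro card_mono) (auto simp: subdiagrams_def diagram_finite)
      then show False using Y by simp
    qed
    then show "(\<Sum>b\<in>{b\<in>removable X. b \<notin> Y}. ?t b Y) =
        sym_const (of_nat (card (tableaux (X - Y))) * (\<Prod>b\<in>X - Y. box_weight b)) * schur_of Y"
      using Y by (simp add: card_tableaux_rec[OF Suc.prems] subdiagrams_def sum_distrib_right sym_const_sum)
  qed
  finally show ?case .
qed

text \<open>At x = -1 this is the defining expansion of the Laguerre functions; at x = 1 its term Y
  = {} gives the moments.\<close>

lemma exp_D_schur_of:
  assumes X: "diagram X"
  shows "exp_D x (schur_of X) = (\<Sum>Y\<in>subdiagrams X.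
    sym_const (x ^ (card X - card Y) / fact (card X - card Y) *
      (of_nat (card (tableaux (X - Y))) * (\<Prod>b\<in>X - Y. box_weight b))) * schur_of Y)"
proof -
  let ?t = "\<lambda>Y. sym_const (of_nat (card (tableaux (X - Y))) * (\<Prod>b\<in>X - Y. box_weight b)) * schur_of Y :: 'a sym"
  have le: "card Y \<le> card X" if "Y \<in> subdiagrams X" for Y
    using that X by (auto simp: subdiagrams_def diagram_finite intro: card_mono)
  have "exp_D x (schur_of X) = (\<Sum>n\<in>{..<Suc (card X)}. sym_const (x ^ n / fact n) *
      (\<Sum>Y\<in>{Y\<in>subdiagrams X. card X = card Y + n}. ?t Y))"
    by (simp only: exp_D_def schur_ext_schur_of[OF X] D_funpow_schur_of_tableaux[OF X])
  also have "\<dots> = (\<Sum>n\<in>{..<Suc (card X)}. \<Sum>Y\<in>{Y\<in>subdiagrams X. card X - card Y = n}.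
      sym_const (x ^ (card X - card Y) / fact (card X - card Y)) * ?t Y)"
  proof (rule sum.cong[OF refl])
    fix n
    have "{Y\<in>subdiagrams X. card X = card Y + n} = {Y\<in>subdiagrams X. card X - card Y = n}"
      using le by force
    then show "sym_const (x ^ n / fact n) * (\<Sum>Y\<in>{Y\<in>subdiagrams X. card X = card Y + n}. ?t Y) =
      (\<Sum>Y\<in>{Y\<in>subdiagrams X. card X - card Y = n}.
        sym_const (x ^ (card X - card Y) / fact (card X - card Y)) * ?t Y)"
      by (simp add: sum_distrib_left)
  qed
  also have "\<dots> = (\<Sum>Y\<in>subdiagrams X. sym_const (x ^ (card X - card Y) / fact (card X - card Y)) * ?t Y)"
    by (rule sum.group[OF finite_subdiagrams[OF X]]) auto
  finally show ?thesis by (simp only: sym_const_mult mult.assoc)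
qed

lemma coef_empty_exp_D_schur_of:
  assumes X: "diagram X"
  shows "coef {} (exp_D 1 (schur_of X)) =
    of_nat (card (tableaux X)) / fact (card X) * (\<Prod>b\<in>X. box_weight b)"
proof -
  let ?c = "\<lambda>Y. 1 ^ (card X - card Y) / fact (card X - card Y) *
      (of_nat (card (tableaux (X - Y))) * (\<Prod>b\<in>X - Y. box_weight b)) :: 'a"
  have coef_sum: "coef {} (sum f A) = (\<Sum>x\<in>A. coef {} (f x))" for f :: "_ \<Rightarrow> 'a sym" and A
    by (induction A rule: infinite_finite_induct) (simp_all add: coef_add)
  have "coef {} (exp_D 1 (schur_of X)) = (\<Sum>Y\<in>subdiagrams X. if Y = {} then ?c Y else 0)"
    unfolding exp_D_schur_of[OF X] coef_sum coef_const
    by (rule sum.cong) (auto simp: subdiagrams_def coef_schur_of)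
  also have "\<dots> = ?c {}"
    using finite_subdiagrams[OF X] by (simp add: subdiagrams_def)
  finally show ?thesis by simp
qed

end

section \<open>Laguerre symmetric functions and the exponential\<close>

lemma skew_pochhammer_box_weight:
  "skew_pochhammer z \<nu> \<mu> * skew_pochhammer z' \<nu> \<mu> =
    (\<Prod>b\<in>boxes \<nu> - boxes \<mu>. laguerre.box_weight z z' b)"
  by (simp add: skew_pochhammer_def skew_def laguerre.box_weight_def prod.distrib)

lemma laguerre_sym_eq_exp_D:
  assumes "\<nu> \<in> young"
  shows "laguerre_sym z z' \<nu> = laguerre.exp_D z z' (- 1) (schur_of (boxes \<nu>))"
proof -
  have "laguerre_sym z z' \<nu> = (\<Sum>\<mu> | \<mu> \<in> young \<and> boxes \<mu> \<subseteq> boxes \<nu>.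
      sym_const ((- 1) ^ (card (boxes \<nu>) - card (boxes \<mu>)) / fact (card (boxes \<nu>) - card (boxes \<mu>)) *
        (of_nat (card (tableaux (boxes \<nu> - boxes \<mu>))) *
        (\<Prod>b\<in>boxes \<nu> - boxes \<mu>. laguerre.box_weight z z' b))) * schur_of (boxes \<mu>))"
    unfolding laguerre_sym_def
    by (rule sum.cong)
      (auto simp: skew_pochhammer_box_weight[symmetric] skew_dim_eq card_boxes schur_of_boxes mult.assoc)
  also have "\<dots> = laguerre.exp_D z z' (- 1) (schur_of (boxes \<nu>))"
    unfolding laguerre.exp_D_schur_of[OF diagram_boxes[OF assms]]
    by (rule sum.reindex_bij_witness[of _ part boxes]) (auto simp: subdiagrams_def diagram_boxes)
  finally show ?thesis .
qed

text \<open>As e^{-D} maps S_X to the Laguerre function, the Schur coefficients of e^D F are the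
  Laguerre coefficients of F. This yields both uniqueness of the functional and spanning.\<close>

lemma laguerre_sym_expand:
  "F = (\<Sum>X\<in>supp (laguerre.exp_D z z' 1 F).
     sym_const (coef X (laguerre.exp_D z z' 1 F)) * laguerre_sym z z' (part X))"
proof -
  let ?G = "laguerre.exp_D z z' 1 F" and ?e = "laguerre.exp_D z z' (- 1)"
  have "F = ?e ?G" by (simp add: laguerre.exp_D_add laguerre.exp_D_0)
  also have "\<dots> = ?e (\<Sum>X\<in>supp ?G. sym_const (coef X ?G) * schur_of X)"
    by (subst schur_expand[of ?G]) (rule refl)
  also have "\<dots> = (\<Sum>X\<in>supp ?G. sym_const (coef X ?G) * laguerre_sym z z' (part X))"
    unfolding sym_linear_sum[OF laguerre.lin_exp_D] sym_linear_const[OF laguerre.lin_exp_D]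
    by (rule sum.cong) (auto simp: laguerre_sym_eq_exp_D supp_def)
  finally show ?thesis .
qed

section \<open>Evaluation on the Thoma cone\<close>

definition mon_eval :: "(nat \<Rightarrow>\<^sub>0 nat) \<Rightarrow> thoma_point \<Rightarrow> real" where
  "mon_eval m \<omega> = (\<Prod>i\<in>Poly_Mapping.keys m. power_sum_at (Suc i) \<omega> ^ Poly_Mapping.lookup m i)"

lemma sym_eval_eq:
  "sym_eval F \<omega> = (\<Sum>m\<in>Poly_Mapping.keys F. Poly_Mapping.lookup F m * of_real (mon_eval m \<omega>))"
  by (simp add: sym_eval_def mon_eval_def of_real_prod)

lemma sym_eval_superset:
  assumes "finite K" "Poly_Mapping.keys F \<subseteq> K"
  shows "sym_eval F \<omega> = (\<Sum>m\<in>K. Poly_Mapping.lookup F m * of_real (mon_eval m \<omega>))"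
  unfolding sym_eval_eq
  by (rule sum.mono_neutral_left) (use assms in \<open>auto simp: in_keys_iff\<close>)

lemma sym_eval_add: "sym_eval (F + G) \<omega> = sym_eval F \<omega> + sym_eval G \<omega>"
proof -
  let ?K = "Poly_Mapping.keys F \<union> Poly_Mapping.keys G"
  have K: "finite ?K" by simp
  show ?thesis
    unfolding sym_eval_superset[OF K keys_add] sym_eval_superset[OF K Un_upper1] sym_eval_superset[OF K Un_upper2]
    by (simp add: lookup_add distrib_right sum.distrib)
qed

lemma sym_eval_const_times: "sym_eval (sym_const a * F) \<omega> = a * sym_eval F \<omega>"
proof -
  have sub: "Poly_Mapping.keys (sym_const a * F) \<subseteq> Poly_Mapping.keys F"
    by (auto simp: in_keys_iff lookup_sym_const_times)
  show ?thesis
    unfolding sym_eval_superset[OF finite_keys sub] sym_eval_eq[of F]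
    by (simp add: lookup_sym_const_times sum_distrib_left mult.assoc)
qed

lemma sym_eval_mon [simp]: "sym_eval (mon m) \<omega> = of_real (mon_eval m \<omega>)"
  by (simp add: sym_eval_eq)

lemma mon_eval_0 [simp]: "mon_eval 0 \<omega> = 1"
  by (simp add: mon_eval_def)

lemma mon_eval_single: "mon_eval (Poly_Mapping.single k n) \<omega> = power_sum_at (Suc k) \<omega> ^ n"
  by (cases "n = 0") (simp_all add: mon_eval_def)

lemma sym_eval_power_sum: "sym_eval (power_sum (Suc k)) \<omega> = of_real (power_sum_at (Suc k) \<omega>)"
  by (simp add: power_sum_def mon_eval_single)

lemma sym_eval_0 [simp]: "sym_eval 0 \<omega> = 0"
  by (simp add: sym_eval_def)

lemma sym_eval_1 [simp]: "sym_eval 1 \<omega> = 1"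
  using sym_eval_mon[of 0 \<omega>] by simp

lemma mon_eval_superset:
  assumes "finite K" "Poly_Mapping.keys m \<subseteq> K"
  shows "mon_eval m \<omega> = (\<Prod>i\<in>K. power_sum_at (Suc i) \<omega> ^ Poly_Mapping.lookup m i)"
  unfolding mon_eval_def
  by (rule prod.mono_neutral_left) (use assms in \<open>auto simp: in_keys_iff\<close>)

lemma mon_eval_add: "mon_eval (m + n) \<omega> = mon_eval m \<omega> * mon_eval n \<omega>"
proof -
  let ?K = "Poly_Mapping.keys m \<union> Poly_Mapping.keys n"
  have K: "finite ?K" by simp
  show ?thesis
    unfolding mon_eval_superset[OF K keys_add] mon_eval_superset[OF K Un_upper1] mon_eval_superset[OF K Un_upper2]
    by (simp add: lookup_add power_add prod.distrib)
qed

lemma sym_eval_mult: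
  fixes F G :: "'b::{real_algebra_1, comm_ring_1} sym"
  shows "sym_eval (F * G) \<omega> = sym_eval F \<omega> * sym_eval G \<omega>"
proof (induction F rule: sym_induct)
  case (mon m)
  show ?case
  proof (induction G rule: sym_induct)
    case (mon n)
    show ?case by (simp add: mon_add[symmetric] mon_eval_add)
  next
    case (add F G)
    then show ?case by (simp add: distrib_left sym_eval_add)
  next
    case (const a F)
    then show ?case by (simp only: mult.left_commute[of "mon m"] sym_eval_const_times mult.left_commute)
  qed
next
  case (add F F')
  then show ?case by (simp add: distrib_right sym_eval_add)
qed (simp only: mult.assoc sym_eval_const_times)

lemma sym_eval_sum: "sym_eval (sum f A) \<omega> = (\<Sum>x\<in>A. sym_eval (f x) \<omega>)"
  by (induction A rule: infinite_finite_induct) (simp_all add: sym_eval_add)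

section \<open>Compatibility of the real and the complex algebra\<close>

lemma lookup_complexify: "Poly_Mapping.lookup (complexify F) m = of_real (Poly_Mapping.lookup F m)"
  by (simp add: complexify_def map.rep_eq when_def)

lemma sym_eval_complexify: "sym_eval (complexify F) \<omega> = of_real (sym_eval F \<omega>)"
proof -
  have "Poly_Mapping.keys (complexify F) = Poly_Mapping.keys F"
    by (auto simp: in_keys_iff lookup_complexify)
  then show ?thesis by (simp add: sym_eval_eq lookup_complexify)
qed

lemma complexify_add: "complexify (F + G) = complexify F + complexify G"
  by (rule poly_mapping_eqI) (simp add: lookup_complexify lookup_add)

lemma complexify_const_times: "complexify (sym_const a * F) = sym_const (of_real a) * complexify F"
  by (rule poly_mapping_eqI) (simp add: lookup_complexify lookup_sym_const_times)

lemma complexify_mon: "complexify (mon m) = mon m"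
  by (rule poly_mapping_eqI) (simp add: lookup_complexify lookup_single when_def)

lemma complexify_mult: "complexify (F * G) = complexify F * complexify G"
proof (induction F rule: sym_induct)
  case (mon m)
  show ?case
  proof (induction G rule: sym_induct)
    case (mon n)
    show ?case by (simp only: mon_add[symmetric] complexify_mon)
  next
    case (add F G)
    then show ?case by (simp add: distrib_left complexify_add)
  next
    case (const a F)
    then show ?case by (simp only: mult.left_commute[of "mon m"] complexify_const_times mult.left_commute)
  qed
next
  case (add F F')
  then show ?case by (simp add: distrib_right complexify_add)
qed (simp only: mult.assoc complexify_const_times)

lemma complexify_0 [simp]: "complexify 0 = 0"
  by (rule poly_mapping_eqI) (simp add: lookup_complexify)

lemma complexify_1 [simp]: "complexify 1 = 1"
  using complexify_mon[of 0] by simp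

text \<open>Ring homomorphisms commute with determinants, which transfers Schur functions from the
  real to the complex algebra.\<close>

interpretation complexify: comm_ring_hom complexify
  by unfold_locales (simp_all add: complexify_add complexify_mult)

lemma complexify_power_sum: "complexify (power_sum k) = power_sum k"
  by (simp add: power_sum_def complexify_mon)

lemma complexify_complete_hom: "complexify (complete_hom n) = complete_hom n"
proof (induction n rule: less_induct)
  case (less n)
  show ?case
  proof (cases n)
    case (Suc m)
    have "complexify (\<Sum>k\<le>m. power_sum (Suc k) * complete_hom (m - k)) =
        (\<Sum>k\<le>m. power_sum (Suc k) * complete_hom (m - k))"
      unfolding complexify.hom_sum complexify_mult complexify_power_sum
      by (rule sum.cong) (simp_all add: less Suc)
    then show ?thesis
      by (simp add: Suc complete_hom.simps(2) complexify_const_times del: of_nat_Suc)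
  qed simp
qed

lemma complexify_schur: "complexify (schur \<nu>) = schur \<nu>"
proof -
  have "map_mat complexify (Matrix.mat (length \<nu>) (length \<nu>)
      (\<lambda>(i, j). if i \<le> \<nu> ! i + j then complete_hom (\<nu> ! i + j - i) else 0)) =
    Matrix.mat (length \<nu>) (length \<nu>)
      (\<lambda>(i, j). if i \<le> \<nu> ! i + j then complete_hom (\<nu> ! i + j - i) else 0)"
    by (rule eq_matI) (auto simp: complexify_complete_hom)
  then show ?thesis
    unfolding schur_def complexify.hom_det[symmetric] by simp
qed

section \<open>Growth and homogeneity of symmetric functions on the cone\<close>

lemma cone_summable_power:
  assumes "\<And>i::nat. 0 \<le> \<alpha> i" "summable \<alpha>"
  shows "summable (\<lambda>i. \<alpha> i ^ Suc k :: real)"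
    and "suminf (\<lambda>i. \<alpha> i ^ Suc k) \<le> suminf \<alpha> ^ Suc k"
proof -
  have le: "\<alpha> i \<le> suminf \<alpha>" for i
    using sum_le_suminf[OF assms(2), of "{i}"] assms(1) by simp
  have bound: "\<alpha> i ^ Suc k \<le> suminf \<alpha> ^ k * \<alpha> i" for i
    using power_mono[OF le assms(1), of i k] assms(1)[of i] by (simp add: mult.commute mult_left_mono)
  show sm: "summable (\<lambda>i. \<alpha> i ^ Suc k)"
    by (rule summable_comparison_test'[OF summable_mult[OF assms(2), of "suminf \<alpha> ^ k"], of 0])
      (use assms(1) bound in \<open>auto simp: zero_le_mult_iff\<close>)
  have "suminf (\<lambda>i. \<alpha> i ^ Suc k) \<le> suminf (\<lambda>i. suminf \<alpha> ^ k * \<alpha> i)"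
    by (rule suminf_le[OF bound sm summable_mult[OF assms(2)]])
  also have "\<dots> = suminf \<alpha> ^ Suc k"
    using suminf_mult[OF assms(2)] by simp
  finally show "suminf (\<lambda>i. \<alpha> i ^ Suc k) \<le> suminf \<alpha> ^ Suc k" .
qed

text \<open>Both sums of k-th powers are at most the coordinate sum times r^{k-1}, and the
  coordinate sums together are at most r. For p_1 the value is r by definition.\<close>

lemma power_sum_at_bound:
  assumes "\<omega> \<in> thoma_cone"
  shows "\<bar>power_sum_at (Suc k) \<omega>\<bar> \<le> snd (snd \<omega>) ^ Suc k"
proof -
  obtain \<alpha> \<beta> r where \<omega>: "\<omega> = (\<alpha>, \<beta>, r)" by (rule prod_cases3)
  have a: "\<And>i. 0 \<le> \<alpha> i" "summable \<alpha>" and b: "\<And>i. 0 \<le> \<beta> i" "summable \<beta>"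
    and r: "0 \<le> r" "suminf \<alpha> + suminf \<beta> \<le> r"
    using assms by (auto simp: \<omega> thoma_cone_def)
  show ?thesis
  proof (cases "k = 0")
    case True
    then show ?thesis using r by (simp add: \<omega>)
  next
    case False
    note sa = cone_summable_power[OF a, of k] and sb = cone_summable_power[OF b, of k]
    have a0: "0 \<le> suminf \<alpha>" and b0: "0 \<le> suminf \<beta>"
      using suminf_nonneg[OF a(2) a(1)] suminf_nonneg[OF b(2) b(1)] by simp_all
    have "\<bar>power_sum_at (Suc k) \<omega>\<bar> \<le> suminf (\<lambda>i. \<alpha> i ^ Suc k) + suminf (\<lambda>i. \<beta> i ^ Suc k)"
    proof -
      have "0 \<le> suminf (\<lambda>i. \<alpha> i ^ Suc k)" "0 \<le> suminf (\<lambda>i. \<beta> i ^ Suc k)"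
        using a b sa sb by (auto intro!: suminf_nonneg simp del: power_Suc)
      then show ?thesis using False
        by (cases "even k") (simp_all add: \<omega> del: power_Suc)
    qed
    also have "\<dots> \<le> suminf \<alpha> * (suminf \<alpha> ^ k) + suminf \<beta> * (suminf \<beta> ^ k)"
      using sa(2) sb(2) by simp
    also have "\<dots> \<le> suminf \<alpha> * r ^ k + suminf \<beta> * r ^ k"
      using a0 b0 r by (intro add_mono mult_left_mono power_mono) auto
    also have "\<dots> \<le> r * r ^ k"
      unfolding distrib_right[symmetric] using r by (intro mult_right_mono) auto
    finally show ?thesis by (simp add: \<omega>)
  qed
qed

lemma mon_eval_bound:
  assumes "\<omega> \<in> thoma_cone"
  shows "\<bar>mon_eval m \<omega>\<bar> \<le> snd (snd \<omega>) ^ weight m"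
proof -
  have "\<bar>mon_eval m \<omega>\<bar> = (\<Prod>i\<in>Poly_Mapping.keys m. \<bar>power_sum_at (Suc i) \<omega>\<bar> ^ Poly_Mapping.lookup m i)"
    by (simp add: mon_eval_def abs_prod power_abs)
  also have "\<dots> \<le> (\<Prod>i\<in>Poly_Mapping.keys m. (snd (snd \<omega>) ^ Suc i) ^ Poly_Mapping.lookup m i)"
    using power_sum_at_bound[OF assms] by (intro prod_mono conjI power_mono) auto
  also have "\<dots> = snd (snd \<omega>) ^ weight m"
    by (simp add: weight_def power_sum power_mult[symmetric] mult.commute del: power_Suc)
  finally show ?thesis .
qed

lemma sym_eval_bound:
  fixes F :: "'b::{real_normed_field} sym"
  assumes "\<omega> \<in> thoma_cone"
  shows "norm (sym_eval F \<omega>) \<le>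
    (\<Sum>m\<in>Poly_Mapping.keys F. norm (Poly_Mapping.lookup F m) * snd (snd \<omega>) ^ weight m)"
  unfolding sym_eval_eq
  by (rule order_trans[OF norm_sum])
    (auto simp: norm_mult intro!: sum_mono mult_left_mono mon_eval_bound[OF assms])

text \<open>The curried form of the map in \<open>lifting\<close>; the third component of the
  simplex point, which is 1, is replaced by r.\<close>

definition cone_map :: "thoma_point \<Rightarrow> real \<Rightarrow> thoma_point" where
  "cone_map \<omega> r = (\<lambda>i. r * fst \<omega> i, \<lambda>i. r * fst (snd \<omega>) i, r)"

lemma cone_map_in_cone:
  assumes "\<omega> \<in> thoma_simplex" "0 \<le> r"
  shows "cone_map \<omega> r \<in> thoma_cone"
proof -
  obtain \<alpha> \<beta> where \<omega>: "\<omega> = (\<alpha>, \<beta>, 1)" using assms by (cases \<omega>) (auto simp: thoma_simplex_def)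
  have "r * (suminf \<alpha> + suminf \<beta>) \<le> r * 1"
    using assms by (intro mult_left_mono) (auto simp: \<omega> thoma_simplex_def thoma_cone_def)
  then show ?thesis
    using assms by (auto simp: \<omega> cone_map_def thoma_simplex_def thoma_cone_def suminf_mult distrib_left
        decseq_def intro!: mult_left_mono summable_mult)
qed

lemma power_sum_at_cone_map:
  assumes "\<omega> \<in> thoma_simplex"
  shows "power_sum_at (Suc k) (cone_map \<omega> r) = r ^ Suc k * power_sum_at (Suc k) \<omega>"
proof -
  obtain \<alpha> \<beta> where \<omega>: "\<omega> = (\<alpha>, \<beta>, 1)" using assms by (cases \<omega>) (auto simp: thoma_simplex_def)
  have a: "\<And>i. 0 \<le> \<alpha> i" "summable \<alpha>" and b: "\<And>i. 0 \<le> \<beta> i" "summable \<beta>"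
    using assms by (auto simp: \<omega> thoma_cone_def thoma_simplex_def)
  show ?thesis
    using suminf_mult[OF cone_summable_power(1)[OF a], of "r ^ Suc k" k]
      suminf_mult[OF cone_summable_power(1)[OF b], of "r ^ Suc k" k]
    by (simp add: \<omega> cone_map_def power_mult_distrib distrib_left mult.left_commute[of _ "(- 1) ^ k"]
        del: power_Suc)
qed

lemma mon_eval_cone_map:
  assumes "\<omega> \<in> thoma_simplex"
  shows "mon_eval m (cone_map \<omega> r) = r ^ weight m * mon_eval m \<omega>"
  by (simp add: mon_eval_def power_sum_at_cone_map[OF assms] power_mult_distrib prod.distrib weight_def
      power_sum power_mult[symmetric] mult.commute del: power_Suc)

lemma sym_eval_schur_of_cone_map:
  assumes "\<omega> \<in> thoma_simplex" "diagram X"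
  shows "sym_eval (schur_of X) (cone_map \<omega> r) =
    (of_real (r ^ card X) * sym_eval (schur_of X) \<omega> :: 'b::{field_char_0, real_algebra_1})"
proof -
  have "sym_eval F (cone_map \<omega> r) = of_real (r ^ card X) * sym_eval F \<omega>"
    if "F \<in> sym.span (mon ` {m. weight m = card X})" for F :: "'b sym"
    using that
  proof (induction F rule: sym.span_induct_alt)
    case base
    show ?case by simp
  next
    case (step a F G)
    then show ?case
      by (auto simp: sym_eval_add sym_eval_const_times mon_eval_cone_map[OF assms(1)] algebra_simps)
  qed
  then show ?thesis using schur_of_homogeneous[OF assms(2)] by blast
qed

section \<open>The lifted measure\<close>

lemma measurable_fst_coord: "(\<lambda>\<omega> :: thoma_point. fst \<omega> i) \<in> borel_measurable borel"
  and measurable_snd_coord: "(\<lambda>\<omega> :: thoma_point. fst (snd \<omega>) i) \<in> borel_measurable borel"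
  and measurable_radius: "(\<lambda>\<omega> :: thoma_point. snd (snd \<omega>)) \<in> borel_measurable borel"
proof -
  have "continuous_on UNIV (\<lambda>\<omega> :: thoma_point. fst \<omega> i)"
    by (rule continuous_on_compose2[OF continuous_on_product_coordinates]) (auto intro: continuous_intros)
  then show "(\<lambda>\<omega> :: thoma_point. fst \<omega> i) \<in> borel_measurable borel"
    by (rule borel_measurable_continuous_onI)
  have "continuous_on UNIV (\<lambda>\<omega> :: thoma_point. fst (snd \<omega>) i)"
    by (rule continuous_on_compose2[OF continuous_on_product_coordinates
          continuous_on_fst[OF continuous_on_snd[OF continuous_on_id]]]) simp
  then show "(\<lambda>\<omega> :: thoma_point. fst (snd \<omega>) i) \<in> borel_measurable borel"
    by (rule borel_measurable_continuous_onI)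
  show "(\<lambda>\<omega> :: thoma_point. snd (snd \<omega>)) \<in> borel_measurable borel"
    by (intro borel_measurable_continuous_onI continuous_intros)
qed

lemma measurable_power_sum_at: "power_sum_at k \<in> borel_measurable borel"
proof -
  note [measurable] = measurable_fst_coord measurable_snd_coord measurable_radius
  have "power_sum_at k = (\<lambda>\<omega>. if k = 1 then snd (snd \<omega>)
      else suminf (\<lambda>i. fst \<omega> i ^ k) + (- 1) ^ (k - 1) * suminf (\<lambda>i. fst (snd \<omega>) i ^ k))"
    by (rule ext) (auto split: prod.splits)
  also have "\<dots> \<in> borel_measurable borel" by measurable
  finally show ?thesis .
qed

lemma measurable_mon_eval: "mon_eval m \<in> borel_measurable borel"
  unfolding mon_eval_def[abs_def]
  by (intro borel_measurable_prod borel_measurable_power measurable_power_sum_at)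

lemma measurable_sym_eval:
  "sym_eval (F :: 'b::{real_normed_field, second_countable_topology} sym) \<in> borel_measurable borel"
proof -
  note [measurable] = measurable_mon_eval
  have "sym_eval F = (\<lambda>\<omega>. \<Sum>m\<in>Poly_Mapping.keys F. Poly_Mapping.lookup F m * of_real (mon_eval m \<omega>))"
    by (rule ext) (rule sym_eval_eq)
  also have "\<dots> \<in> borel_measurable borel" by measurable
  finally show ?thesis .
qed

text \<open>The moment is Gamma(c + n) / Gamma(c), the rising factorial. As a nonnegative integral
  it yields integrability at once, and n = 0 gives total mass 1.\<close>

lemma gamma_distr_moment:
  assumes "c > 0"
  shows "(\<integral>\<^sup>+r. ennreal (r ^ n) \<partial>gamma_distr c) = ennreal (pochhammer c n)"
proof -
  have nonint: "c \<notin> \<int>\<^sub>\<le>\<^sub>0" using assms by (auto elim!: nonpos_Ints_cases)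
  have G: "Gamma c > 0" using assms by (rule Gamma_real_pos)
  have m: "(\<lambda>r :: real. ennreal (f r)) \<in> borel_measurable (restrict_space lborel {0<..})"
    if "f \<in> borel_measurable borel" for f
    using that by (intro measurable_restrict_space1) simp
  have "(\<integral>\<^sup>+r. ennreal (r ^ n) \<partial>gamma_distr c) =
      (\<integral>\<^sup>+r. ennreal (r powr (c - 1) * exp (- r) / Gamma c) * ennreal (r ^ n) \<partial>restrict_space lborel {0<..})"
    unfolding gamma_distr_def by (intro nn_integral_density m) measurable
  also have "\<dots> = (\<integral>\<^sup>+r. ennreal (r powr (c - 1) * exp (- r) / Gamma c) * ennreal (r ^ n) * indicator {0<..} r \<partial>lborel)"
    by (subst nn_integral_restrict_space) simp_all
  also have "\<dots> = (\<integral>\<^sup>+r. ennreal (1 / Gamma c) * ennreal (indicator {0..} r * r powr (c + n - 1) / exp r) \<partial>lborel)"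
  proof (rule nn_integral_cong)
    fix r :: real
    show "ennreal (r powr (c - 1) * exp (- r) / Gamma c) * ennreal (r ^ n) * indicator {0<..} r =
        ennreal (1 / Gamma c) * ennreal (indicator {0..} r * r powr (c + n - 1) / exp r)"
    proof (cases "r > 0")
      case True
      then have "r powr (c + n - 1) = r powr (c - 1) * r ^ n"
        by (simp add: powr_realpow[symmetric] powr_add[symmetric] algebra_simps)
      then show ?thesis
        using True G by (simp add: ennreal_mult[symmetric] exp_minus field_simps)
    next
      case False
      \<comment> \<open>At r = 0 the two indicators differ, but \<open>0 powr x = 0\<close> makes
        both sides vanish.\<close>
      then show ?thesis by (cases "r = 0") simp_all
    qed
  qed
  also have "\<dots> = ennreal (1 / Gamma c) * (\<integral>\<^sup>+r. ennreal (indicator {0..} r * r powr (c + n - 1) / exp r) \<partial>lborel)"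
    by (rule nn_integral_cmult) measurable
  also have "\<dots> = ennreal (1 / Gamma c) * ennreal (Gamma (c + n))"
    using assms by (subst Gamma_conv_nn_integral_real) simp_all
  also have "\<dots> = ennreal (pochhammer c n)"
    using G Gamma_real_pos[of "c + n"] assms
    by (simp add: pochhammer_Gamma[OF nonint] ennreal_mult[symmetric])
  finally show ?thesis .
qed

lemma sets_gamma_distr: "sets (gamma_distr c) = sets (restrict_space borel {0<..})"
  by (simp add: gamma_distr_def sets_restrict_space)

lemma space_gamma_distr: "space (gamma_distr c) = {0<..}"
  by (simp add: gamma_distr_def space_restrict_space)

lemma prob_space_gamma_distr: "c > 0 \<Longrightarrow> prob_space (gamma_distr c)"
  using gamma_distr_moment[of c 0] by (intro prob_spaceI) simp

lemma measurable_gamma_distr: "f \<in> borel_measurable borel \<Longrightarrow> f \<in> borel_measurable (gamma_distr c)"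
  by (simp add: measurable_restrict_space1 cong: measurable_cong_sets[OF sets_gamma_distr refl])

lemma has_bochner_integral_gamma_distr:
  assumes "c > 0"
  shows "has_bochner_integral (gamma_distr c) (\<lambda>r. r ^ n) (pochhammer c n)"
  using gamma_distr_moment[OF assms, of n] assms
  by (intro has_bochner_integral_nn_integral measurable_gamma_distr AE_I2)
    (auto simp: space_gamma_distr pochhammer_nonneg)

text \<open>Integrability and density are treated for the lifting of an arbitrary probability
  measure on the simplex; the parameters z, z' enter later, through the Schur moments.\<close>

locale thoma_lifting =
  fixes P :: "thoma_point measure" and c :: real
  assumes prob_P: "prob_space P"
    and sets_P: "sets P = sets (restrict_space borel thoma_simplex)"
    and c_pos: "c > 0"
begin

abbreviation \<gamma> where "\<gamma> \<equiv> gamma_distr c"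

abbreviation M where "M \<equiv> lifting P c"

lemma space_P: "space P = thoma_simplex"
  using sets_eq_imp_space_eq[OF sets_P] by (simp add: space_restrict_space)

lemma measurable_P: "f \<in> borel_measurable borel \<Longrightarrow> f \<in> borel_measurable P"
  by (simp add: measurable_restrict_space1 cong: measurable_cong_sets[OF sets_P refl])

sublocale P: prob_space P by (rule prob_P)
sublocale \<gamma>: prob_space \<gamma> by (rule prob_space_gamma_distr[OF c_pos])
sublocale P\<gamma>: pair_prob_space P \<gamma> ..

lemma lifting_eq: "M = distr (P \<Otimes>\<^sub>M \<gamma>) (restrict_space borel thoma_cone) (\<lambda>x. cone_map (fst x) (snd x))"
  unfolding lifting_def
  by (rule distr_cong) (auto simp: cone_map_def split: prod.splits)

lemma measurable_cone_map:
  "(\<lambda>x. cone_map (fst x) (snd x)) \<in> P \<Otimes>\<^sub>M \<gamma> \<rightarrow>\<^sub>M restrict_space borel thoma_cone"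
proof (rule measurable_restrict_space2)
  show "(\<lambda>x. cone_map (fst x) (snd x)) \<in> space (P \<Otimes>\<^sub>M \<gamma>) \<rightarrow> thoma_cone"
    by (auto simp: space_pair_measure space_P space_gamma_distr intro!: cone_map_in_cone)
  have [measurable]: "(\<lambda>x. snd x) \<in> borel_measurable (P \<Otimes>\<^sub>M \<gamma>)"
    by (rule measurable_compose[OF measurable_snd measurable_gamma_distr]) simp
  have [measurable]: "(\<lambda>x. fst (fst x) i) \<in> borel_measurable (P \<Otimes>\<^sub>M \<gamma>)"
    "(\<lambda>x. fst (snd (fst x)) i) \<in> borel_measurable (P \<Otimes>\<^sub>M \<gamma>)" for i
    by (rule measurable_compose[OF measurable_fst measurable_P], rule measurable_fst_coord measurable_snd_coord)+
  show "(\<lambda>x. cone_map (fst x) (snd x)) \<in> borel_measurable (P \<Otimes>\<^sub>M \<gamma>)"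
    unfolding cone_map_def
    by (intro borel_measurable_Pair measurable_coordinatewise_then_product) measurable
qed

lemma sets_M: "sets M = sets (restrict_space borel thoma_cone)"
  by (simp add: lifting_def)

lemma space_M: "space M = thoma_cone"
  by (simp add: lifting_def space_restrict_space)

sublocale M: prob_space M
  unfolding lifting_eq by (rule P\<gamma>.prob_space_distr[OF measurable_cone_map])

lemma measurable_M: "f \<in> borel_measurable borel \<Longrightarrow> f \<in> borel_measurable M"
  by (simp add: measurable_restrict_space1 cong: measurable_cong_sets[OF sets_M refl])

lemma integrable_product_power: "integrable (P \<Otimes>\<^sub>M \<gamma>) (\<lambda>x. snd x ^ n)"
proof (rule P\<gamma>.Fubini_integrable)
  show "(\<lambda>x. snd x ^ n) \<in> borel_measurable (P \<Otimes>\<^sub>M \<gamma>)"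
    by (rule measurable_compose[OF measurable_snd measurable_gamma_distr]) simp
  have int: "integrable \<gamma> (\<lambda>r. r ^ n)"
    using has_bochner_integral_gamma_distr[OF c_pos] by (rule integrable.intros)
  then show "AE x in P. integrable \<gamma> (\<lambda>y. snd (x, y) ^ n)" by simp
  show "integrable P (\<lambda>x. \<integral>y. norm (snd (x, y) ^ n) \<partial>\<gamma>)" by simp
qed

lemma integrable_radius_power: "integrable M (\<lambda>\<omega>. snd (snd \<omega>) ^ n)"
  unfolding lifting_eq
  using integrable_product_power[of n]
  by (subst integrable_distr_eq[OF measurable_cone_map])
    (auto simp: cone_map_def intro!: measurable_restrict_space1 borel_measurable_power measurable_radius)

lemma integrable_sym_eval:
  fixes F :: "'b::{real_normed_field, banach, second_countable_topology} sym"
  shows "integrable M (sym_eval F)"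
proof (rule Bochner_Integration.integrable_bound)
  show "integrable M (\<lambda>\<omega>. \<Sum>m\<in>Poly_Mapping.keys F. norm (Poly_Mapping.lookup F m) * snd (snd \<omega>) ^ weight m)"
    by (intro Bochner_Integration.integrable_sum integrable_mult_right integrable_radius_power)
  show "sym_eval F \<in> borel_measurable M" by (rule measurable_M[OF measurable_sym_eval])
  show "AE \<omega> in M. norm (sym_eval F \<omega>) \<le>
      norm (\<Sum>m\<in>Poly_Mapping.keys F. norm (Poly_Mapping.lookup F m) * snd (snd \<omega>) ^ weight m)"
  proof (rule AE_I2)
    fix \<omega> assume "\<omega> \<in> space M"
    then have "norm (sym_eval F \<omega>) \<le>
        (\<Sum>m\<in>Poly_Mapping.keys F. norm (Poly_Mapping.lookup F m) * snd (snd \<omega>) ^ weight m)"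
      by (intro sym_eval_bound) (simp add: space_M)
    then show "norm (sym_eval F \<omega>) \<le>
        norm (\<Sum>m\<in>Poly_Mapping.keys F. norm (Poly_Mapping.lookup F m) * snd (snd \<omega>) ^ weight m)"
      by simp
  qed
qed

lemma integral_schur_of:
  assumes X: "diagram X"
  shows "(\<integral>\<omega>. sym_eval (schur_of X :: real sym) \<omega> \<partial>M) =
    pochhammer c (card X) * (\<integral>\<omega>. sym_eval (schur_of X :: real sym) \<omega> \<partial>P)"
proof -
  let ?S = "sym_eval (schur_of X :: real sym)"
  have S: "?S \<in> borel_measurable (restrict_space borel thoma_cone)"
    by (rule measurable_restrict_space1[OF measurable_sym_eval])
  have int: "integrable (P \<Otimes>\<^sub>M \<gamma>) (\<lambda>x. ?S (cone_map (fst x) (snd x)))"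
    using integrable_sym_eval[of "schur_of X :: real sym"]
    unfolding lifting_eq by (rule integrable_distr[OF measurable_cone_map])
  have "(\<integral>\<omega>. ?S \<omega> \<partial>M) = (\<integral>x. ?S (cone_map (fst x) (snd x)) \<partial>(P \<Otimes>\<^sub>M \<gamma>))"
    unfolding lifting_eq by (rule integral_distr[OF measurable_cone_map S])
  also have "\<dots> = (\<integral>\<omega>. (\<integral>r. ?S (cone_map \<omega> r) \<partial>\<gamma>) \<partial>P)"
    using P\<gamma>.integral_fst'[OF int] by simp
  also have "\<dots> = (\<integral>\<omega>. pochhammer c (card X) * ?S \<omega> \<partial>P)"
  proof (rule Bochner_Integration.integral_cong[OF refl])
    fix \<omega> assume "\<omega> \<in> space P"
    then have "\<omega> \<in> thoma_simplex" by (simp add: space_P)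
    then have "(\<integral>r. ?S (cone_map \<omega> r) \<partial>\<gamma>) = (\<integral>r. r ^ card X * ?S \<omega> \<partial>\<gamma>)"
      by (simp add: sym_eval_schur_of_cone_map[OF _ X])
    also have "\<dots> = (\<integral>r. r ^ card X \<partial>\<gamma>) * ?S \<omega>" by simp
    also have "(\<integral>r. r ^ card X \<partial>\<gamma>) = pochhammer c (card X)"
      by (rule has_bochner_integral_integral_eq[OF has_bochner_integral_gamma_distr[OF c_pos]])
    finally show "(\<integral>r. ?S (cone_map \<omega> r) \<partial>\<gamma>) = pochhammer c (card X) * ?S \<omega>" .
  qed
  also have "\<dots> = pochhammer c (card X) * (\<integral>\<omega>. ?S \<omega> \<partial>P)" by simp
  finally show ?thesis .
qed

end

text \<open>The one-box diagram turns the admissibility condition into z z' \<ge> 0.\<close>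

lemma admissible_product_pos:
  assumes "admissible z z'"
  shows "Re (z * z') > 0" "z * z' = of_real (Re (z * z'))"
proof -
  have "[1] \<in> young" by (simp add: young_def)
  moreover have "boxes [1] = {(0, 0)}" by (auto simp: boxes_def)
  ultimately have "z * z' \<in> \<real>\<^sub>\<ge>\<^sub>0"
    using assms by (force simp: admissible_def skew_pochhammer_def skew_def content_def)
  moreover have "z * z' \<noteq> 0" using assms by (simp add: admissible_def)
  ultimately show "Re (z * z') > 0" "z * z' = of_real (Re (z * z'))"
    by (auto simp: complex_nonneg_Reals_iff complex_eq_iff)
qed

locale z_measure =
  fixes z z' :: complex and P :: "thoma_point measure" and c :: real
  assumes c_eq: "z * z' = of_real c" and c_positive: "c > 0" and zm: "is_z_measure z z' P"
begin

sublocale thoma_lifting P c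
  by (rule thoma_lifting.intro) (use c_positive zm in \<open>simp_all add: is_z_measure_def\<close>)

sublocale laguerre z z' .

lemma integral_eq_coef: "(\<integral>\<omega>. sym_eval F \<omega> \<partial>M) = coef {} (exp_D 1 F)"
proof (induction F rule: schur_induct)
  case (schur X)
  obtain \<nu> where \<nu>: "\<nu> \<in> young" "X = boxes \<nu>" using schur by (rule diagram_cases)
  have "(\<integral>\<omega>. sym_eval (schur_of X) \<omega> \<partial>M) = complex_of_real (\<integral>\<omega>. sym_eval (schur_of X :: real sym) \<omega> \<partial>M)"
    unfolding schur_of_def complexify_schur[symmetric] sym_eval_complexify by (rule integral_complex_of_real)
  also have "\<dots> = pochhammer (of_real c) (card X) * of_real (\<integral>\<omega>. sym_eval (schur_of X :: real sym) \<omega> \<partial>P)"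
    by (simp only: integral_schur_of[OF schur] of_real_mult pochhammer_of_real)
  also have "of_real (\<integral>\<omega>. sym_eval (schur_of X :: real sym) \<omega> \<partial>P) =
      skew_pochhammer z \<nu> [] * skew_pochhammer z' \<nu> [] / pochhammer (z * z') (sum_list \<nu>) *
        (of_nat (skew_dim \<nu> []) / fact (sum_list \<nu>))"
    using zm \<nu> by (simp add: is_z_measure_def schur_of_boxes)
  also have "pochhammer (of_real c) (card X) * \<dots> = coef {} (exp_D 1 (schur_of X))"
  proof -
    have "pochhammer (complex_of_real c) (sum_list \<nu>) \<noteq> 0"
      unfolding pochhammer_of_real
      using pochhammer_pos[OF c_positive, of "sum_list \<nu>"] by simp
    then show ?thesis
      unfolding \<nu>(2) coef_empty_exp_D_schur_of[OF diagram_boxes[OF \<nu>(1)]] skew_pochhammer_box_weight c_eq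
      by (simp add: card_boxes skew_dim_eq)
  qed
  finally show ?case .
next
  case (add F G)
  then show ?case
    by (simp add: sym_eval_add integrable_sym_eval sym_linear_add[OF lin_exp_D] coef_add)
next
  case (const a F)
  then show ?case
    by (simp add: sym_eval_const_times integrable_sym_eval sym_linear_const[OF lin_exp_D] coef_const)
qed

text \<open>The definite description needs both halves: the integral has the prescribed values
  because e^D takes Laguerre functions back to Schur functions, and it is the only such functional
  because the Laguerre functions span.\<close>

lemma laguerre_functional_eq: "laguerre_functional z z' F = (\<integral>\<omega>. sym_eval F \<omega> \<partial>M)"
proof -
  let ?\<Phi> = "\<lambda>F. \<integral>\<omega>. sym_eval F \<omega> \<partial>M :: complex"
  let ?lin = "Vector_Spaces.linear (\<lambda>a (F :: complex sym). sym_const a * F) (*)"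
  have "laguerre_functional z z' = ?\<Phi>"
    unfolding laguerre_functional_def
  proof (rule the_equality)
    have vs: "vector_space ((*) :: complex \<Rightarrow> complex \<Rightarrow> complex)"
      by unfold_locales (simp_all add: algebra_simps)
    have "?\<Phi> (F + G) = ?\<Phi> F + ?\<Phi> G" "?\<Phi> (sym_const a * F) = a * ?\<Phi> F" for F G a
      unfolding sym_eval_add sym_eval_const_times by (simp_all add: integrable_sym_eval)
    then have "?lin ?\<Phi>"
      unfolding Vector_Spaces.linear_iff
      using sym.vector_space_axioms vs by blast
    moreover have "?\<Phi> (laguerre_sym z z' \<nu>) = (if \<nu> = [] then 1 else 0)" if "\<nu> \<in> young" for \<nu>
    proof -
      have "boxes \<nu> = {} \<longleftrightarrow> \<nu> = []"
        using inj_onD[OF inj_on_boxes, of \<nu> "[]"] that by auto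
      then show ?thesis
        unfolding integral_eq_coef laguerre_sym_eq_exp_D[OF that] exp_D_add
        using coef_schur_of[OF diagram_empty diagram_boxes[OF that]] by (auto simp: exp_D_0)
    qed
    ultimately show "?lin ?\<Phi> \<and> (\<forall>\<nu>\<in>young. ?\<Phi> (laguerre_sym z z' \<nu>) = (if \<nu> = [] then 1 else 0))"
      by blast
    fix \<phi> assume \<phi>: "?lin \<phi> \<and> (\<forall>\<nu>\<in>young. \<phi> (laguerre_sym z z' \<nu>) = (if \<nu> = [] then 1 else 0))"
    show "\<phi> = ?\<Phi>"
    proof
      fix F :: "complex sym"
      let ?G = "exp_D 1 F"
      have expand: "\<psi> F = (\<Sum>X\<in>supp ?G. coef X ?G * \<psi> (laguerre_sym z z' (part X)))"
        if "?lin \<psi>" for \<psi>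
      proof -
        interpret \<psi>: Vector_Spaces.linear "\<lambda>a (F :: complex sym). sym_const a * F" "(*)" \<psi> by (rule that)
        have "\<psi> F = \<psi> (\<Sum>X\<in>supp ?G. sym_const (coef X ?G) * laguerre_sym z z' (part X))"
          by (rule arg_cong[OF laguerre_sym_expand])
        then show ?thesis by (simp only: \<psi>.sum \<psi>.scale)
      qed
      show "\<phi> F = ?\<Phi> F"
        unfolding expand[OF \<open>?lin ?\<Phi>\<close>] using \<phi> expand[of \<phi>]
          \<open>\<And>\<nu>. \<nu> \<in> young \<Longrightarrow> ?\<Phi> (laguerre_sym z z' \<nu>) = (if \<nu> = [] then 1 else 0)\<close>
        by (auto simp: supp_def intro!: sum.cong)
    qed
  qed
  then show ?thesis by simp
qed

end

section \<open>Orthogonality\<close>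

context thoma_lifting
begin

lemma cmod_sym_eval_power2: "(cmod (sym_eval F \<omega>))\<^sup>2 = cmod (sym_eval (F * F) \<omega>)"
  by (simp add: sym_eval_mult norm_mult power2_eq_square)

lemma square_integrable_sym_eval: "square_integrable M (sym_eval (F :: complex sym))"
  unfolding square_integrable_def cmod_sym_eval_power2
  by (intro conjI measurable_M measurable_sym_eval integrable_norm integrable_sym_eval)

end

text \<open>Nonzero box weights give the nondegenerate form; real ones make the Laguerre functions
  real-valued, so that the Hermitian inner product of two of them is computed by the bilinear
  form.\<close>

locale orthogonal_z_measure = z_measure +
  assumes box_weight_nonzero': "laguerre.box_weight z z' b \<noteq> 0"
    and box_weight_real: "cnj (laguerre.box_weight z z' b) = laguerre.box_weight z z' b"
begin

sublocale laguerre_nondegenerate z z'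
  by unfold_locales (rule box_weight_nonzero')

lemma cnj_sym_eval_laguerre:
  assumes "\<nu> \<in> young"
  shows "cnj (sym_eval (laguerre_sym z z' \<nu>) \<omega>) = sym_eval (laguerre_sym z z' \<nu>) \<omega>"
proof -
  have "cnj (sym_eval (schur_of X) \<omega>) = sym_eval (schur_of X) \<omega>" for X
    unfolding schur_of_def complexify_schur[symmetric] sym_eval_complexify by simp
  then show ?thesis
    unfolding laguerre_sym_eq_exp_D[OF assms] exp_D_schur_of[OF diagram_boxes[OF assms]]
      sym_eval_sum sym_eval_const_times cnj_sum
    by (intro sum.cong refl) (simp add: box_weight_real)
qed

text \<open>The integral is the form of the images under e^D, and these images are Schur
  functions.\<close>

lemma integral_laguerre_mult:
  assumes "\<nu> \<in> young" "\<mu> \<in> young"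
  shows "(\<integral>\<omega>. sym_eval (laguerre_sym z z' \<nu>) \<omega> * cnj (sym_eval (laguerre_sym z z' \<mu>) \<omega>) \<partial>M) =
    (if \<nu> = \<mu> then diagram_weight (boxes \<nu>) else 0)"
proof -
  have "boxes \<nu> = boxes \<mu> \<longleftrightarrow> \<nu> = \<mu>"
    using inj_onD[OF inj_on_boxes, of \<nu> \<mu>] assms by auto
  moreover have "(\<integral>\<omega>. sym_eval (laguerre_sym z z' \<nu>) \<omega> * cnj (sym_eval (laguerre_sym z z' \<mu>) \<omega>) \<partial>M) =
      coef {} (exp_D 1 (laguerre_sym z z' \<nu> * laguerre_sym z z' \<mu>))"
    unfolding integral_eq_coef[symmetric] sym_eval_mult cnj_sym_eval_laguerre[OF assms(2)] by (rule refl)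
  ultimately show ?thesis
    unfolding coef_empty_exp_mult
    by (simp add: laguerre_sym_eq_exp_D assms exp_D_add exp_D_0 form_schur_of diagram_boxes)
qed

lemma integral_laguerre_square_nonzero:
  assumes "\<nu> \<in> young"
  shows "(\<integral>\<omega>. (cmod (sym_eval (laguerre_sym z z' \<nu>) \<omega>))\<^sup>2 \<partial>M) \<noteq> 0"
proof
  assume *: "(\<integral>\<omega>. (cmod (sym_eval (laguerre_sym z z' \<nu>) \<omega>))\<^sup>2 \<partial>M) = 0"
  have "complex_of_real (\<integral>\<omega>. (cmod (sym_eval (laguerre_sym z z' \<nu>) \<omega>))\<^sup>2 \<partial>M) =
      (\<integral>\<omega>. sym_eval (laguerre_sym z z' \<nu>) \<omega> * cnj (sym_eval (laguerre_sym z z' \<nu>) \<omega>) \<partial>M)"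
    unfolding integral_complex_of_real[symmetric] complex_norm_square[symmetric] by simp
  then show False
    using * diagram_weight_nonzero[OF diagram_boxes[OF assms]] by (simp add: integral_laguerre_mult assms)
qed

end

text \<open>In the principal series the two factors are conjugate and z is not an integer; in the
  complementary series both factors are real and no integer lies strictly between k and k +
  1.\<close>

lemma box_weight_series:
  assumes "principal_series z z' \<or> complementary_series z z'"
  shows "laguerre.box_weight z z' b \<noteq> 0"
    and "cnj (laguerre.box_weight z z' b) = laguerre.box_weight z z' b"
proof -
  let ?k = "of_int (content b) :: complex"
  have "z + ?k \<noteq> 0 \<and> z' + ?k \<noteq> 0 \<and> cnj ((z + ?k) * (z' + ?k)) = (z + ?k) * (z' + ?k)"
    using assms
  proof
    assume "principal_series z z'"
    then have z: "z' = cnj z" "z \<notin> \<int>" by (simp_all add: principal_series_def)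
    have nz: "z + ?k \<noteq> 0"
    proof
      assume "z + ?k = 0"
      then have "z = of_int (- content b)" by (simp add: eq_neg_iff_add_eq_0)
      then show False using z(2) Ints_of_int by metis
    qed
    have eq: "z' + ?k = cnj (z + ?k)" by (simp add: z(1))
    have "z' + ?k \<noteq> 0" using nz unfolding eq complex_cnj_zero_iff .
    then show ?thesis using nz by (simp add: z(1) mult.commute)
  next
    assume "complementary_series z z'"
    then obtain k :: int where z: "z \<in> \<real>" "z' \<in> \<real>"
      and k: "of_int k < Re z" "Re z < of_int k + 1" "of_int k < Re z'" "Re z' < of_int k + 1"
      unfolding complementary_series_def by blast
    have nz: "x + ?k \<noteq> 0" if "of_int k < Re x" "Re x < of_int k + 1" for x
    proof
      assume "x + ?k = 0"
      then have "Re x = of_int (- content b)" by (simp add: complex_eq_iff)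
      then have "of_int k < (of_int (- content b) :: real)" "of_int (- content b) < (of_int (k + 1) :: real)"
        using that by simp_all
      then have "k < - content b" "- content b < k + 1" by (simp_all only: of_int_less_iff)
      then show False by simp
    qed
    show ?thesis
      using nz k z by (simp add: Reals_cnj_iff)
  qed
  then show "laguerre.box_weight z z' b \<noteq> 0"
    and "cnj (laguerre.box_weight z z' b) = laguerre.box_weight z z' b"
    by (simp_all add: laguerre.box_weight_def)
qed

section \<open>Density of the symmetric functions\<close>

lemma cmod_add_power2_le: "(cmod (a + b))\<^sup>2 \<le> 2 * (cmod a)\<^sup>2 + 2 * (cmod b)\<^sup>2"
proof -
  have "(cmod (a + b))\<^sup>2 \<le> (cmod a + cmod b)\<^sup>2" by (intro power_mono norm_triangle_ineq) simp
  also have "\<dots> \<le> 2 * (cmod a)\<^sup>2 + 2 * (cmod b)\<^sup>2"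
    using sum_squares_bound[of "cmod a" "cmod b"] by (simp add: power2_sum)
  finally show ?thesis .
qed

lemma square_integrable_add:
  assumes "square_integrable M f" "square_integrable M g"
  shows "square_integrable M (\<lambda>x. f x + g x)"
proof -
  have [measurable]: "f \<in> borel_measurable M" "g \<in> borel_measurable M"
    using assms by (simp_all add: square_integrable_def)
  have "integrable M (\<lambda>x. (cmod (f x + g x))\<^sup>2)"
  proof (rule Bochner_Integration.integrable_bound)
    show "integrable M (\<lambda>x. 2 * (cmod (f x))\<^sup>2 + 2 * (cmod (g x))\<^sup>2)"
      using assms by (simp add: square_integrable_def)
    show "AE x in M. norm ((cmod (f x + g x))\<^sup>2) \<le> norm (2 * (cmod (f x))\<^sup>2 + 2 * (cmod (g x))\<^sup>2)"
      using cmod_add_power2_le by simp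
  qed measurable
  then show ?thesis by (simp add: square_integrable_def)
qed

lemma square_integrable_bounded_mult:
  fixes h :: "'x \<Rightarrow> complex"
  assumes "square_integrable M f" "h \<in> borel_measurable M" "\<And>x. x \<in> space M \<Longrightarrow> cmod (h x) \<le> C"
  shows "square_integrable M (\<lambda>x. h x * f x)"
proof -
  have [measurable]: "f \<in> borel_measurable M" "h \<in> borel_measurable M"
    using assms by (simp_all add: square_integrable_def)
  have "integrable M (\<lambda>x. (cmod (h x * f x))\<^sup>2)"
  proof (rule Bochner_Integration.integrable_bound)
    show "integrable M (\<lambda>x. C\<^sup>2 * (cmod (f x))\<^sup>2)"
      using assms(1) by (simp add: square_integrable_def)
    show "AE x in M. norm ((cmod (h x * f x))\<^sup>2) \<le> norm (C\<^sup>2 * (cmod (f x))\<^sup>2)"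
      using assms(3) by (intro AE_I2) (auto simp: norm_mult power_mult_distrib intro!: mult_right_mono power_mono)
  qed measurable
  then show ?thesis by (simp add: square_integrable_def)
qed

lemma square_integrable_scale: "square_integrable M f \<Longrightarrow> square_integrable M (\<lambda>x. c * f x)"
  by (rule square_integrable_bounded_mult[of M f "\<lambda>_. c" "cmod c"]) simp_all

lemma square_integrable_diff:
  assumes "square_integrable M f" "square_integrable M g"
  shows "square_integrable M (\<lambda>x. f x - g x)"
  using square_integrable_add[OF assms(1) square_integrable_scale[OF assms(2), of "- 1"]] by simp

text \<open>A triangle inequality for squared distances with factors 2; it replaces Minkowski's
  inequality, and no square roots of integrals occur.\<close>

lemma integral_square_triangle:
  assumes "square_integrable M f" "square_integrable M g" "square_integrable M h"
  shows "(\<integral>x. (cmod (f x - h x))\<^sup>2 \<partial>M) \<le>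
    2 * (\<integral>x. (cmod (f x - g x))\<^sup>2 \<partial>M) + 2 * (\<integral>x. (cmod (g x - h x))\<^sup>2 \<partial>M)"
proof -
  have int: "integrable M (\<lambda>x. (cmod (f x - g x))\<^sup>2)" "integrable M (\<lambda>x. (cmod (g x - h x))\<^sup>2)"
    "integrable M (\<lambda>x. (cmod (f x - h x))\<^sup>2)"
    using square_integrable_diff assms by (auto simp: square_integrable_def)
  have "(\<integral>x. (cmod (f x - h x))\<^sup>2 \<partial>M) \<le>
      (\<integral>x. 2 * (cmod (f x - g x))\<^sup>2 + 2 * (cmod (g x - h x))\<^sup>2 \<partial>M)"
  proof (rule integral_mono)
    fix x
    show "(cmod (f x - h x))\<^sup>2 \<le> 2 * (cmod (f x - g x))\<^sup>2 + 2 * (cmod (g x - h x))\<^sup>2"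
      using cmod_add_power2_le[of "f x - g x" "g x - h x"] by simp
  qed (use int in simp_all)
  then show ?thesis using int by simp
qed

lemma integral_square_dominated:
  assumes f: "f \<in> borel_measurable M" and u: "\<And>n. u n \<in> borel_measurable M"
    and w: "integrable M (\<lambda>x. (w x)\<^sup>2)"
    and lim: "\<And>x. x \<in> space M \<Longrightarrow> (\<lambda>n. u n x) \<longlonglongrightarrow> f x"
    and bound: "\<And>n x. x \<in> space M \<Longrightarrow> cmod (u n x) \<le> w x"
  shows "square_integrable M f" "(\<lambda>n. \<integral>x. (cmod (f x - u n x))\<^sup>2 \<partial>M) \<longlonglongrightarrow> 0"
proof -
  note [measurable] = f u
  have fw: "cmod (f x) \<le> w x" if "x \<in> space M" for x
    using tendsto_norm[OF lim[OF that]] bound[OF that] by (intro LIMSEQ_le_const2) auto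
  have "integrable M (\<lambda>x. (cmod (f x))\<^sup>2)"
    by (rule Bochner_Integration.integrable_bound[OF w])
      (auto intro!: AE_I2 power_mono fw)
  then show "square_integrable M f" by (simp add: square_integrable_def)
  have "(\<lambda>n. \<integral>x. (cmod (f x - u n x))\<^sup>2 \<partial>M) \<longlonglongrightarrow> (\<integral>x. 0 \<partial>M)"
  proof (rule integral_dominated_convergence)
    show "integrable M (\<lambda>x. 4 * (w x)\<^sup>2)" using w by simp
    show "AE x in M. (\<lambda>n. (cmod (f x - u n x))\<^sup>2) \<longlonglongrightarrow> 0"
    proof (rule AE_I2)
      fix x assume "x \<in> space M"
      from tendsto_power[OF tendsto_norm[OF tendsto_diff[OF tendsto_const lim[OF this]]], of "f x" 2]
      show "(\<lambda>n. (cmod (f x - u n x))\<^sup>2) \<longlonglongrightarrow> 0" by simp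
    qed
    show "AE x in M. norm ((cmod (f x - u n x))\<^sup>2) \<le> 4 * (w x)\<^sup>2" for n
    proof (rule AE_I2)
      fix x assume x: "x \<in> space M"
      have "cmod (f x - u n x) \<le> 2 * w x"
        using norm_triangle_ineq4[of "f x" "u n x"] fw[OF x] bound[OF x, of n] by linarith
      then have "(cmod (f x - u n x))\<^sup>2 \<le> (2 * w x)\<^sup>2" by (intro power_mono) simp_all
      then show "norm ((cmod (f x - u n x))\<^sup>2) \<le> 4 * (w x)\<^sup>2" by (simp add: power_mult_distrib)
    qed
  qed measurable
  then show "(\<lambda>n. \<integral>x. (cmod (f x - u n x))\<^sup>2 \<partial>M) \<longlonglongrightarrow> 0" by simp
qed

context thoma_lifting
begin

definition approximable :: "(thoma_point \<Rightarrow> complex) \<Rightarrow> bool" where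
  "approximable f \<longleftrightarrow> square_integrable M f \<and>
     (\<forall>\<epsilon>>0. \<exists>F :: complex sym. (\<integral>\<omega>. (cmod (f \<omega> - sym_eval F \<omega>))\<^sup>2 \<partial>M) < \<epsilon>)"

lemma approximable_sym_eval: "approximable (sym_eval F)"
  unfolding approximable_def
  by (auto intro!: square_integrable_sym_eval exI[of _ F])

lemma approximable_closed:
  assumes f: "square_integrable M f"
    and "\<And>\<epsilon>. \<epsilon> > 0 \<Longrightarrow> \<exists>g. approximable g \<and> (\<integral>\<omega>. (cmod (f \<omega> - g \<omega>))\<^sup>2 \<partial>M) < \<epsilon>"
  shows "approximable f"
  unfolding approximable_def
proof (intro conjI f allI impI)
  fix \<epsilon> :: real assume "\<epsilon> > 0"
  then obtain g where g: "approximable g" "(\<integral>\<omega>. (cmod (f \<omega> - g \<omega>))\<^sup>2 \<partial>M) < \<epsilon> / 4"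
    using assms(2)[of "\<epsilon> / 4"] by auto
  then obtain F :: "complex sym" where F: "(\<integral>\<omega>. (cmod (g \<omega> - sym_eval F \<omega>))\<^sup>2 \<partial>M) < \<epsilon> / 4"
    using \<open>\<epsilon> > 0\<close> unfolding approximable_def by (meson divide_pos_pos zero_less_numeral)
  have "(\<integral>\<omega>. (cmod (f \<omega> - sym_eval F \<omega>))\<^sup>2 \<partial>M) < \<epsilon>"
    using integral_square_triangle[OF f _ square_integrable_sym_eval, of g F] g F
    by (simp add: approximable_def)
  then show "\<exists>F :: complex sym. (\<integral>\<omega>. (cmod (f \<omega> - sym_eval F \<omega>))\<^sup>2 \<partial>M) < \<epsilon>" by blast
qed

lemma approximable_dominated:
  assumes "f \<in> borel_measurable M" "\<And>n. approximable (u n)" "integrable M (\<lambda>x. (w x)\<^sup>2)"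
    and "\<And>x. x \<in> thoma_cone \<Longrightarrow> (\<lambda>n. u n x) \<longlonglongrightarrow> f x"
    and "\<And>n x. x \<in> thoma_cone \<Longrightarrow> cmod (u n x) \<le> w x"
  shows "approximable f"
proof -
  have u: "u n \<in> borel_measurable M" for n
    using assms(2)[of n] by (simp add: approximable_def square_integrable_def)
  note dom = integral_square_dominated[OF assms(1) u assms(3) assms(4,5)[folded space_M]]
  show ?thesis
  proof (rule approximable_closed[OF dom(1)])
    fix \<epsilon> :: real assume "\<epsilon> > 0"
    from order_tendstoD(2)[OF dom(2) this]
    obtain n where "(\<integral>x. (cmod (f x - u n x))\<^sup>2 \<partial>M) < \<epsilon>"
      by (auto simp: eventually_sequentially)
    then show "\<exists>g. approximable g \<and> (\<integral>\<omega>. (cmod (f \<omega> - g \<omega>))\<^sup>2 \<partial>M) < \<epsilon>"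
      using assms(2) by blast
  qed
qed

lemma approximable_add:
  assumes "approximable f" "approximable g"
  shows "approximable (\<lambda>\<omega>. f \<omega> + g \<omega>)"
  unfolding approximable_def
proof (intro conjI allI impI)
  have f: "square_integrable M f" and g: "square_integrable M g"
    using assms by (simp_all add: approximable_def)
  show fg: "square_integrable M (\<lambda>\<omega>. f \<omega> + g \<omega>)"
    by (rule square_integrable_add[OF f g])
  fix \<epsilon> :: real assume "\<epsilon> > 0"
  then have "\<epsilon> / 4 > 0" by simp
  then obtain F G :: "complex sym" where FG: "(\<integral>\<omega>. (cmod (f \<omega> - sym_eval F \<omega>))\<^sup>2 \<partial>M) < \<epsilon> / 4"
    "(\<integral>\<omega>. (cmod (g \<omega> - sym_eval G \<omega>))\<^sup>2 \<partial>M) < \<epsilon> / 4"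
    using assms unfolding approximable_def by meson
  have "(\<integral>\<omega>. (cmod (f \<omega> + g \<omega> - sym_eval (F + G) \<omega>))\<^sup>2 \<partial>M) \<le>
      2 * (\<integral>\<omega>. (cmod (f \<omega> + g \<omega> - (sym_eval F \<omega> + g \<omega>)))\<^sup>2 \<partial>M) +
      2 * (\<integral>\<omega>. (cmod (sym_eval F \<omega> + g \<omega> - sym_eval (F + G) \<omega>))\<^sup>2 \<partial>M)"
    by (rule integral_square_triangle[OF fg square_integrable_add[OF square_integrable_sym_eval g]
          square_integrable_sym_eval])
  also have "\<dots> = 2 * (\<integral>\<omega>. (cmod (f \<omega> - sym_eval F \<omega>))\<^sup>2 \<partial>M) + 2 * (\<integral>\<omega>. (cmod (g \<omega> - sym_eval G \<omega>))\<^sup>2 \<partial>M)"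
    by (simp add: sym_eval_add)
  finally show "\<exists>F :: complex sym. (\<integral>\<omega>. (cmod (f \<omega> + g \<omega> - sym_eval F \<omega>))\<^sup>2 \<partial>M) < \<epsilon>"
    using FG by (intro exI[of _ "F + G"]) simp
qed

text \<open>Multiplication by a bounded function is continuous in L2, so it preserves the closure as
  soon as it maps symmetric functions into it.\<close>

lemma approximable_bounded_mult:
  assumes h: "h \<in> borel_measurable M" "\<And>\<omega>. \<omega> \<in> thoma_cone \<Longrightarrow> cmod (h \<omega>) \<le> C"
    and sym: "\<And>F. approximable (\<lambda>\<omega>. h \<omega> * sym_eval F \<omega>)" and f: "approximable f"
  shows "approximable (\<lambda>\<omega>. h \<omega> * f \<omega>)"
proof (rule approximable_closed)
  have sq: "square_integrable M f" using f by (simp add: approximable_def)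
  show "square_integrable M (\<lambda>\<omega>. h \<omega> * f \<omega>)"
    by (rule square_integrable_bounded_mult[OF sq h(1), of C]) (simp add: h(2) space_M)
  fix \<epsilon> :: real assume "\<epsilon> > 0"
  \<comment> \<open>The summand 1 keeps the divisor positive even when C = 0.\<close>
  define K where "K = C\<^sup>2 + 1"
  have K: "K > 0" "C\<^sup>2 \<le> K" unfolding K_def by (simp_all add: add_nonneg_pos)
  then obtain F :: "complex sym" where F: "(\<integral>\<omega>. (cmod (f \<omega> - sym_eval F \<omega>))\<^sup>2 \<partial>M) < \<epsilon> / K"
    using f \<open>\<epsilon> > 0\<close> unfolding approximable_def by (meson divide_pos_pos)
  have int: "integrable M (\<lambda>\<omega>. (cmod (f \<omega> - sym_eval F \<omega>))\<^sup>2)"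
    using square_integrable_diff[OF sq square_integrable_sym_eval] by (simp add: square_integrable_def)
  have "(\<integral>\<omega>. (cmod (h \<omega> * f \<omega> - h \<omega> * sym_eval F \<omega>))\<^sup>2 \<partial>M) \<le> (\<integral>\<omega>. K * (cmod (f \<omega> - sym_eval F \<omega>))\<^sup>2 \<partial>M)"
  proof (rule integral_mono)
    have "square_integrable M (\<lambda>\<omega>. h \<omega> * (f \<omega> - sym_eval F \<omega>))"
      by (rule square_integrable_bounded_mult[OF square_integrable_diff[OF sq square_integrable_sym_eval] h(1), of C])
        (simp add: h(2) space_M)
    then show "integrable M (\<lambda>\<omega>. (cmod (h \<omega> * f \<omega> - h \<omega> * sym_eval F \<omega>))\<^sup>2)"
      by (simp add: square_integrable_def right_diff_distrib)
    show "integrable M (\<lambda>\<omega>. K * (cmod (f \<omega> - sym_eval F \<omega>))\<^sup>2)" using int by simp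
    fix \<omega> assume "\<omega> \<in> space M"
    then have "(cmod (h \<omega>))\<^sup>2 \<le> K"
      using power_mono[OF h(2) norm_ge_zero, of \<omega> 2] K(2) by (simp add: space_M)
    then show "(cmod (h \<omega> * f \<omega> - h \<omega> * sym_eval F \<omega>))\<^sup>2 \<le> K * (cmod (f \<omega> - sym_eval F \<omega>))\<^sup>2"
      by (simp add: right_diff_distrib[symmetric] norm_mult power_mult_distrib mult_right_mono)
  qed
  also have "\<dots> = K * (\<integral>\<omega>. (cmod (f \<omega> - sym_eval F \<omega>))\<^sup>2 \<partial>M)" by simp
  also have "\<dots> < \<epsilon>" using F K(1) by (simp add: field_simps)
  finally show "\<exists>g. approximable g \<and> (\<integral>\<omega>. (cmod (h \<omega> * f \<omega> - g \<omega>))\<^sup>2 \<partial>M) < \<epsilon>"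
    using sym by blast
qed

lemma approximable_scale:
  assumes "approximable f"
  shows "approximable (\<lambda>\<omega>. a * f \<omega>)"
proof (rule approximable_bounded_mult[of "\<lambda>_. a" "cmod a", OF _ _ _ assms])
  show "approximable (\<lambda>\<omega>. a * sym_eval F \<omega>)" for F
    using approximable_sym_eval[of "sym_const a * F"] by (simp only: sym_eval_const_times[abs_def])
qed simp_all

text \<open>Bounded multipliers of the \<open>L\<^sup>2\<close>-closure of the symmetric functions form an algebra closed
  under bounded pointwise limits; the sets with multiplier indicator are a \<open>\<sigma>\<close>-algebra.\<close>

definition multiplier :: "(thoma_point \<Rightarrow> real) \<Rightarrow> bool" where
  "multiplier h \<longleftrightarrow> h \<in> borel_measurable M \<and> (\<exists>C. \<forall>\<omega>\<in>thoma_cone. \<bar>h \<omega>\<bar> \<le> C) \<and>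
     (\<forall>f. approximable f \<longrightarrow> approximable (\<lambda>\<omega>. of_real (h \<omega>) * f \<omega>))"

lemma multiplierI:
  assumes "h \<in> borel_measurable M" "\<And>\<omega>. \<omega> \<in> thoma_cone \<Longrightarrow> \<bar>h \<omega>\<bar> \<le> C"
    and "\<And>F. approximable (\<lambda>\<omega>. of_real (h \<omega>) * sym_eval F \<omega>)"
  shows "multiplier h"
  unfolding multiplier_def
proof (intro conjI allI impI)
  fix f assume f: "approximable f"
  show "approximable (\<lambda>\<omega>. of_real (h \<omega>) * f \<omega>)"
    by (rule approximable_bounded_mult[where C = C, OF _ _ assms(3) f]) (use assms(1,2) in simp_all)
qed (use assms(1,2) in blast)+

lemma multiplier_const: "multiplier (\<lambda>_. a)"
  unfolding multiplier_def by (auto intro: approximable_scale)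

lemma multiplier_add:
  assumes "multiplier g" "multiplier h"
  shows "multiplier (\<lambda>\<omega>. g \<omega> + h \<omega>)"
proof -
  obtain C C' where "\<forall>\<omega>\<in>thoma_cone. \<bar>g \<omega>\<bar> \<le> C" "\<forall>\<omega>\<in>thoma_cone. \<bar>h \<omega>\<bar> \<le> C'"
    using assms unfolding multiplier_def by blast
  then have "\<forall>\<omega>\<in>thoma_cone. \<bar>g \<omega> + h \<omega>\<bar> \<le> C + C'"
    by (meson abs_triangle_ineq add_mono order_trans)
  then show ?thesis
    using assms approximable_add unfolding multiplier_def
    by (auto simp: distrib_right intro!: exI[of _ "C + C'"])
qed

lemma multiplier_mult:
  assumes "multiplier g" "multiplier h"
  shows "multiplier (\<lambda>\<omega>. g \<omega> * h \<omega>)"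
proof -
  obtain C C' where "\<forall>\<omega>\<in>thoma_cone. \<bar>g \<omega>\<bar> \<le> C" "\<forall>\<omega>\<in>thoma_cone. \<bar>h \<omega>\<bar> \<le> C'"
    using assms unfolding multiplier_def by blast
  then have "\<forall>\<omega>\<in>thoma_cone. \<bar>g \<omega> * h \<omega>\<bar> \<le> C * C'"
    by (auto simp: abs_mult intro!: mult_mono elim!: order_trans[OF abs_ge_zero, rotated] dest: bspec)
  then show ?thesis
    using assms unfolding multiplier_def
    by (auto simp: mult.assoc intro!: exI[of _ "C * C'"])
qed

lemma multiplier_lim:
  assumes u: "\<And>n. multiplier (u n)" and C: "\<And>n \<omega>. \<omega> \<in> thoma_cone \<Longrightarrow> \<bar>u n \<omega>\<bar> \<le> C"
    and lim: "\<And>\<omega>. \<omega> \<in> thoma_cone \<Longrightarrow> (\<lambda>n. u n \<omega>) \<longlonglongrightarrow> h \<omega>"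
  shows "multiplier h"
proof (rule multiplierI)
  show h: "h \<in> borel_measurable M"
    by (rule borel_measurable_LIMSEQ_real[of M u]) (use u lim in \<open>auto simp: multiplier_def space_M\<close>)
  show "\<bar>h \<omega>\<bar> \<le> C" if "\<omega> \<in> thoma_cone" for \<omega>
    using tendsto_rabs[OF lim[OF that]] C[OF that] by (intro LIMSEQ_le_const2) auto
  fix F :: "complex sym"
  show "approximable (\<lambda>\<omega>. of_real (h \<omega>) * sym_eval F \<omega>)"
  proof (rule approximable_dominated)
    show "(\<lambda>\<omega>. of_real (h \<omega>) * sym_eval F \<omega>) \<in> borel_measurable M"
      using h measurable_M[OF measurable_sym_eval[of F]] by simp
    show "approximable (\<lambda>\<omega>. of_real (u n \<omega>) * sym_eval F \<omega>)" for n
      using u[of n] approximable_sym_eval[of F] by (simp add: multiplier_def)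
    show "integrable M (\<lambda>\<omega>. (C * cmod (sym_eval F \<omega>))\<^sup>2)"
      using square_integrable_sym_eval[of F] by (simp add: square_integrable_def power_mult_distrib)
    fix \<omega> assume \<omega>: "\<omega> \<in> thoma_cone"
    show "(\<lambda>n. of_real (u n \<omega>) * sym_eval F \<omega>) \<longlonglongrightarrow> of_real (h \<omega>) * sym_eval F \<omega>"
      by (intro tendsto_mult tendsto_of_real lim[OF \<omega>] tendsto_const)
    show "cmod (of_real (u n \<omega>) * sym_eval F \<omega>) \<le> C * cmod (sym_eval F \<omega>)" for n
      using C[OF \<omega>, of n] by (simp add: norm_mult mult_right_mono)
  qed
qed

lemma multiplier_power: "multiplier h \<Longrightarrow> multiplier (\<lambda>\<omega>. h \<omega> ^ n)"
  by (induction n) (simp_all add: multiplier_const multiplier_mult)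

lemma multiplier_sum:
  "(\<And>i. i \<in> A \<Longrightarrow> multiplier (f i)) \<Longrightarrow> multiplier (\<lambda>\<omega>. \<Sum>i\<in>A. f i \<omega>)"
  by (induction A rule: infinite_finite_induct) (simp_all add: multiplier_const multiplier_add)

end

section \<open>Weierstrass approximation and truncated sums\<close>

lemma polynomial_approximation:
  fixes g :: "real \<Rightarrow> real"
  assumes "continuous_on UNIV g"
  obtains a N where "\<And>n x. \<bar>x\<bar> \<le> C \<Longrightarrow> \<bar>g x - (\<Sum>i\<le>N n. a n i * x ^ i)\<bar> < 1 / real (Suc n)"
proof -
  have "\<exists>a N. \<forall>x. \<bar>x\<bar> \<le> C \<longrightarrow> \<bar>g x - (\<Sum>i\<le>N. a i * x ^ i)\<bar> < 1 / real (Suc n)" for n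
  proof -
    obtain p where p: "real_polynomial_function p" "\<And>x. x \<in> {- C..C} \<Longrightarrow> \<bar>g x - p x\<bar> < 1 / real (Suc n)"
      using Stone_Weierstrass_real_polynomial_function[of "{- C..C}" g "1 / real (Suc n)"]
        continuous_on_subset[OF assms subset_UNIV] by auto
    then obtain a N where "p = (\<lambda>x. \<Sum>i\<le>N. a i * x ^ i)"
      by (auto simp: real_polynomial_function_iff_sum)
    then show ?thesis using p(2) by (intro exI[of _ a] exI[of _ N]) (auto simp: abs_le_iff)
  qed
  then show ?thesis using that by metis
qed

lemma summable_square_bounded:
  fixes x :: "nat \<Rightarrow> real"
  assumes x: "\<And>j. \<bar>x j\<bar> \<le> 1" "summable (\<lambda>j. (x j)\<^sup>2)" and q: "\<And>y. \<bar>y\<bar> \<le> 1 \<Longrightarrow> \<bar>q y\<bar> \<le> K"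
  shows "summable (\<lambda>j. (x j)\<^sup>2 * q (x j))"
proof (rule summable_comparison_test')
  show "summable (\<lambda>j. (x j)\<^sup>2 * K)" using x(2) by (rule summable_mult2)
  show "norm ((x j)\<^sup>2 * q (x j)) \<le> (x j)\<^sup>2 * K" if "j \<ge> 0" for j
    using q[OF x(1)[of j]] by (simp add: abs_mult mult_left_mono)
qed

lemma continuous_bounded:
  fixes \<phi> :: "real \<Rightarrow> real"
  assumes "continuous_on UNIV \<phi>"
  obtains B where "\<And>x. \<bar>x\<bar> \<le> C \<Longrightarrow> \<bar>\<phi> x\<bar> \<le> B"
proof -
  have "compact (\<phi> ` {- C..C})"
    by (intro compact_continuous_image continuous_on_subset[OF assms]) simp_all
  then obtain B where "\<forall>y\<in>\<phi> ` {- C..C}. \<bar>y\<bar> \<le> B"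
    using compact_imp_bounded[of "\<phi> ` {- C..C}"] unfolding bounded_iff real_norm_def by blast
  then show ?thesis by (intro that[of B]) (simp add: abs_le_iff)
qed

text \<open>The weights x_j^2 are summable, so a uniform error on [-1, 1] is multiplied by a finite
  total mass.\<close>

lemma polynomial_moment_limit:
  fixes g :: "real \<Rightarrow> real" and x :: "nat \<Rightarrow> real"
  assumes p: "\<And>n y. \<bar>y\<bar> \<le> 1 \<Longrightarrow> \<bar>g y - p n y\<bar> < 1 / real (Suc n)"
    and g: "\<And>y. \<bar>y\<bar> \<le> 1 \<Longrightarrow> \<bar>g y\<bar> \<le> B"
    and x: "\<And>j. \<bar>x j\<bar> \<le> 1" "summable (\<lambda>j. (x j)\<^sup>2)"
  shows "(\<lambda>n. suminf (\<lambda>j. (x j)\<^sup>2 * p n (x j))) \<longlonglongrightarrow> suminf (\<lambda>j. (x j)\<^sup>2 * g (x j))"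
proof -
  have pB: "\<bar>p n y\<bar> \<le> B + 1" if "\<bar>y\<bar> \<le> 1" for n y
  proof -
    have "1 / real (Suc n) \<le> 1" by simp
    then show ?thesis using p[OF that, of n] g[OF that] by linarith
  qed
  have sp: "summable (\<lambda>j. (x j)\<^sup>2 * p n (x j))" for n by (rule summable_square_bounded[OF x pB])
  have sg: "summable (\<lambda>j. (x j)\<^sup>2 * g (x j))" by (rule summable_square_bounded[OF x g])
  have bound: "\<bar>suminf (\<lambda>j. (x j)\<^sup>2 * p n (x j)) - suminf (\<lambda>j. (x j)\<^sup>2 * g (x j))\<bar> \<le> suminf (\<lambda>j. (x j)\<^sup>2) * inverse (real (Suc n))" for n
  proof -
    have le: "norm ((x j)\<^sup>2 * p n (x j) - (x j)\<^sup>2 * g (x j)) \<le> (x j)\<^sup>2 * inverse (real (Suc n))" for j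
    proof -
      have "\<bar>p n (x j) - g (x j)\<bar> \<le> inverse (real (Suc n))"
        using p[OF x(1), of j n] by (simp only: abs_minus_commute inverse_eq_divide less_imp_le)
      then show ?thesis
        unfolding right_diff_distrib[symmetric] real_norm_def abs_mult abs_power2 by (rule mult_left_mono) simp
    qed
    have "\<bar>suminf (\<lambda>j. (x j)\<^sup>2 * p n (x j)) - suminf (\<lambda>j. (x j)\<^sup>2 * g (x j))\<bar> =
        norm (suminf (\<lambda>j. (x j)\<^sup>2 * p n (x j) - (x j)\<^sup>2 * g (x j)))"
      by (simp add: suminf_diff[OF sp sg])
    also have "\<dots> \<le> suminf (\<lambda>j. (x j)\<^sup>2 * inverse (real (Suc n)))"
      by (rule norm_suminf_le[OF le summable_mult2[OF x(2)]])
    also have "\<dots> = suminf (\<lambda>j. (x j)\<^sup>2) * inverse (real (Suc n))"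
      by (rule suminf_mult2[OF x(2), symmetric])
    finally show ?thesis .
  qed
  have lim: "(\<lambda>n. suminf (\<lambda>j. (x j)\<^sup>2) * inverse (real (Suc n))) \<longlonglongrightarrow> 0"
    by (rule tendsto_mult_right_zero[OF LIMSEQ_inverse_real_of_nat])
  have "(\<lambda>n. suminf (\<lambda>j. (x j)\<^sup>2 * p n (x j)) - suminf (\<lambda>j. (x j)\<^sup>2 * g (x j))) \<longlonglongrightarrow> 0"
    by (rule Lim_null_comparison[OF always_eventually[OF allI] lim]) (simp only: real_norm_def bound)
  then show ?thesis by (rule LIM_zero_cancel)
qed

text \<open>For a nonincreasing sequence, \<open>x\<^sub>i > t\<close> iff the sum of \<open>(x\<^sub>j - t)\<^sub>+\<close> over \<open>j \<ge> i\<close> is positive.\<close>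

lemma measurable_from_truncated_sums:
  fixes x :: "nat \<Rightarrow> 'x \<Rightarrow> real"
  assumes x: "\<And>\<omega>. \<omega> \<in> space N \<Longrightarrow> decseq (\<lambda>j. x j \<omega>)" "\<And>\<omega> j. \<omega> \<in> space N \<Longrightarrow> 0 \<le> x j \<omega>"
      "\<And>\<omega>. \<omega> \<in> space N \<Longrightarrow> summable (\<lambda>j. x j \<omega>)"
    and meas: "\<And>t. t > 0 \<Longrightarrow> (\<lambda>\<omega>. suminf (\<lambda>j. max 0 (x j \<omega> - t))) \<in> borel_measurable N"
  shows "x i \<in> borel_measurable N"
proof (induction i rule: less_induct)
  case (less i)
  have pos: "{\<omega> \<in> space N. t < x i \<omega>} \<in> sets N" if t: "t > 0" for t
  proof -
    \<comment> \<open>The coordinates below i are measurable by induction, so their share of the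
      truncated sum can be subtracted.\<close>
    let ?T = "\<lambda>\<omega>. suminf (\<lambda>j. max 0 (x j \<omega> - t)) - (\<Sum>j<i. max 0 (x j \<omega> - t))"
    have [measurable]: "x j \<in> borel_measurable N" if "j < i" for j by (rule less[OF that])
    have "(\<lambda>\<omega>. max 0 (x j \<omega> - t)) \<in> borel_measurable N" if "j < i" for j
      using less[OF that] by (intro borel_measurable_max borel_measurable_diff) simp_all
    then have T: "?T \<in> borel_measurable N"
      using meas[OF t] by (intro borel_measurable_diff borel_measurable_sum) simp_all
    have "0 < ?T \<omega> \<longleftrightarrow> t < x i \<omega>" if \<omega>: "\<omega> \<in> space N" for \<omega>
    proof -
      have sm: "summable (\<lambda>j. max 0 (x j \<omega> - t))"
        by (rule summable_comparison_test'[OF x(3)[OF \<omega>], of 0]) (use x(2)[OF \<omega>] t in auto)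
      have sm': "summable (\<lambda>j. max 0 (x (j + i) \<omega> - t))"
        using sm by (subst summable_iff_shift)
      have T_eq: "?T \<omega> = suminf (\<lambda>j. max 0 (x (j + i) \<omega> - t))"
        using suminf_split_initial_segment[OF sm, of i] by simp
      show ?thesis
      proof
        assume "t < x i \<omega>"
        then have "0 < (\<Sum>j\<in>{0}. max 0 (x (j + i) \<omega> - t))" by simp
        also have "\<dots> \<le> suminf (\<lambda>j. max 0 (x (j + i) \<omega> - t))"
          by (rule sum_le_suminf[OF sm']) simp_all
        finally show "0 < ?T \<omega>" by (simp only: T_eq)
      next
        assume *: "0 < ?T \<omega>"
        show "t < x i \<omega>"
        proof (rule ccontr)
          assume "\<not> t < x i \<omega>"
          moreover have "x (j + i) \<omega> \<le> x i \<omega>" for j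
            using decseqD[OF x(1)[OF \<omega>], of i "j + i"] by simp
          ultimately have "x (j + i) \<omega> \<le> t" for j by (meson not_less order_trans)
          then have "(\<lambda>j. max 0 (x (j + i) \<omega> - t)) = (\<lambda>_. 0)" by auto
          then show False using * unfolding T_eq by simp
        qed
      qed
    qed
    then have "{\<omega> \<in> space N. t < x i \<omega>} = {\<omega> \<in> space N. 0 < ?T \<omega>}" by blast
    also have "\<dots> \<in> sets N" using T unfolding borel_measurable_iff_greater by blast
    finally show ?thesis .
  qed
  show ?case
    unfolding borel_measurable_iff_greater
  proof
    fix t :: real
    consider "t > 0" | "t = 0" | "t < 0" by linarith
    then show "{\<omega> \<in> space N. t < x i \<omega>} \<in> sets N"
    proof cases
      case 2
      \<comment> \<open>The truncated sums are only available for positive t; the level 0 is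
        exhausted by the levels 1 / (n + 1).\<close>
      have "{\<omega> \<in> space N. t < x i \<omega>} = (\<Union>n. {\<omega> \<in> space N. inverse (real (Suc n)) < x i \<omega>})"
      proof (intro equalityI subsetI)
        fix \<omega> assume "\<omega> \<in> {\<omega> \<in> space N. t < x i \<omega>}"
        then show "\<omega> \<in> (\<Union>n. {\<omega> \<in> space N. inverse (real (Suc n)) < x i \<omega>})"
          using reals_Archimedean[of "x i \<omega>"] 2 by auto
      next
        fix \<omega> assume "\<omega> \<in> (\<Union>n. {\<omega> \<in> space N. inverse (real (Suc n)) < x i \<omega>})"
        then obtain n where n: "\<omega> \<in> space N" "inverse (real (Suc n)) < x i \<omega>" by auto
        have "0 < inverse (real (Suc n))" by simp
        then have "t < x i \<omega>" using n(2) 2 by linarith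
        then show "\<omega> \<in> {\<omega> \<in> space N. t < x i \<omega>}" using n(1) by simp
      qed
      also have "\<dots> \<in> sets N" by (intro sets.countable_UN) (auto intro!: pos)
      finally show ?thesis .
    next
      case 3
      then have "{\<omega> \<in> space N. t < x i \<omega>} = space N" using x(2) by (auto intro: less_le_trans)
      then show ?thesis by simp
    qed (rule pos)
  qed
qed

section \<open>Exponential moments and the algebra of multipliers\<close>

context thoma_lifting
begin

text \<open>Against the density, exp(r/2) leaves exp(- r/2), a Gamma integrand of rate 1/2. The
  known absolute integrability is for complex exponents, so norms are taken before passing from
  Lebesgue to Borel measure.\<close>

lemma integrable_gamma_exp: "integrable \<gamma> (\<lambda>r. exp (r / 2) * r ^ n)"
proof -
  let ?g = "\<lambda>t. indicator {0<..} t * (t powr (c + n - 1) * exp (- (t / 2)))"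
  have "(\<lambda>t. complex_of_real t powr (complex_of_real (c + n) - 1) / of_real (exp (1 / 2 * t)))
      absolutely_integrable_on {0<..}"
    by (rule absolutely_integrable_Gamma_integral) (use c_pos in simp_all)
  then have "integrable lebesgue (\<lambda>t. norm (indicator {0<..} t *\<^sub>R
      (complex_of_real t powr (complex_of_real (c + n) - 1) / of_real (exp (1 / 2 * t)))))"
    unfolding set_integrable_def by (rule integrable_norm)
  also have "(\<lambda>t. norm (indicator {0<..} t *\<^sub>R
      (complex_of_real t powr (complex_of_real (c + n) - 1) / of_real (exp (1 / 2 * t))))) = ?g"
  proof
    fix t :: real
    show "norm (indicator {0<..} t *\<^sub>R
      (complex_of_real t powr (complex_of_real (c + n) - 1) / of_real (exp (1 / 2 * t)))) = ?g t"
    proof (cases "t > 0")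
      case True
      have "complex_of_real t powr (complex_of_real (c + n) - 1) = of_real (t powr (c + n - 1))"
        using powr_of_real[of t "c + n - 1"] True by (simp only: of_real_diff of_real_1 less_imp_le)
      moreover have "a / exp (1 / 2 * t) = a * exp (- (t / 2))" for a
        using exp_minus[of "t / 2"] by (simp only: divide_inverse mult.commute mult_1_left)
      ultimately show ?thesis
        using True by (simp only: norm_divide norm_scaleR norm_of_real abs_exp_cancel
            indicator_simps greaterThan_iff abs_one mult_1_left powr_ge_zero abs_of_nonneg)
    qed simp
  qed
  finally have "integrable lborel ?g"
    by (subst (asm) integrable_completion) simp_all
  then have g: "integrable lborel (\<lambda>t. ?g t / Gamma c)" by simp
  have dens: "(\<lambda>r. r powr (c - 1) * exp (- r) / Gamma c) \<in> borel_measurable (restrict_space lborel {0<..})"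
    by (rule measurable_restrict_space1) simp
  have "integrable \<gamma> (\<lambda>r. exp (r / 2) * r ^ n) \<longleftrightarrow>
      integrable (restrict_space lborel {0<..}) (\<lambda>r. (r powr (c - 1) * exp (- r) / Gamma c) *\<^sub>R (exp (r / 2) * r ^ n))"
    unfolding gamma_distr_def
    by (rule integrable_density[OF _ dens])
      (use Gamma_real_pos[OF c_pos] in \<open>auto intro!: measurable_restrict_space1\<close>)
  also have "\<dots> \<longleftrightarrow> integrable lborel (\<lambda>r. indicator {0<..} r *\<^sub>R
      ((r powr (c - 1) * exp (- r) / Gamma c) *\<^sub>R (exp (r / 2) * r ^ n)))"
    by (rule integrable_restrict_space) simp
  also have "(\<lambda>r. indicator {0<..} r *\<^sub>R
      ((r powr (c - 1) * exp (- r) / Gamma c) *\<^sub>R (exp (r / 2) * r ^ n))) = (\<lambda>t. ?g t / Gamma c)"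
  proof
    fix r :: real
    show "indicator {0<..} r *\<^sub>R ((r powr (c - 1) * exp (- r) / Gamma c) *\<^sub>R (exp (r / 2) * r ^ n)) = ?g r / Gamma c"
    proof (cases "r > 0")
      case True
      then have "r powr (c + n - 1) = r powr (c - 1) * r ^ n"
        by (simp add: powr_realpow[symmetric] powr_add[symmetric] algebra_simps)
      moreover have "exp (- r) * exp (r / 2) = exp (- (r / 2))"
        by (simp add: exp_add[symmetric])
      ultimately show ?thesis using True by simp
    qed simp
  qed
  finally show ?thesis using g by simp
qed

lemma integrable_exp_radius: "integrable M (\<lambda>\<omega>. exp (snd (snd \<omega>) / 2) * snd (snd \<omega>) ^ n)"
proof -
  have "integrable (P \<Otimes>\<^sub>M \<gamma>) (\<lambda>x. exp (snd x / 2) * snd x ^ n)"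
  proof (rule P\<gamma>.Fubini_integrable)
    show "(\<lambda>x. exp (snd x / 2) * snd x ^ n) \<in> borel_measurable (P \<Otimes>\<^sub>M \<gamma>)"
      by (rule measurable_compose[OF measurable_snd measurable_gamma_distr]) simp
    show "AE x in P. integrable \<gamma> (\<lambda>y. exp (snd (x, y) / 2) * snd (x, y) ^ n)"
      using integrable_gamma_exp by simp
  qed simp
  moreover have "(\<lambda>\<omega>. exp (snd (snd \<omega>) / 2) * snd (snd \<omega>) ^ n) \<in> borel_measurable (restrict_space borel thoma_cone)"
    by (intro measurable_restrict_space1 measurable_compose[OF measurable_radius]) simp
  ultimately show ?thesis
    unfolding lifting_eq
    by (subst integrable_distr_eq[OF measurable_cone_map]) (auto simp: cone_map_def)
qed

lemma radius_nonneg: "\<omega> \<in> thoma_cone \<Longrightarrow> 0 \<le> snd (snd \<omega>)"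
  by (auto simp: thoma_cone_def)

lemma sym_eval_power: "sym_eval (F ^ n) \<omega> = (sym_eval F \<omega> :: complex) ^ n"
  by (induction n) (simp_all add: sym_eval_mult)

lemma exp_sums: "(\<lambda>k. x ^ k / fact k) sums exp (x :: real)"
  using exp_converges[of x] by (simp add: divide_inverse mult.commute)

lemma exp_partial_sum_le:
  assumes "x \<ge> (0 :: real)"
  shows "(\<Sum>k<n. x ^ k / fact k) \<le> exp x"
proof -
  note s = exp_sums[of x]
  show ?thesis
    unfolding sums_unique[OF s] using sums_summable[OF s] assms by (intro sum_le_suminf) simp_all
qed

text \<open>The Taylor polynomials of exp(- r/4) are symmetric functions, as r is p_1. Their
  products with F are dominated by exp(r/4) |F|, whose square contains exp(r/2) and is integrable; a
  rate below 1/2 is what the decay exp(- r) allows.\<close>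

lemma multiplier_exp_radius: "multiplier (\<lambda>\<omega>. exp (- (snd (snd \<omega>) / 4)))"
proof (rule multiplierI[where C = 1])
  have r: "(\<lambda>\<omega>. snd (snd \<omega>)) \<in> borel_measurable M" by (rule measurable_M[OF measurable_radius])
  show E: "(\<lambda>\<omega>. exp (- (snd (snd \<omega>) / 4))) \<in> borel_measurable M" using r by simp
  show "\<bar>exp (- (snd (snd \<omega>) / 4))\<bar> \<le> 1" if "\<omega> \<in> thoma_cone" for \<omega>
    using radius_nonneg[OF that] by simp
  fix F :: "complex sym"
  let ?T = "\<lambda>n. (\<Sum>k<n. sym_const ((- 1 / 4) ^ k / fact k) * power_sum (Suc 0) ^ k) :: complex sym"
  have T: "sym_eval (?T n * F) \<omega> = of_real (\<Sum>k<n. (- (snd (snd \<omega>) / 4)) ^ k / fact k) * sym_eval F \<omega>" for n \<omega>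
  proof -
    have "sym_eval (power_sum (Suc 0)) \<omega> = complex_of_real (snd (snd \<omega>))"
      unfolding sym_eval_power_sum by (cases \<omega>) simp
    moreover have "complex_of_real ((- (r / 4)) ^ k / fact k) = (- 1 / 4) ^ k / fact k * of_real r ^ k" for r k
    proof -
      have "(- (r / 4)) ^ k = (- 1 / 4 * r) ^ k" by simp
      also have "\<dots> = (- 1 / 4) ^ k * r ^ k" by (rule power_mult_distrib)
      finally show ?thesis by (simp only: of_real_mult of_real_divide of_real_power of_real_fact) simp
    qed
    ultimately show ?thesis
      unfolding sym_eval_mult[of "sum _ _"] sym_eval_sum sym_eval_const_times sym_eval_power of_real_sum by simp
  qed
  show "approximable (\<lambda>\<omega>. of_real (exp (- (snd (snd \<omega>) / 4))) * sym_eval F \<omega>)"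
  proof (rule approximable_dominated)
    show "(\<lambda>\<omega>. of_real (exp (- (snd (snd \<omega>) / 4))) * sym_eval F \<omega>) \<in> borel_measurable M"
      using E measurable_M[OF measurable_sym_eval[of F]] by simp
    show "approximable (sym_eval (?T n * F))" for n by (rule approximable_sym_eval)
    let ?b = "\<lambda>\<omega>. \<Sum>m\<in>Poly_Mapping.keys (F * F). norm (Poly_Mapping.lookup (F * F) m) *
        (exp (snd (snd \<omega>) / 2) * snd (snd \<omega>) ^ weight m)"
    have sq: "(exp (snd (snd \<omega>) / 4) * cmod (sym_eval F \<omega>))\<^sup>2 = exp (snd (snd \<omega>) / 2) * cmod (sym_eval (F * F) \<omega>)" for \<omega>
      unfolding power_mult_distrib cmod_sym_eval_power2 by (simp flip: exp_double)
    show "integrable M (\<lambda>\<omega>. (exp (snd (snd \<omega>) / 4) * cmod (sym_eval F \<omega>))\<^sup>2)"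
    proof (rule Bochner_Integration.integrable_bound)
      show "integrable M ?b"
        by (intro Bochner_Integration.integrable_sum integrable_mult_right integrable_exp_radius)
      show "(\<lambda>\<omega>. (exp (snd (snd \<omega>) / 4) * cmod (sym_eval F \<omega>))\<^sup>2) \<in> borel_measurable M"
        using r measurable_M[OF measurable_sym_eval[of F]] by simp
      show "AE \<omega> in M. norm ((exp (snd (snd \<omega>) / 4) * cmod (sym_eval F \<omega>))\<^sup>2) \<le> norm (?b \<omega>)"
      proof (rule AE_I2)
        fix \<omega> assume "\<omega> \<in> space M"
        then have "exp (snd (snd \<omega>) / 2) * cmod (sym_eval (F * F) \<omega>) \<le> exp (snd (snd \<omega>) / 2) *
            (\<Sum>m\<in>Poly_Mapping.keys (F * F). norm (Poly_Mapping.lookup (F * F) m) * snd (snd \<omega>) ^ weight m)"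
          by (intro mult_left_mono sym_eval_bound) (simp_all add: space_M)
        also have "\<dots> = ?b \<omega>" by (simp add: sum_distrib_left mult.left_commute)
        finally show "norm ((exp (snd (snd \<omega>) / 4) * cmod (sym_eval F \<omega>))\<^sup>2) \<le> norm (?b \<omega>)"
          unfolding sq by simp
      qed
    qed
    fix \<omega> assume \<omega>: "\<omega> \<in> thoma_cone"
    let ?r = "snd (snd \<omega>)"
    show "(\<lambda>n. sym_eval (?T n * F) \<omega>) \<longlonglongrightarrow> of_real (exp (- (?r / 4))) * sym_eval F \<omega>"
      unfolding T by (intro tendsto_mult tendsto_of_real tendsto_const exp_sums[unfolded sums_def])
    show "cmod (sym_eval (?T n * F) \<omega>) \<le> exp (?r / 4) * cmod (sym_eval F \<omega>)" for n
    proof -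
      have "\<bar>\<Sum>k<n. (- (?r / 4)) ^ k / fact k\<bar> \<le> (\<Sum>k<n. \<bar>(- (?r / 4)) ^ k / fact k\<bar>)" by (rule sum_abs)
      also have "\<dots> = (\<Sum>k<n. (?r / 4) ^ k / fact k)"
        using radius_nonneg[OF \<omega>] by (simp add: power_abs)
      also have "\<dots> \<le> exp (?r / 4)" using radius_nonneg[OF \<omega>] by (intro exp_partial_sum_le) simp
      finally show ?thesis unfolding T norm_mult norm_of_real by (intro mult_right_mono) simp_all
    qed
  qed
qed

text \<open>A multiplier has bounded range, on which a continuous function is a uniform limit of
  polynomials.\<close>

lemma multiplier_comp:
  assumes h: "multiplier h" and \<phi>: "continuous_on UNIV \<phi>"
  shows "multiplier (\<lambda>\<omega>. \<phi> (h \<omega>))"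
proof -
  obtain C where C: "\<And>\<omega>. \<omega> \<in> thoma_cone \<Longrightarrow> \<bar>h \<omega>\<bar> \<le> C"
    using h unfolding multiplier_def by blast
  obtain a N where p: "\<And>n x. \<bar>x\<bar> \<le> C \<Longrightarrow> \<bar>\<phi> x - (\<Sum>i\<le>N n. a n i * x ^ i)\<bar> < 1 / real (Suc n)"
    using polynomial_approximation[OF \<phi>] by blast
  obtain B where B: "\<And>x. \<bar>x\<bar> \<le> C \<Longrightarrow> \<bar>\<phi> x\<bar> \<le> B"
    using continuous_bounded[OF \<phi>] by blast
  let ?u = "\<lambda>n \<omega>. \<Sum>i\<le>N n. a n i * h \<omega> ^ i"
  show ?thesis
  proof (rule multiplier_lim[of ?u "B + 1"])
    show "multiplier (?u n)" for n
      by (intro multiplier_sum multiplier_mult multiplier_const multiplier_power h)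
    fix \<omega> assume \<omega>: "\<omega> \<in> thoma_cone"
    have close: "\<bar>\<phi> (h \<omega>) - ?u n \<omega>\<bar> < 1 / real (Suc n)" for n by (rule p[OF C[OF \<omega>]])
    have "1 / real (Suc n) \<le> 1" for n by simp
    then show "\<bar>?u n \<omega>\<bar> \<le> B + 1" for n using close[of n] B[OF C[OF \<omega>]] by (smt (verit))
    have "(\<lambda>n. \<phi> (h \<omega>) - ?u n \<omega>) \<longlonglongrightarrow> 0"
      by (rule Lim_null_comparison[OF always_eventually LIMSEQ_inverse_real_of_nat])
        (use close in \<open>simp add: inverse_eq_divide less_imp_le del: of_nat_Suc\<close>)
    from tendsto_diff[OF tendsto_const[of "\<phi> (h \<omega>)"] this]
    show "(\<lambda>n. ?u n \<omega>) \<longlonglongrightarrow> \<phi> (h \<omega>)" by simp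
  qed
qed

text \<open>Values off the cone do not matter; the constant sequence in
  \<open>multiplier_lim\<close> expresses this.\<close>

lemma multiplier_cong:
  assumes "multiplier h" "\<And>\<omega>. \<omega> \<in> thoma_cone \<Longrightarrow> h \<omega> = h' \<omega>"
  shows "multiplier h'"
proof -
  obtain C where C: "\<And>\<omega>. \<omega> \<in> thoma_cone \<Longrightarrow> \<bar>h \<omega>\<bar> \<le> C"
    using assms(1) unfolding multiplier_def by blast
  show ?thesis
    by (rule multiplier_lim[of "\<lambda>_. h" C]) (use assms C in simp_all)
qed

text \<open>The indicator is the limit of ramps of slope n starting at t, which are continuous
  functions of h with values in [0, 1].\<close>

lemma multiplier_greater:
  assumes "multiplier h"
  shows "multiplier (indicator {\<omega> \<in> thoma_cone. t < h \<omega>})"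
proof (rule multiplier_lim[of "\<lambda>n \<omega>. max 0 (min 1 (real n * (h \<omega> - t)))" 1])
  show "multiplier (\<lambda>\<omega>. max 0 (min 1 (real n * (h \<omega> - t))))" for n
    by (rule multiplier_comp[OF assms]) (intro continuous_intros)
  fix \<omega> assume \<omega>: "\<omega> \<in> thoma_cone"
  show "\<bar>max 0 (min 1 (real n * (h \<omega> - t)))\<bar> \<le> 1" for n by simp
  show "(\<lambda>n. max 0 (min 1 (real n * (h \<omega> - t)))) \<longlonglongrightarrow> indicator {\<omega> \<in> thoma_cone. t < h \<omega>} \<omega>"
  proof (cases "t < h \<omega>")
    case True
    then obtain n0 where n0: "1 < real n0 * (h \<omega> - t)" using reals_Archimedean3[of "h \<omega> - t"] by auto
    have "max 0 (min 1 (real n * (h \<omega> - t))) = 1" if "n \<ge> n0" for n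
    proof -
      have "real n0 * (h \<omega> - t) \<le> real n * (h \<omega> - t)" using that True by (intro mult_right_mono) simp_all
      then show ?thesis using n0 by simp
    qed
    then have "eventually (\<lambda>n. max 0 (min 1 (real n * (h \<omega> - t))) = 1) sequentially"
      unfolding eventually_sequentially by blast
    then show ?thesis using True \<omega> by (simp add: tendsto_eventually)
  next
    case False
    then have "real n * (h \<omega> - t) \<le> 0" for n by (intro mult_nonneg_nonpos) simp_all
    then have "max 0 (min 1 (real n * (h \<omega> - t))) = 0" for n
      using min.coboundedI2[of "real n * (h \<omega> - t)" 0 1] by (simp only: max_absorb1)
    then show ?thesis using False by simp
  qed
qed

definition multiplier_sets :: "thoma_point set set" where
  "multiplier_sets = {A \<in> sets M. multiplier (indicator A)}"

lemma sigma_algebra_multiplier_sets: "sigma_algebra thoma_cone multiplier_sets"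
  unfolding sigma_algebra_iff2
proof (intro conjI ballI allI impI)
  show "multiplier_sets \<subseteq> Pow thoma_cone"
    using sets.sets_into_space[of _ M] by (auto simp: multiplier_sets_def space_M)
  have "indicator {} = (\<lambda>_ :: thoma_point. 0 :: real)" by auto
  then show "{} \<in> multiplier_sets" by (simp add: multiplier_sets_def multiplier_const)
next
  fix A assume A: "A \<in> multiplier_sets"
  then have "multiplier (\<lambda>\<omega>. 1 + (- 1) * indicator A \<omega>)"
    by (intro multiplier_add multiplier_mult multiplier_const) (simp add: multiplier_sets_def)
  then have "multiplier (indicator (thoma_cone - A))"
    by (rule multiplier_cong) (simp add: indicator_def)
  then show "thoma_cone - A \<in> multiplier_sets"
    using A sets.compl_sets[of A M] by (simp add: multiplier_sets_def space_M)
next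
  fix A :: "nat \<Rightarrow> thoma_point set" assume "range A \<subseteq> multiplier_sets"
  then have A: "A n \<in> sets M" "multiplier (indicator (A n))" for n
    by (auto simp: multiplier_sets_def)
  have fin: "multiplier (indicator (\<Union>i<n. A i))" for n
  proof (induction n)
    case 0
    have "indicator {} = (\<lambda>_ :: thoma_point. 0 :: real)" by auto
    then show ?case by (simp add: multiplier_const)
  next
    case (Suc n)
    let ?U = "\<Union>i<n. A i"
    have "multiplier (\<lambda>\<omega>. (indicator ?U \<omega> + indicator (A n) \<omega>) + (- 1) * (indicator ?U \<omega> * indicator (A n) \<omega>))"
      by (intro multiplier_add multiplier_mult multiplier_const Suc A)
    then show ?case
      by (rule multiplier_cong) (auto simp: indicator_def less_Suc_eq)
  qed
  have "multiplier (indicator (\<Union>i. A i))"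
  proof (rule multiplier_lim[where C = 1])
    show "multiplier (indicator (\<Union>i<n. A i))" for n by (rule fin)
    show "\<bar>indicator (\<Union>i<n. A i) \<omega> :: real\<bar> \<le> 1" for n \<omega> by (simp add: indicator_def)
    show "(\<lambda>n. indicator (\<Union>i<n. A i) \<omega> :: real) \<longlonglongrightarrow> indicator (\<Union>i. A i) \<omega>" for \<omega>
      by (rule LIMSEQ_indicator_UN)
  qed
  then show "(\<Union>i. A i) \<in> multiplier_sets"
    using A(1) by (simp add: multiplier_sets_def sets.countable_UN)
qed

text \<open>Packaged as a measure so that the measurability rules apply to the multiplier
  sets.\<close>

definition N :: "thoma_point measure" where
  "N = sigma thoma_cone multiplier_sets"

lemma space_N: "space N = thoma_cone" and sets_N: "sets N = multiplier_sets"
  unfolding N_def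
  by (rule sigma_algebra.space_measure_of_eq[OF sigma_algebra_multiplier_sets]
    sigma_algebra.sets_measure_of_eq[OF sigma_algebra_multiplier_sets])+

lemma multiplier_measurable_N:
  assumes "multiplier h"
  shows "h \<in> borel_measurable N"
  unfolding borel_measurable_iff_greater
proof
  fix t
  have "h \<in> borel_measurable M" using assms by (simp add: multiplier_def)
  then have "{\<omega> \<in> thoma_cone. t < h \<omega>} \<in> sets M"
    unfolding borel_measurable_iff_greater space_M by blast
  then show "{\<omega> \<in> space N. t < h \<omega>} \<in> sets N"
    using multiplier_greater[OF assms, of t] by (simp add: sets_N space_N multiplier_sets_def)
qed

lemma radius_measurable_N: "(\<lambda>\<omega>. snd (snd \<omega>)) \<in> borel_measurable N"
proof -
  have "(\<lambda>\<omega>. - 4 * ln (exp (- (snd (snd \<omega>) / 4)))) \<in> borel_measurable N"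
    by (intro borel_measurable_times borel_measurable_const borel_measurable_ln
        multiplier_measurable_N[OF multiplier_exp_radius])
  then show ?thesis by simp
qed

text \<open>Power sums are unbounded and must be cut off. On r \<le> n they are bounded by a power
  of n, and the cut-off power sum times F is a multiplier indicator times the symmetric function p_k
  F.\<close>

lemma power_sum_at_measurable_N: "power_sum_at (Suc k) \<in> borel_measurable N"
proof (rule borel_measurable_LIMSEQ_real)
  let ?h = "\<lambda>n \<omega>. power_sum_at (Suc k) \<omega> * indicator {\<omega> \<in> thoma_cone. snd (snd \<omega>) \<le> real n} \<omega>"
  have S: "{\<omega> \<in> thoma_cone. snd (snd \<omega>) \<le> real n} \<in> sets N" for n
    using radius_measurable_N unfolding borel_measurable_iff_le space_N by blast
  then have ind: "multiplier (indicator {\<omega> \<in> thoma_cone. snd (snd \<omega>) \<le> real n})"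
    and SM: "{\<omega> \<in> thoma_cone. snd (snd \<omega>) \<le> real n} \<in> sets M" for n
    by (simp_all add: sets_N multiplier_sets_def)
  have "multiplier (?h n)" for n
  proof (rule multiplierI)
    show "?h n \<in> borel_measurable M"
      using measurable_M[OF measurable_power_sum_at] SM[of n] by simp
    show "\<bar>?h n \<omega>\<bar> \<le> real n ^ Suc k" if "\<omega> \<in> thoma_cone" for \<omega>
    proof (cases "snd (snd \<omega>) \<le> real n")
      case True
      have "\<bar>power_sum_at (Suc k) \<omega>\<bar> \<le> snd (snd \<omega>) ^ Suc k" by (rule power_sum_at_bound[OF that])
      also have "\<dots> \<le> real n ^ Suc k" using True radius_nonneg[OF that] by (intro power_mono)
      finally show ?thesis using True that by simp
    qed simp
    fix F :: "complex sym"
    have "approximable (\<lambda>\<omega>. of_real (indicator {\<omega> \<in> thoma_cone. snd (snd \<omega>) \<le> real n} \<omega>) *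
        sym_eval (power_sum (Suc k) * F) \<omega>)"
      using ind[of n] approximable_sym_eval[of "power_sum (Suc k) * F"] by (simp add: multiplier_def)
    then show "approximable (\<lambda>\<omega>. of_real (?h n \<omega>) * sym_eval F \<omega>)"
      by (simp add: sym_eval_mult sym_eval_power_sum mult.assoc mult.left_commute)
  qed
  then show "?h n \<in> borel_measurable N" for n by (rule multiplier_measurable_N)
  fix \<omega> assume "\<omega> \<in> space N"
  then have \<omega>: "\<omega> \<in> thoma_cone" by (simp add: space_N)
  obtain n0 :: nat where n0: "snd (snd \<omega>) \<le> real n0" using real_arch_simple by blast
  have "?h n \<omega> = power_sum_at (Suc k) \<omega>" if "n \<ge> n0" for n
    using n0 that \<omega> by simp
  then have "eventually (\<lambda>n. ?h n \<omega> = power_sum_at (Suc k) \<omega>) sequentially"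
    unfolding eventually_sequentially by blast
  then show "(\<lambda>n. ?h n \<omega>) \<longlonglongrightarrow> power_sum_at (Suc k) \<omega>" by (rule tendsto_eventually)
qed

end

section \<open>Recovering the Thoma coordinates from the power sums\<close>

lemma suminf_square_polynomial:
  fixes x :: "nat \<Rightarrow> real"
  assumes x: "\<And>j. \<bar>x j\<bar> \<le> 1" "summable (\<lambda>j. (x j)\<^sup>2)"
  shows "suminf (\<lambda>j. (x j)\<^sup>2 * (\<Sum>i\<le>n. a i * x j ^ i)) = (\<Sum>i\<le>n. a i * suminf (\<lambda>j. (x j)\<^sup>2 * x j ^ i))"
proof -
  have "summable (\<lambda>j. (x j)\<^sup>2 * x j ^ i)" for i
    by (rule summable_square_bounded[OF x, where K = 1]) (simp add: power_abs power_le_one)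
  note sums = sums_sum[of "{..n}" "\<lambda>i j. a i * ((x j)\<^sup>2 * x j ^ i)", OF sums_mult[OF summable_sums[OF this]]]
  show ?thesis
    using sums_unique[OF sums] by (simp only: sum_distrib_left mult.left_commute)
qed

lemma cone_coordinates:
  assumes "\<omega> \<in> thoma_cone"
  shows "decseq (fst \<omega>)" "decseq (fst (snd \<omega>))" "0 \<le> fst \<omega> j" "0 \<le> fst (snd \<omega>) j"
    "summable (fst \<omega>)" "summable (fst (snd \<omega>))" "fst \<omega> j \<le> snd (snd \<omega>)" "fst (snd \<omega>) j \<le> snd (snd \<omega>)"
proof -
  obtain \<alpha> \<beta> r where \<omega>: "\<omega> = (\<alpha>, \<beta>, r)" by (rule prod_cases3)
  have c: "decseq \<alpha>" "decseq \<beta>" "\<And>i. 0 \<le> \<alpha> i" "\<And>i. 0 \<le> \<beta> i" "summable \<alpha>" "summable \<beta>" "suminf \<alpha> + suminf \<beta> \<le> r"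
    using assms unfolding \<omega> thoma_cone_def by auto
  have "\<alpha> j \<le> suminf \<alpha>" "\<beta> j \<le> suminf \<beta>"
    using sum_le_suminf[OF c(5), of "{j}"] sum_le_suminf[OF c(6), of "{j}"] c(3,4) by simp_all
  moreover have "0 \<le> suminf \<alpha>" "0 \<le> suminf \<beta>"
    by (rule suminf_nonneg[OF c(5) c(3)]) (rule suminf_nonneg[OF c(6) c(4)])
  ultimately show "decseq (fst \<omega>)" "decseq (fst (snd \<omega>))" "0 \<le> fst \<omega> j" "0 \<le> fst (snd \<omega>) j"
    "summable (fst \<omega>)" "summable (fst (snd \<omega>))" "fst \<omega> j \<le> snd (snd \<omega>)" "fst (snd \<omega>) j \<le> snd (snd \<omega>)"
    using c by (simp_all add: \<omega>)
qed

text \<open>For \<open>r = 0\<close> all normalized coordinates are \<open>0\<close>, as \<open>x / 0 = 0\<close>.\<close>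

definition alpha_fraction :: "nat \<Rightarrow> thoma_point \<Rightarrow> real" where
  "alpha_fraction j \<omega> = fst \<omega> j / snd (snd \<omega>)"

definition beta_fraction :: "nat \<Rightarrow> thoma_point \<Rightarrow> real" where
  "beta_fraction j \<omega> = fst (snd \<omega>) j / snd (snd \<omega>)"

lemma unit_sequence_summable_squares:
  fixes x :: "nat \<Rightarrow> real"
  assumes "\<And>j. 0 \<le> x j" "\<And>j. x j \<le> 1" "summable x"
  shows "summable (\<lambda>j. (x j)\<^sup>2)"
  by (rule summable_comparison_test'[OF assms(3), of 0])
    (use assms(1,2) in \<open>simp add: power2_eq_square mult_left_le\<close>)

lemma
  assumes \<omega>: "\<omega> \<in> thoma_cone"
  shows alpha_fraction: "decseq (\<lambda>j. alpha_fraction j \<omega>)" "0 \<le> alpha_fraction j \<omega>" "alpha_fraction j \<omega> \<le> 1"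
      "summable (\<lambda>j. alpha_fraction j \<omega>)" "fst \<omega> j = snd (snd \<omega>) * alpha_fraction j \<omega>"
    and beta_fraction: "decseq (\<lambda>j. beta_fraction j \<omega>)" "0 \<le> beta_fraction j \<omega>" "beta_fraction j \<omega> \<le> 1"
      "summable (\<lambda>j. beta_fraction j \<omega>)" "fst (snd \<omega>) j = snd (snd \<omega>) * beta_fraction j \<omega>"
proof -
  note c = cone_coordinates[OF \<omega>]
  have r: "0 \<le> snd (snd \<omega>)" using c(3)[of 0] c(7)[of 0] by simp
  show "decseq (\<lambda>j. alpha_fraction j \<omega>)" "decseq (\<lambda>j. beta_fraction j \<omega>)"
    using c(1,2) r by (simp_all add: decseq_def alpha_fraction_def beta_fraction_def divide_right_mono)
  show "0 \<le> alpha_fraction j \<omega>" "0 \<le> beta_fraction j \<omega>"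
    using c(3,4)[of j] r by (simp_all add: alpha_fraction_def beta_fraction_def)
  show "alpha_fraction j \<omega> \<le> 1" "beta_fraction j \<omega> \<le> 1"
    using c(7,8)[of j] r by (auto simp: alpha_fraction_def beta_fraction_def divide_le_eq_1)
  show "summable (\<lambda>j. alpha_fraction j \<omega>)" "summable (\<lambda>j. beta_fraction j \<omega>)"
    using c(5,6) by (simp_all add: alpha_fraction_def beta_fraction_def summable_divide)
  show "fst \<omega> j = snd (snd \<omega>) * alpha_fraction j \<omega>" "fst (snd \<omega>) j = snd (snd \<omega>) * beta_fraction j \<omega>"
    using c(3,4,7,8)[of j] by (auto simp: alpha_fraction_def beta_fraction_def)
qed

lemma
  assumes \<omega>: "\<omega> \<in> thoma_cone"
  shows alpha_fraction_abs: "\<bar>alpha_fraction j \<omega>\<bar> \<le> 1" and alpha_fraction_squares: "summable (\<lambda>j. (alpha_fraction j \<omega>)\<^sup>2)"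
    and beta_fraction_abs: "\<bar>- beta_fraction j \<omega>\<bar> \<le> 1" and beta_fraction_squares: "summable (\<lambda>j. (- beta_fraction j \<omega>)\<^sup>2)"
proof -
  note a = alpha_fraction[OF \<omega>] and b = beta_fraction[OF \<omega>]
  show "\<bar>alpha_fraction j \<omega>\<bar> \<le> 1" "\<bar>- beta_fraction j \<omega>\<bar> \<le> 1" using a(2,3)[of j] b(2,3)[of j] by simp_all
  show "summable (\<lambda>j. (alpha_fraction j \<omega>)\<^sup>2)" by (rule unit_sequence_summable_squares[OF a(2-4)])
  show "summable (\<lambda>j. (- beta_fraction j \<omega>)\<^sup>2)"
    using unit_sequence_summable_squares[OF b(2-4)] by (simp only: power2_minus)
qed

text \<open>Integral of \<open>g\<close> against the signed measure \<open>\<Sum> x\<^sub>j\<^sup>2 \<delta>(x\<^sub>j) - \<Sum> y\<^sub>j\<^sup>2 \<delta>(-y\<^sub>j)\<close>, whose moments are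
  the power sums divided by the powers of \<open>r\<close>.\<close>

definition moment :: "(real \<Rightarrow> real) \<Rightarrow> thoma_point \<Rightarrow> real" where
  "moment g \<omega> = suminf (\<lambda>j. (alpha_fraction j \<omega>)\<^sup>2 * g (alpha_fraction j \<omega>)) -
     suminf (\<lambda>j. (- beta_fraction j \<omega>)\<^sup>2 * g (- beta_fraction j \<omega>))"

text \<open>The weight x^2 shifts exponents to i + 2, which avoids p_1, and placing the
  \<beta>-atoms at negative points with negative mass reproduces the sign (-1)^{k-1} in p_k.\<close>

lemma moment_power:
  assumes \<omega>: "\<omega> \<in> thoma_cone"
  shows "moment (\<lambda>y. y ^ i) \<omega> = power_sum_at (Suc (Suc i)) \<omega> / snd (snd \<omega>) ^ Suc (Suc i)"
proof (cases "snd (snd \<omega>) = 0")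
  case True
  then show ?thesis by (simp add: moment_def alpha_fraction_def beta_fraction_def)
next
  case False
  note c = cone_coordinates[OF \<omega>]
  let ?k = "Suc (Suc i)"
  have sq: "x\<^sup>2 * x ^ i = x ^ ?k" for x :: real by (simp add: power2_eq_square)
  have a: "suminf (\<lambda>j. (alpha_fraction j \<omega>)\<^sup>2 * alpha_fraction j \<omega> ^ i) = suminf (\<lambda>j. fst \<omega> j ^ ?k) / snd (snd \<omega>) ^ ?k"
    unfolding suminf_divide[OF cone_summable_power(1)[OF c(3) c(5)], symmetric]
    by (simp only: sq) (simp only: alpha_fraction_def power_divide)
  have "suminf (\<lambda>j. (- beta_fraction j \<omega>)\<^sup>2 * (- beta_fraction j \<omega>) ^ i) =
      suminf (\<lambda>j. (- 1) ^ ?k * (fst (snd \<omega>) j ^ ?k / snd (snd \<omega>) ^ ?k))"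
    unfolding sq unfolding power_minus[of "beta_fraction _ _"] by (simp only: beta_fraction_def power_divide)
  also have "\<dots> = (- 1) ^ ?k * (suminf (\<lambda>j. fst (snd \<omega>) j ^ ?k) / snd (snd \<omega>) ^ ?k)"
    unfolding suminf_divide[OF cone_summable_power(1)[OF c(4) c(6)], symmetric]
    by (rule suminf_mult) (rule summable_divide[OF cone_summable_power(1)[OF c(4) c(6)]])
  finally have b: "suminf (\<lambda>j. (- beta_fraction j \<omega>)\<^sup>2 * (- beta_fraction j \<omega>) ^ i) = \<dots>" .
  obtain \<alpha> \<beta> r where \<omega>_eq: "\<omega> = (\<alpha>, \<beta>, r)" by (rule prod_cases3)
  have "power_sum_at ?k \<omega> = suminf (\<lambda>j. fst \<omega> j ^ ?k) - (- 1) ^ ?k * suminf (\<lambda>j. fst (snd \<omega>) j ^ ?k)"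
    unfolding \<omega>_eq by simp
  then show ?thesis unfolding moment_def a b by (simp only: diff_divide_distrib times_divide_eq_right)
qed

lemma moment_polynomial:
  assumes \<omega>: "\<omega> \<in> thoma_cone"
  shows "moment (\<lambda>y. \<Sum>i\<le>n. a i * y ^ i) \<omega> = (\<Sum>i\<le>n. a i * moment (\<lambda>y. y ^ i) \<omega>)"
  unfolding moment_def
    suminf_square_polynomial[OF alpha_fraction_abs[OF \<omega>] alpha_fraction_squares[OF \<omega>]]
    suminf_square_polynomial[OF beta_fraction_abs[OF \<omega>] beta_fraction_squares[OF \<omega>]]
  by (simp only: sum_subtractf right_diff_distrib)

context thoma_lifting
begin

text \<open>Normalized coordinates lie in [-1, 1] for every point of the cone, so one sequence of
  approximating polynomials works for all points simultaneously.\<close>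

lemma moment_measurable:
  assumes g: "continuous_on UNIV g"
  shows "moment g \<in> borel_measurable N"
proof -
  obtain a n where p: "\<And>m x. \<bar>x\<bar> \<le> 1 \<Longrightarrow> \<bar>g x - (\<Sum>i\<le>n m. a m i * x ^ i)\<bar> < 1 / real (Suc m)"
    using polynomial_approximation[OF g] by blast
  obtain B where B: "\<And>x. \<bar>x\<bar> \<le> 1 \<Longrightarrow> \<bar>g x\<bar> \<le> B"
    using continuous_bounded[OF g] by blast
  show ?thesis
  proof (rule borel_measurable_LIMSEQ_real)
    fix m
    have *: "(\<lambda>\<omega>. \<Sum>i\<le>n m. a m i * (power_sum_at (Suc (Suc i)) \<omega> / snd (snd \<omega>) ^ Suc (Suc i))) \<in> borel_measurable N"
      by (intro borel_measurable_sum borel_measurable_times borel_measurable_const borel_measurable_divide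
          borel_measurable_power power_sum_at_measurable_N radius_measurable_N)
    show "moment (\<lambda>y. \<Sum>i\<le>n m. a m i * y ^ i) \<in> borel_measurable N"
      by (rule measurable_cong[THEN iffD2, OF _ *]) (simp only: space_N moment_polynomial moment_power)
  next
    fix \<omega> assume "\<omega> \<in> space N"
    then have \<omega>: "\<omega> \<in> thoma_cone" by (simp add: space_N)
    show "(\<lambda>m. moment (\<lambda>y. \<Sum>i\<le>n m. a m i * y ^ i) \<omega>) \<longlonglongrightarrow> moment g \<omega>"
      unfolding moment_def
      by (intro tendsto_diff polynomial_moment_limit[where B = B] p B
          alpha_fraction_abs[OF \<omega>] alpha_fraction_squares[OF \<omega>] beta_fraction_abs[OF \<omega>] beta_fraction_squares[OF \<omega>])
  qed
qed

text \<open>A test function vanishing on the negative half-line sees only the \<alpha>-atoms; its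
  reflection sees only the \<beta>-atoms, up to sign.\<close>

lemma fraction_measurable:
  "alpha_fraction j \<in> borel_measurable N" "beta_fraction j \<in> borel_measurable N"
proof -
  \<comment> \<open>The quotient undoes the weight x^2 of \<open>moment\<close>, leaving the
    positive part of x - t; the maximum with t keeps the denominator away from 0, so the function is
    continuous.\<close>
  let ?g = "\<lambda>t x. max 0 (x - t) / (max t x)\<^sup>2 :: real"
  have cont: "continuous_on UNIV (?g t)" "continuous_on UNIV (\<lambda>x. ?g t (- x))" if "t > 0" for t
    using that by (intro continuous_intros; simp add: max_def)+
  have pos: "x\<^sup>2 * ?g t x = max 0 (x - t)" if "t > 0" for t x :: real
    using that by (cases "x \<le> t") (simp_all add: max_def)
  have neg: "?g t (- x) = 0" if "t > 0" "0 \<le> x" for t x :: real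
    using that by (simp add: max_def)
  have alpha: "suminf (\<lambda>j. max 0 (alpha_fraction j \<omega> - t)) = moment (?g t) \<omega>"
    and beta: "suminf (\<lambda>j. max 0 (beta_fraction j \<omega> - t)) = - moment (\<lambda>x. ?g t (- x)) \<omega>"
    if t: "t > 0" and \<omega>: "\<omega> \<in> thoma_cone" for t \<omega>
    unfolding moment_def minus_minus power2_minus pos[OF t] neg[OF t alpha_fraction(2)[OF \<omega>]]
      neg[OF t beta_fraction(2)[OF \<omega>]]
    by simp_all
  have meas: "(\<lambda>\<omega>. suminf (\<lambda>j. max 0 (alpha_fraction j \<omega> - t))) \<in> borel_measurable N"
    "(\<lambda>\<omega>. suminf (\<lambda>j. max 0 (beta_fraction j \<omega> - t))) \<in> borel_measurable N" if t: "t > 0" for t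
    by (rule measurable_cong[THEN iffD2, OF _ moment_measurable[OF cont(1)[OF t]]], simp only: space_N alpha[OF t])
      (rule measurable_cong[THEN iffD2, OF _ borel_measurable_uminus[OF moment_measurable[OF cont(2)[OF t]]]],
        simp only: space_N beta[OF t])
  show "alpha_fraction j \<in> borel_measurable N"
    by (rule measurable_from_truncated_sums[of N alpha_fraction]) (simp_all only: space_N alpha_fraction meas)
  show "beta_fraction j \<in> borel_measurable N"
    by (rule measurable_from_truncated_sums[of N beta_fraction]) (simp_all only: space_N beta_fraction meas)
qed

text \<open>Once r and all coordinates are measurable for \<open>N\<close>, so is the identity map
  into the Borel space; hence \<open>N\<close> contains every Borel subset of the cone.\<close>

lemma multiplier_indicator:
  assumes A: "A \<in> sets M"
  shows "multiplier (indicator A)"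
proof -
  have alpha: "(\<lambda>\<omega>. fst \<omega> j) \<in> borel_measurable N" for j
  proof -
    have *: "(\<lambda>\<omega>. snd (snd \<omega>) * alpha_fraction j \<omega>) \<in> borel_measurable N"
      by (intro borel_measurable_times radius_measurable_N fraction_measurable)
    show ?thesis
      by (rule measurable_cong[THEN iffD2, OF _ *]) (simp only: space_N alpha_fraction(5))
  qed
  have beta: "(\<lambda>\<omega>. fst (snd \<omega>) j) \<in> borel_measurable N" for j
  proof -
    have *: "(\<lambda>\<omega>. snd (snd \<omega>) * beta_fraction j \<omega>) \<in> borel_measurable N"
      by (intro borel_measurable_times radius_measurable_N fraction_measurable)
    show ?thesis
      by (rule measurable_cong[THEN iffD2, OF _ *]) (simp only: space_N beta_fraction(5))
  qed
  have "(\<lambda>\<omega>. (fst \<omega>, fst (snd \<omega>), snd (snd \<omega>))) \<in> borel_measurable N"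
    by (intro borel_measurable_Pair measurable_coordinatewise_then_product radius_measurable_N alpha beta)
  then have id: "(\<lambda>\<omega>. \<omega>) \<in> borel_measurable N" by simp
  obtain B where "B \<in> sets borel" "A = thoma_cone \<inter> B"
    using A unfolding sets_M sets_restrict_space by auto
  then have "A \<in> sets N"
    using measurable_sets[OF id, of B] by (simp add: space_N Int_commute)
  then show ?thesis by (simp add: sets_N multiplier_sets_def)
qed

lemma approximable_sum:
  "(\<And>i. i \<in> I \<Longrightarrow> approximable (f i)) \<Longrightarrow> approximable (\<lambda>\<omega>. \<Sum>i\<in>I. f i \<omega>)"
proof (induction I rule: infinite_finite_induct)
  case (insert i I)
  then show ?case by (simp add: approximable_add)
qed (use approximable_sym_eval[of 0] in \<open>simp_all add: sym_eval_0[abs_def]\<close>)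

text \<open>Simple functions bounded by 2 |g| converge to g pointwise, and dominated convergence
  brings g into the closure.\<close>

lemma square_integrable_approximable:
  assumes g: "square_integrable M g"
  shows "approximable g"
proof -
  have gM: "g \<in> borel_measurable M" using g by (simp add: square_integrable_def)
  obtain s where s: "\<And>n. simple_function M (s n)"
    and lim: "\<And>\<omega>. \<omega> \<in> space M \<Longrightarrow> (\<lambda>n. s n \<omega>) \<longlonglongrightarrow> g \<omega>"
    and bound: "\<And>n \<omega>. \<omega> \<in> space M \<Longrightarrow> dist (s n \<omega>) 0 \<le> 2 * dist (g \<omega>) 0"
    using borel_measurable_implies_sequence_metric[OF gM, of 0] by blast
  let ?A = "\<lambda>n y. s n -` {y} \<inter> space M"
  \<comment> \<open>The factor \<open>sym_eval 1\<close> is the constant 1; it presents each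
    indicator as a multiplier applied to a symmetric function.\<close>
  let ?u = "\<lambda>n \<omega>. \<Sum>y\<in>s n ` space M. y * (of_real (indicator (?A n y) \<omega>) * sym_eval 1 \<omega>)"
  have eq: "?u n \<omega> = s n \<omega>" if "\<omega> \<in> thoma_cone" for n \<omega>
  proof -
    have "s n \<omega> = (\<Sum>y\<in>s n ` space M. indicator (?A n y) \<omega> *\<^sub>R y)"
      by (rule simple_function_indicator_representation_banach[OF s]) (simp only: space_M that)
    then show ?thesis by (simp only: sym_eval_1 scaleR_conv_of_real mult_1_left mult_1_right mult.commute)
  qed
  show ?thesis
  proof (rule approximable_dominated[OF gM])
    show "approximable (?u n)" for n
    proof (rule approximable_sum, rule approximable_scale)
      fix y
      have "?A n y \<in> sets M" by (rule simple_functionD(2)[OF s])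
      from multiplier_indicator[OF this] show "approximable (\<lambda>\<omega>. of_real (indicator (?A n y) \<omega>) * sym_eval 1 \<omega>)"
        using approximable_sym_eval[of 1] by (simp only: multiplier_def)
    qed
    show "integrable M (\<lambda>\<omega>. (2 * cmod (g \<omega>))\<^sup>2)"
      using g by (simp add: square_integrable_def power_mult_distrib)
    fix \<omega> assume \<omega>: "\<omega> \<in> thoma_cone"
    show "(\<lambda>n. ?u n \<omega>) \<longlonglongrightarrow> g \<omega>" unfolding eq[OF \<omega>] using lim \<omega> by (simp add: space_M)
    show "cmod (?u n \<omega>) \<le> 2 * cmod (g \<omega>)" for n
      unfolding eq[OF \<omega>] using bound[of \<omega> n] \<omega> by (simp add: space_M)
  qed
qed

end

text \<open>For density, an approximating symmetric function is itself a finite combination of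
  Laguerre functions, by \<open>laguerre_sym_expand\<close>.\<close>

lemma (in orthogonal_z_measure) orthogonal_basis_laguerre:
  "orthogonal_basis_L2 M young (\<lambda>\<nu>. sym_eval (laguerre_sym z z' \<nu>))"
  unfolding orthogonal_basis_L2_def
proof (intro conjI ballI impI allI)
  fix g and \<epsilon> :: real assume g: "square_integrable M g" and "\<epsilon> > 0"
  then obtain F :: "complex sym" where F: "(\<integral>\<omega>. (cmod (g \<omega> - sym_eval F \<omega>))\<^sup>2 \<partial>M) < \<epsilon>"
    using square_integrable_approximable[OF g] unfolding approximable_def by blast
  let ?G = "exp_D 1 F"
  have inj: "inj_on part (supp ?G)"
    by (rule inj_on_inverseI[of _ boxes]) (simp add: supp_def)
  have "sym_eval F \<omega> = (\<Sum>\<nu>\<in>part ` supp ?G. coef (boxes \<nu>) ?G * sym_eval (laguerre_sym z z' \<nu>) \<omega>)" for \<omega>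
  proof -
    have "sym_eval F \<omega> = (\<Sum>X\<in>supp ?G. coef X ?G * sym_eval (laguerre_sym z z' (part X)) \<omega>)"
      by (subst laguerre_sym_expand[of F z z']) (simp only: sym_eval_sum sym_eval_const_times)
    also have "\<dots> = (\<Sum>X\<in>supp ?G. coef (boxes (part X)) ?G * sym_eval (laguerre_sym z z' (part X)) \<omega>)"
      by (rule sum.cong) (simp_all add: supp_def)
    finally show ?thesis by (simp add: sum.reindex[OF inj])
  qed
  then have "(\<integral>\<omega>. (cmod (g \<omega> - (\<Sum>\<nu>\<in>part ` supp ?G. coef (boxes \<nu>) ?G * sym_eval (laguerre_sym z z' \<nu>) \<omega>)))\<^sup>2 \<partial>M) < \<epsilon>"
    using F by simp
  moreover have "finite (part ` supp ?G)" "part ` supp ?G \<subseteq> young"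
    using finite_supp[of ?G] by (auto simp: supp_def)
  ultimately show "\<exists>J a. finite J \<and> J \<subseteq> young \<and>
      (\<integral>\<omega>. (cmod (g \<omega> - (\<Sum>\<nu>\<in>J. a \<nu> * sym_eval (laguerre_sym z z' \<nu>) \<omega>)))\<^sup>2 \<partial>M) < \<epsilon>"
    by (intro exI[of _ "part ` supp ?G"] exI[of _ "\<lambda>\<nu>. coef (boxes \<nu>) ?G"] conjI)
qed (simp_all add: square_integrable_sym_eval integral_laguerre_square_nonzero integral_laguerre_mult)

theorem theorem5p18:
  fixes z z' :: complex and P :: "thoma_point measure"
  assumes "admissible z z'"
    and "is_z_measure z z' P"
  shows "(\<forall>F :: real sym.
            integrable (lifting P (Re (z * z'))) (sym_eval F) \<and>
            laguerre_functional z z' (complexify F) =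
              complex_of_real (\<integral>\<omega>. sym_eval F \<omega> \<partial>lifting P (Re (z * z')))) \<and>
         (principal_series z z' \<or> complementary_series z z' \<longrightarrow>
            orthogonal_basis_L2 (lifting P (Re (z * z'))) young
              (\<lambda>\<nu>. sym_eval (laguerre_sym z z' \<nu>)))"
proof (intro conjI allI impI)
  interpret z_measure z z' P "Re (z * z')"
    by (rule z_measure.intro[OF admissible_product_pos(2,1)[OF assms(1)] assms(2)])
  show "integrable (lifting P (Re (z * z'))) (sym_eval F)" for F :: "real sym"
    by (rule integrable_sym_eval)
  show "laguerre_functional z z' (complexify F) =
      complex_of_real (\<integral>\<omega>. sym_eval F \<omega> \<partial>lifting P (Re (z * z')))" for F :: "real sym"
    unfolding laguerre_functional_eq sym_eval_complexify by (rule integral_complex_of_real)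
  assume "principal_series z z' \<or> complementary_series z z'"
  then interpret orthogonal_z_measure z z' P "Re (z * z')"
    by unfold_locales (rule box_weight_series; assumption)+
  show "orthogonal_basis_L2 (lifting P (Re (z * z'))) young (\<lambda>\<nu>. sym_eval (laguerre_sym z z' \<nu>))"
    by (rule orthogonal_basis_laguerre)
qed

end
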